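(* Let $\varrho\in[0,1]$ and let $a(x,\xi)\in L^\infty S^m_\varrho$ on $\mathbf{R}^n\times\mathbf{R}^n$, with $m<-\frac{n+1}{2}\varrho+n(\varrho-1)$, be compactly supported in the $x$ variable. Let the real phase function $\varphi(x,\xi)\in C^\infty(\mathbf{R}^n\times(\mathbf{R}^n\setminus0))$, positively homogeneous of degree $1$ in $\xi$, satisfy $\operatorname{rank}\partial^2_{\xi\xi}\varphi(x,\xi)=n-1$. Then the corresponding Fourier integral operator $T_{a,\varphi}$ is bounded on $L^p_w$ for $1<p<\infty$ and all $w\in A_p$.
   Context: Notation: $\langle\xi\rangle=(1+|\xi|^2)^{1/2}$; $\widehat u(\xi)=\int e^{-i\langle x,\xi\rangle}u(x)\,dx$. Operator: $T_{a,\varphi}u(x)=(2\pi)^{-n}\int_{\mathbf{R}^n}e^{i\varphi(x,\xi)}a(x,\xi)\widehat u(\xi)\,d\xi$, $u\in\mathscr{S}(\mathbf{R}^n)$. Class $L^\infty S^m_\varrho$: functions $a(x,\xi)$, smooth in $\xi$ and bounded measurable in $x$, such that for every multi-index $\alpha$, $\sup_{\xi}\langle\xi\rangle^{-m+\varrho|\alpha|}\|\partial_\xi^\alpha a(\cdot,\xi)\|_{L^\infty(\mathbf{R}^n)}<\infty$. Weights: for $1<p<\infty$, $w\in A_p$ means $w$ is positive, locally integrable and $\sup_B w_B\big((w^{-1/(p-1)})_B\big)^{p-1}<\infty$ over balls $B\subset\mathbf{R}^n$ ($f_B$ the average over $B$). $\|u\|_{L^p_w}=(\int|u|^pw\,dx)^{1/p}$;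 bounded on $L^p_w$ means $\|Tu\|_{L^p_w}\le C\|u\|_{L^p_w}$ for all $u\in\mathscr{S}(\mathbf{R}^n)$. *)

theory Defs
  imports "HOL-Analysis.Analysis" "HOL-Probability.Essential_Supremum"
begin

section \<open>Smooth functions and multi-index derivatives\<close>

text \<open>For open \<open>S\<close> this is the class of \<open>k\<close> times continuously differentiable functions on \<open>S\<close>:
  \<open>f\<close> is differentiable and its first partial derivatives are of class \<open>k - 1\<close>.\<close>

primrec Ck_on :: "nat \<Rightarrow> 'a::euclidean_space set \<Rightarrow> ('a \<Rightarrow> 'b::real_normed_vector) \<Rightarrow> bool" where
  "Ck_on 0 S f \<longleftrightarrow> continuous_on S f"
| "Ck_on (Suc k) S f \<longleftrightarrow> (\<forall>x\<in>S. f differentiable (at x)) \<and>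
     (\<forall>b\<in>Basis. Ck_on k S (\<lambda>x. frechet_derivative f (at x) b))"

definition smooth_on :: "'a::euclidean_space set \<Rightarrow> ('a \<Rightarrow> 'b::real_normed_vector) \<Rightarrow> bool" where
  "smooth_on S f \<longleftrightarrow> (\<forall>k. Ck_on k S f)"

definition partial :: "'n::finite \<Rightarrow> (real^'n \<Rightarrow> 'b::real_normed_vector) \<Rightarrow> real^'n \<Rightarrow> 'b" where
  "partial i f x = frechet_derivative f (at x) (axis i 1)"

text \<open>The index type carries no order, so an enumeration of the coordinates is chosen in order to
  compose the partial derivatives; on smooth functions they commute and the choice is immaterial.\<close>

definition coords :: "'n::finite list" where
  "coords = (SOME is. distinct is \<and> set is = UNIV)"

definition mderiv :: "('n::finite \<Rightarrow> nat) \<Rightarrow> (real^'n \<Rightarrow> 'b::real_normed_vector) \<Rightarrow> real^'n \<Rightarrow> 'b" where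
  "mderiv \<alpha> f = foldr (\<lambda>i. partial i ^^ \<alpha> i) coords f"

definition mlength :: "('n::finite \<Rightarrow> nat) \<Rightarrow> nat" where
  "mlength \<alpha> = (\<Sum>i\<in>UNIV. \<alpha> i)"

definition mpower :: "real^'n \<Rightarrow> ('n::finite \<Rightarrow> nat) \<Rightarrow> real" where
  "mpower x \<alpha> = (\<Prod>i\<in>UNIV. (x $ i) ^ \<alpha> i)"

definition hessian :: "(real^'n::finite \<Rightarrow> real) \<Rightarrow> real^'n \<Rightarrow> real^'n^'n" where
  "hessian f x = (\<chi> i j. partial i (partial j f) x)"


section \<open>Schwartz functions, symbols and Fourier integral operators\<close>

definition schwartz :: "(real^'n::finite \<Rightarrow> complex) \<Rightarrow> bool" where
  "schwartz u \<longleftrightarrow> smooth_on UNIV u \<and>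
     (\<forall>\<alpha> \<beta>. bounded (range (\<lambda>x. mpower x \<alpha> *\<^sub>R mderiv \<beta> u x)))"

definition fourier :: "(real^'n::finite \<Rightarrow> complex) \<Rightarrow> real^'n \<Rightarrow> complex" where
  "fourier u \<xi> = (LINT x|lebesgue. cis (- (x \<bullet> \<xi>)) * u x)"

definition japanese :: "real^'n::finite \<Rightarrow> real" where
  "japanese \<xi> = sqrt (1 + (norm \<xi>)\<^sup>2)"

definition Linf_norm :: "(real^'n::finite \<Rightarrow> complex) \<Rightarrow> ennreal" where
  "Linf_norm f = esssup lebesgue (\<lambda>x. ennreal (norm (f x)))"

text \<open>Boundedness in \<open>x\<close> is the case \<open>\<alpha> = 0\<close> of the last condition.\<close>

definition symbol_class :: "real \<Rightarrow> real \<Rightarrow> (real^'n::finite \<Rightarrow> real^'n \<Rightarrow> complex) set" where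
  "symbol_class m \<rho> = {a.
     (\<forall>x. smooth_on UNIV (a x)) \<and>
     (\<forall>\<xi>. (\<lambda>x. a x \<xi>) \<in> borel_measurable lebesgue) \<and>
     (\<forall>\<alpha>. (SUP \<xi>. ennreal (japanese \<xi> powr (- m + \<rho> * real (mlength \<alpha>))) *
               Linf_norm (\<lambda>x. mderiv \<alpha> (a x) \<xi>)) < \<infinity>)}"

definition FIO :: "(real^'n::finite \<Rightarrow> real^'n \<Rightarrow> complex) \<Rightarrow> (real^'n \<Rightarrow> real^'n \<Rightarrow> real) \<Rightarrow>
    (real^'n \<Rightarrow> complex) \<Rightarrow> real^'n \<Rightarrow> complex" where
  "FIO a \<phi> u x = complex_of_real ((2 * pi) powr (- real CARD('n))) *
     (LINT \<xi>|lebesgue. cis (\<phi> x \<xi>) * a x \<xi> * fourier u \<xi>)"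


section \<open>Muckenhoupt weights and weighted Lebesgue spaces\<close>

text \<open>Powers with positive exponent on \<open>[0, \<infinity>]\<close>. Averages and norms take values there, so that
  divergent integrals are infinite instead of \<open>0\<close>.\<close>

definition epowr :: "ennreal \<Rightarrow> real \<Rightarrow> ennreal" where
  "epowr t s = (if t = \<infinity> then \<infinity> else ennreal (enn2real t powr s))"

definition ball_avg :: "real^'n::finite \<Rightarrow> real \<Rightarrow> (real^'n \<Rightarrow> real) \<Rightarrow> ennreal" where
  "ball_avg c r f = (\<integral>\<^sup>+x\<in>ball c r. ennreal (f x) \<partial>lebesgue) / emeasure lebesgue (ball c r)"

definition locally_integrable :: "(real^'n::finite \<Rightarrow> real) \<Rightarrow> bool" where
  "locally_integrable f \<longleftrightarrow> (\<forall>K. compact K \<longrightarrow> set_integrable lebesgue K f)"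

definition Ap_weights :: "real \<Rightarrow> (real^'n::finite \<Rightarrow> real) set" where
  "Ap_weights p = {w. (\<forall>x. 0 < w x) \<and> locally_integrable w \<and>
     (SUP (c, r)\<in>UNIV \<times> {0<..}.
        ball_avg c r w * epowr (ball_avg c r (\<lambda>x. w x powr (- 1 / (p - 1)))) (p - 1)) < \<infinity>}"

definition Lpw_norm :: "real \<Rightarrow> (real^'n::finite \<Rightarrow> real) \<Rightarrow> (real^'n \<Rightarrow> complex) \<Rightarrow> ennreal" where
  "Lpw_norm p w u = epowr (\<integral>\<^sup>+x. ennreal (norm (u x) powr p * w x) \<partial>lebesgue) (1 / p)"

text \<open>Measurability of \<open>T u\<close> is required because the integral in the norm is only a lower integral
  for functions that are not measurable.\<close>

definition bounded_on_Lpw :: "real \<Rightarrow> (real^'n::finite \<Rightarrow> real) \<Rightarrow>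
    ((real^'n \<Rightarrow> complex) \<Rightarrow> real^'n \<Rightarrow> complex) \<Rightarrow> bool" where
  "bounded_on_Lpw p w T \<longleftrightarrow> (\<exists>C\<ge>0. \<forall>u. schwartz u \<longrightarrow>
     T u \<in> borel_measurable lebesgue \<and> Lpw_norm p w (T u) \<le> ennreal C * Lpw_norm p w u)"

end

theory Submission
  imports Defs
begin

text \<open>Write \<open>n\<close> for the dimension and \<open>K\<close> for the compact \<open>x\<close>-support of the symbol.  The order condition says
  exactly that \<open>m - \<rho> * (n - 1) / 2 < - n\<close>.  Stationary phase gains \<open>(n - 1) / 2\<close> powers of \<open>\<bar>\<xi>\<bar> powr \<rho>\<close>
  from the \<open>n - 1\<close> nonvanishing curvatures of the phase, so the frequencies of size \<open>\<mu>\<close> contribute to the kernel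
  of the operator at most \<open>\<mu> powr (m + n - \<rho> * (n - 1) / 2)\<close>, which is summable: the high frequencies have a bounded
  kernel that decays in \<open>y\<close>.  The low frequencies see the singularity of the phase at the origin and give
  decay of every order \<open>s < n\<close>.  Hence for almost all \<open>x \<in> K\<close>

    \<open>\<bar>T u x\<bar> \<le> M * (\<integral> (1 + \<bar>y\<bar>) powr (- s) * \<bar>u y\<bar> \<partial>y)\<close>,

  and no maximal function is needed, because \<open>T u\<close> lives on \<open>K\<close>: Hoelder's inequality bounds the right-hand side
  by the \<open>L\<^sup>p\<close> norm of \<open>u\<close> with weight \<open>w\<close> as soon as \<open>(1 + \<bar>y\<bar>) powr (- s * p / (p - 1))\<close> is integrable
  against the dual weight \<open>w powr (- 1 / (p - 1))\<close>.  This holds for some \<open>s < n\<close> that depends on \<open>w\<close>, by the reverse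
  doubling property of \<open>A\<^sub>p\<close> weights (lemma \<open>Ap_dual_weight_decay\<close>).

  The frequencies are localized by a continuous partition of unity: \<open>localizer \<xi> \<eta>\<close> lives on \<open>\<bar>\<xi> - \<eta>\<bar> < \<delta> * \<bar>\<xi>\<bar>\<close>
  and has constant mass in \<open>\<eta>\<close>.  With \<open>\<eta> = \<mu> *\<^sub>R \<omega>\<close>, \<open>\<bar>\<omega>\<bar> = 1\<close>, a dilation by \<open>\<mu>\<close> moves each piece to a small ball around
  \<open>\<omega>\<close>, where \<open>\<phi>\<close> becomes \<open>\<mu>\<close> times a smooth function and the symbol has derivatives that grow
  by \<open>\<mu> powr (1 - \<rho>)\<close> at each order; estimating each piece and integrating in \<open>\<eta>\<close> replaces a dyadic decomposition.

  Two estimates of a piece suffice.  For large \<open>y\<close> the phase has no stationary point, and \<open>n\<close> integrations by parts give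
  the decay in \<open>y\<close> (\<open>kernel_bound_large_y\<close>).  For the uniform bound (\<open>kernel_bound_stationary\<close>) the square of the
  integral is estimated by correlations of the integrand with its translates
  (\<open>norm_integral_squared_le_correlations\<close>).  In a correlation at distance \<open>h\<close> the linear term \<open>y \<bullet> \<xi>\<close> drops out,
  and the phase difference has gradient comparable to \<open>\<bar>h\<bar>\<close>, unless \<open>h\<close> is nearly radial, because the Hessian
  vanishes in the radial direction only (\<open>gradient_separation\<close>).  Integration by parts makes the
  correlation small beyond the distance \<open>\<mu> powr (- \<rho>)\<close>.  Averaging over translates in a box that has this thickness in
  one coordinate, so that long translations are far from radial, gives the square root of \<open>\<mu> powr (- \<rho> * (n - 1))\<close>.

  Every integration by parts (\<open>nonstationary_phase\<close>) uses one coordinate direction, chosen so that the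
  corresponding component of the gradient is large.  Hence only pure derivatives \<open>\<partial>\<^sub>j\<^sup>k\<close> of the symbol enter,
  and only these and their gradients for the phase.\<close>

section \<open>Derivatives along a line\<close>

text \<open>The first \<open>k\<close> derivatives along \<open>e\<close> are bounded by one and the same \<open>M\<close>.  A function whose derivatives
  grow geometrically is covered as well, by a shorter direction \<open>e\<close>.\<close>

primrec bounded_derivs ::
    "'a::real_normed_vector \<Rightarrow> 'a set \<Rightarrow> nat \<Rightarrow> real \<Rightarrow> ('a \<Rightarrow> 'b::real_normed_vector) \<Rightarrow> bool" where
  "bounded_derivs e S 0 M f \<longleftrightarrow> continuous_on S f \<and> (\<forall>x\<in>S. norm (f x) \<le> M)"
| "bounded_derivs e S (Suc k) M f \<longleftrightarrow> continuous_on S f \<and> (\<forall>x\<in>S. norm (f x) \<le> M) \<and>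
     (\<exists>f'. (\<forall>x\<in>S. ((\<lambda>t. f (x + t *\<^sub>R e)) has_vector_derivative f' x) (at 0)) \<and>
       bounded_derivs e S k M f')"

lemma bounded_derivs_SucI:
  assumes "continuous_on S f" "\<And>x. x \<in> S \<Longrightarrow> norm (f x) \<le> M"
    and "\<And>x. x \<in> S \<Longrightarrow> ((\<lambda>t. f (x + t *\<^sub>R e)) has_vector_derivative f' x) (at 0)"
    and "bounded_derivs e S k M f'"
  shows "bounded_derivs e S (Suc k) M f"
  using assms by auto

lemma bounded_derivs_SucE:
  assumes "bounded_derivs e S (Suc k) M f"
  obtains f' where "continuous_on S f" "\<And>x. x \<in> S \<Longrightarrow> norm (f x) \<le> M"
    "\<And>x. x \<in> S \<Longrightarrow> ((\<lambda>t. f (x + t *\<^sub>R e)) has_vector_derivative f' x) (at 0)"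
    "bounded_derivs e S k M f'"
  using assms by auto

lemma bounded_derivs_continuous: "bounded_derivs e S k M f \<Longrightarrow> continuous_on S f"
  by (cases k) auto

lemma bounded_derivs_bound: "bounded_derivs e S k M f \<Longrightarrow> x \<in> S \<Longrightarrow> norm (f x) \<le> M"
  by (cases k) auto

lemma bounded_derivs_lower: "bounded_derivs e S (Suc k) M f \<Longrightarrow> bounded_derivs e S k M f"
proof (induction k arbitrary: f)
  case (Suc k)
  from Suc.prems show ?case
  proof (rule bounded_derivs_SucE)
    fix f' assume *: "continuous_on S f" "\<And>x. x \<in> S \<Longrightarrow> norm (f x) \<le> M"
      "\<And>x. x \<in> S \<Longrightarrow> ((\<lambda>t. f (x + t *\<^sub>R e)) has_vector_derivative f' x) (at 0)"
      "bounded_derivs e S (Suc k) M f'"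
    show ?thesis by (rule bounded_derivs_SucI[OF *(1-3) Suc.IH[OF *(4)]])
  qed
qed auto

lemma bounded_derivs_le_order:
  assumes "bounded_derivs e S k M f" "j \<le> k"
  shows "bounded_derivs e S j M f"
  using assms(2,1) by (induction rule: inc_induct) (auto dest: bounded_derivs_lower simp del: bounded_derivs.simps)

lemma bounded_derivs_mono:
  assumes "bounded_derivs e S k M f" "M \<le> M'" "T \<subseteq> S"
  shows "bounded_derivs e T k M' f"
  using assms(1)
proof (induction k arbitrary: f)
  case 0
  then show ?case using assms by (force intro: continuous_on_subset)
next
  case (Suc k)
  from Suc.prems show ?case
  proof (rule bounded_derivs_SucE)
    fix f' assume *: "continuous_on S f" "\<And>x. x \<in> S \<Longrightarrow> norm (f x) \<le> M"
      "\<And>x. x \<in> S \<Longrightarrow> ((\<lambda>t. f (x + t *\<^sub>R e)) has_vector_derivative f' x) (at 0)"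
      "bounded_derivs e S k M f'"
    show ?thesis
      by (rule bounded_derivs_SucI[OF _ _ _ Suc.IH[OF *(4)]])
         (use * assms(2,3) continuous_on_subset in \<open>force+\<close>)
  qed
qed

lemma line_in_open_eventually:
  fixes x e :: "'a::real_normed_vector"
  assumes "open S" "x \<in> S"
  shows "\<forall>\<^sub>F t in nhds (0::real). x + t *\<^sub>R e \<in> S"
proof -
  have "((\<lambda>t. x + t *\<^sub>R e) \<longlongrightarrow> x + 0 *\<^sub>R e) (nhds (0::real))"
    by (intro tendsto_intros filterlim_ident)
  then show ?thesis using assms by (auto simp: tendsto_def)
qed

text \<open>Amplitudes are extended by zero outside their support, so that derivatives have to be compared locally.\<close>

lemma has_vector_derivative_line_cong:
  fixes x e :: "'a::real_normed_vector" and f g :: "'a \<Rightarrow> 'b::real_normed_vector"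
  assumes "open S" "x \<in> S" "\<And>y. y \<in> S \<Longrightarrow> f y = g y"
  shows "((\<lambda>t. f (x + t *\<^sub>R e)) has_vector_derivative D) (at (0::real)) \<longleftrightarrow>
         ((\<lambda>t. g (x + t *\<^sub>R e)) has_vector_derivative D) (at 0)"
  by (rule has_vector_derivative_cong_ev)
     (use line_in_open_eventually[OF assms(1,2), of e] assms(2,3) in \<open>auto elim!: eventually_mono\<close>)

lemma bounded_derivs_cong:
  fixes f g :: "'a::real_normed_vector \<Rightarrow> 'b::real_normed_vector"
  assumes "open S" "bounded_derivs e S k M f" "\<And>x. x \<in> S \<Longrightarrow> f x = g x"
  shows "bounded_derivs e S k M g"
proof (cases k)
  case 0
  then show ?thesis using assms by (auto cong: continuous_on_cong)
next
  case (Suc l)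
  obtain f' where f': "continuous_on S f" "\<And>x. x \<in> S \<Longrightarrow> norm (f x) \<le> M"
    "\<And>x. x \<in> S \<Longrightarrow> ((\<lambda>t. f (x + t *\<^sub>R e)) has_vector_derivative f' x) (at 0)" "bounded_derivs e S l M f'"
    using assms(2) unfolding Suc by (rule bounded_derivs_SucE) (rule that)
  have "((\<lambda>t. g (x + t *\<^sub>R e)) has_vector_derivative f' x) (at 0)" if "x \<in> S" for x
    using f'(3)[OF that] has_vector_derivative_line_cong[OF assms(1) that, of f g] assms(3) by blast
  moreover have "continuous_on S g" using f'(1) assms(3) by (auto cong: continuous_on_cong)
  ultimately show ?thesis unfolding Suc
    by (rule_tac bounded_derivs_SucI[where f'=f']) (use f' assms(3) in \<open>auto simp del: bounded_derivs.simps\<close>)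
qed

lemma bounded_derivs_of_sequence:
  fixes F :: "nat \<Rightarrow> 'a::real_normed_vector \<Rightarrow> 'b::real_normed_vector"
  assumes "\<And>i. i \<le> k \<Longrightarrow> continuous_on S (F i)"
    and "\<And>i x. i \<le> k \<Longrightarrow> x \<in> S \<Longrightarrow> norm (F i x) \<le> M"
    and "\<And>i x. i < k \<Longrightarrow> x \<in> S \<Longrightarrow>
           ((\<lambda>t. F i (x + t *\<^sub>R e)) has_vector_derivative F (Suc i) x) (at 0)"
  shows "bounded_derivs e S k M (F 0)"
  using assms
proof (induction k arbitrary: F)
  case (Suc k)
  have "bounded_derivs e S k M (F (Suc 0))"
    using Suc.prems by (intro Suc.IH[where F="\<lambda>i. F (Suc i)"]) auto
  then show ?case using Suc.prems[of 0] by auto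
qed auto

lemma bounded_derivs_const: "norm c \<le> M \<Longrightarrow> bounded_derivs e S k M (\<lambda>_. c)"
proof (induction k arbitrary: c)
  case (Suc k)
  have "0 \<le> M" using Suc.prems norm_ge_zero order_trans by blast
  then show ?case using Suc by (auto intro!: exI[of _ "\<lambda>_. 0"])
qed auto

lemma bounded_derivs_add:
  assumes "bounded_derivs e S k M f" "bounded_derivs e S k M' g"
  shows "bounded_derivs e S k (M + M') (\<lambda>x. f x + g x)"
  using assms
proof (induction k arbitrary: f g)
  case 0
  then show ?case by (auto intro!: continuous_intros norm_add_rule_thm)
next
  case (Suc k)
  obtain f' where f': "continuous_on S f" "\<And>x. x \<in> S \<Longrightarrow> norm (f x) \<le> M"
    "\<And>x. x \<in> S \<Longrightarrow> ((\<lambda>t. f (x + t *\<^sub>R e)) has_vector_derivative f' x) (at 0)" "bounded_derivs e S k M f'"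
    using Suc.prems(1) by (rule bounded_derivs_SucE) (rule that)
  obtain g' where g': "continuous_on S g" "\<And>x. x \<in> S \<Longrightarrow> norm (g x) \<le> M'"
    "\<And>x. x \<in> S \<Longrightarrow> ((\<lambda>t. g (x + t *\<^sub>R e)) has_vector_derivative g' x) (at 0)" "bounded_derivs e S k M' g'"
    using Suc.prems(2) by (rule bounded_derivs_SucE) (rule that)
  show ?case
    by (rule bounded_derivs_SucI[where f'="\<lambda>x. f' x + g' x"])
       (simp_all add: f' g' Suc.IH continuous_on_add norm_add_rule_thm has_vector_derivative_add)
qed

lemma bounded_derivs_bounded_linear:
  assumes "bounded_derivs e S k M f" "bounded_linear L" "\<And>y. norm (L y) \<le> C * norm y" "0 \<le> C"
  shows "bounded_derivs e S k (C * M) (\<lambda>x. L (f x))"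
  using assms(1)
proof (induction k arbitrary: f)
  have bnd: "norm (L y) \<le> C * M" if "norm y \<le> M" for y
    using mult_left_mono[OF that assms(4)] assms(3)[of y] by linarith
  {
    case 0
    then show ?case using bnd by (auto intro: bounded_linear.continuous_on[OF assms(2)])
  next
    case (Suc k)
    obtain f' where f': "continuous_on S f" "\<And>x. x \<in> S \<Longrightarrow> norm (f x) \<le> M"
      "\<And>x. x \<in> S \<Longrightarrow> ((\<lambda>t. f (x + t *\<^sub>R e)) has_vector_derivative f' x) (at 0)" "bounded_derivs e S k M f'"
      using Suc.prems(1) by (rule bounded_derivs_SucE) (rule that)
    show ?case
      by (rule bounded_derivs_SucI[where f'="\<lambda>x. L (f' x)"])
         (simp_all add: f' bnd Suc.IH bounded_linear.continuous_on[OF assms(2)]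
            bounded_linear.has_vector_derivative[OF assms(2)])
  }
qed

text \<open>The Leibniz rule doubles the number of terms at each order, hence the factor.\<close>

lemma bounded_derivs_mult:
  fixes f g :: "'a::real_normed_vector \<Rightarrow> 'b::real_normed_algebra"
  assumes "bounded_derivs e S k M f" "bounded_derivs e S k M' g" "0 \<le> M" "0 \<le> M'"
  shows "bounded_derivs e S k (2 ^ k * (M * M')) (\<lambda>x. f x * g x)"
  using assms(1,2)
proof (induction k arbitrary: f g)
  have bnd: "norm (y * z) \<le> M * M'" if "norm y \<le> M" "norm z \<le> M'" for y z :: 'b
    using mult_mono[OF that assms(3) norm_ge_zero] norm_mult_ineq[of y z] by linarith
  {
    case 0
    then show ?case using bnd by (auto intro!: continuous_intros)
  next
    case (Suc k)
    obtain f' where f': "continuous_on S f" "\<And>x. x \<in> S \<Longrightarrow> norm (f x) \<le> M"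
      "\<And>x. x \<in> S \<Longrightarrow> ((\<lambda>t. f (x + t *\<^sub>R e)) has_vector_derivative f' x) (at 0)" "bounded_derivs e S k M f'"
      using Suc.prems(1) by (rule bounded_derivs_SucE) (rule that)
    obtain g' where g': "continuous_on S g" "\<And>x. x \<in> S \<Longrightarrow> norm (g x) \<le> M'"
      "\<And>x. x \<in> S \<Longrightarrow> ((\<lambda>t. g (x + t *\<^sub>R e)) has_vector_derivative g' x) (at 0)" "bounded_derivs e S k M' g'"
      using Suc.prems(2) by (rule bounded_derivs_SucE) (rule that)
    have fg: "bounded_derivs e S k M f" "bounded_derivs e S k M' g"
      using Suc.prems by (auto intro!: bounded_derivs_lower simp del: bounded_derivs.simps)
    have der: "((\<lambda>t. f (x + t *\<^sub>R e) * g (x + t *\<^sub>R e)) has_vector_derivative f x * g' x + f' x * g x) (at 0)"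
      if "x \<in> S" for x
      using has_vector_derivative_mult[OF f'(3)[OF that] g'(3)[OF that]] by simp
    have *: "bounded_derivs e S k (2^k * (M * M') + 2^k * (M * M')) (\<lambda>x. f x * g' x + f' x * g x)"
      by (rule bounded_derivs_add[OF Suc.IH[OF fg(1) g'(4)] Suc.IH[OF f'(4) fg(2)]])
    have le: "M * M' \<le> 2 ^ Suc k * (M * M')"
      using assms(3,4) mult_right_mono[of 1 "2 ^ Suc k" "M * M'"] one_le_power[of "2::real" "Suc k"] by simp
    show ?case
    proof (rule bounded_derivs_SucI[OF _ _ der])
      show "continuous_on S (\<lambda>x. f x * g x)" by (intro continuous_intros f' g')
      show "norm (f x * g x) \<le> 2 ^ Suc k * (M * M')" if "x \<in> S" for x
        using bnd[OF f'(2)[OF that] g'(2)[OF that]] le by linarith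
      show "bounded_derivs e S k (2 ^ Suc k * (M * M')) (\<lambda>x. f x * g' x + f' x * g x)"
      proof -
        have "2 ^ k * (M * M') + 2 ^ k * (M * M') = 2 ^ Suc k * (M * M')" by simp
        with * show ?thesis by (simp only:)
      qed
    qed
  }
qed

text \<open>A negative power of a function bounded below is treated with the exponent arbitrary, since
  differentiation lowers it.\<close>

lemma bounded_derivs_powr:
  assumes "0 < c" "0 \<le> M"
  shows "\<exists>C\<ge>0. \<forall>e S (f :: 'a::real_normed_vector \<Rightarrow> real). bounded_derivs e S k M f \<longrightarrow>
    (\<forall>x\<in>S. c \<le> f x) \<longrightarrow> bounded_derivs e S k C (\<lambda>x. f x powr s)"
proof (induction k arbitrary: s)
  case 0
  have *: "f x powr s \<le> max (M powr s) (c powr s)"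
    if "c \<le> f x" "norm (f x) \<le> M" for x and f :: "'a \<Rightarrow> real"
  proof (cases "0 \<le> s")
    case True
    then have "f x powr s \<le> M powr s" using that assms by (intro powr_mono2) auto
    then show ?thesis by simp
  next
    case False
    then have "f x powr s \<le> c powr s" using that assms by (intro powr_mono2') auto
    then show ?thesis by simp
  qed
  show ?case
  proof (intro exI[of _ "max (M powr s) (c powr s)"] conjI allI impI)
    fix e S and f :: "'a \<Rightarrow> real"
    assume f: "bounded_derivs e S 0 M f" "\<forall>x\<in>S. c \<le> f x"
    then have "continuous_on S (\<lambda>x. f x powr s)"
      using assms(1) by (intro continuous_intros) fastforce+
    then show "bounded_derivs e S 0 (max (M powr s) (c powr s)) (\<lambda>x. f x powr s)"
      using f * by auto
  qed (simp add: le_max_iff_disj)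
next
  case (Suc k)
  from Suc[of "s - 1"] obtain C1 where C1: "C1 \<ge> 0" "\<And>e S (f :: 'a \<Rightarrow> real). bounded_derivs e S k M f \<Longrightarrow>
      (\<And>x. x\<in>S \<Longrightarrow> c \<le> f x) \<Longrightarrow> bounded_derivs e S k C1 (\<lambda>x. f x powr (s - 1))"
    by blast
  from Suc[of s] obtain C2 where C2: "C2 \<ge> 0" "\<And>e S (f :: 'a \<Rightarrow> real). bounded_derivs e S k M f \<Longrightarrow>
      (\<And>x. x\<in>S \<Longrightarrow> c \<le> f x) \<Longrightarrow> bounded_derivs e S k C2 (\<lambda>x. f x powr s)"
    by blast
  define C where "C = C2 + 2^k * (C1 * (\<bar>s\<bar> * M))"
  have "bounded_derivs e S (Suc k) C (\<lambda>x. f x powr s)"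
    if f: "bounded_derivs e S (Suc k) M f" "\<forall>x\<in>S. c \<le> f x" for e S and f :: "'a \<Rightarrow> real"
  proof -
    have fk: "bounded_derivs e S k M f" using f(1) by (rule bounded_derivs_lower)
    obtain f' where f': "\<And>x. x \<in> S \<Longrightarrow> ((\<lambda>t. f (x + t *\<^sub>R e)) has_vector_derivative f' x) (at 0)"
        "bounded_derivs e S k M f'"
      using f(1) by (rule bounded_derivs_SucE) (rule that)
    have der: "((\<lambda>t. f (x + t *\<^sub>R e) powr s) has_vector_derivative f x powr (s - 1) * (s * f' x)) (at 0)"
      if "x \<in> S" for x
    proof -
      have "0 < f x" using f(2) that assms(1) by force
      moreover have "((\<lambda>t. f (x + t *\<^sub>R e)) has_real_derivative f' x) (at 0)"
        using f'(1) that by (simp add: has_real_derivative_iff_has_vector_derivative)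
      ultimately have "((\<lambda>t. f (x + t *\<^sub>R e) powr s) has_real_derivative
           s * f (x + 0 *\<^sub>R e) powr (s - of_nat 1) * f' x) (at 0)"
        by (intro DERIV_fun_powr) auto
      then show ?thesis
        by (simp add: has_real_derivative_iff_has_vector_derivative mult_ac)
    qed
    have "bounded_derivs e S k (\<bar>s\<bar> * M) (\<lambda>x. s * f' x)"
      using f'(2) by (rule bounded_derivs_bounded_linear) (auto simp: abs_mult bounded_linear_mult_right)
    then have "bounded_derivs e S k (2^k * (C1 * (\<bar>s\<bar> * M))) (\<lambda>x. f x powr (s - 1) * (s * f' x))"
      using C1 fk f(2) assms by (intro bounded_derivs_mult) auto
    then have 1: "bounded_derivs e S k C (\<lambda>x. f x powr (s - 1) * (s * f' x))"
      by (rule bounded_derivs_mono) (use C2 in \<open>auto simp: C_def\<close>)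
    have 2: "bounded_derivs e S k C (\<lambda>x. f x powr s)"
      by (rule bounded_derivs_mono[OF C2(2)[OF fk]]) (use f(2) C1(1) assms in \<open>auto simp: C_def\<close>)
    show ?thesis
      by (rule bounded_derivs_SucI[OF bounded_derivs_continuous[OF 2] bounded_derivs_bound[OF 2] der 1])
  qed
  moreover have "0 \<le> C" using C1(1) C2(1) assms by (auto simp: C_def)
  ultimately show ?case by blast
qed

lemma has_real_derivative_max0_power:
  "((\<lambda>s::real. max 0 s ^ Suc (Suc k)) has_real_derivative (2 + real k) * max 0 s ^ Suc k) (at s)"
proof -
  consider "s < 0" | "s > 0" | "s = 0" by linarith
  then show ?thesis
  proof cases
    case 1
    have "((\<lambda>s::real. max 0 s ^ Suc (Suc k)) has_real_derivative 0) (at s) \<longleftrightarrow>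
          ((\<lambda>s::real. 0) has_real_derivative 0) (at s)"
      using eventually_nhds_in_open[of "{..<0}" s] 1
      by (intro DERIV_cong_ev) (auto elim!: eventually_mono)
    then show ?thesis using 1 by simp
  next
    case 2
    have "((\<lambda>s::real. max 0 s ^ Suc (Suc k)) has_real_derivative (2 + real k) * s ^ Suc k) (at s) \<longleftrightarrow>
          ((\<lambda>s::real. s ^ Suc (Suc k)) has_real_derivative (2 + real k) * s ^ Suc k) (at s)"
      using eventually_nhds_in_open[of "{0<..}" s] 2
      by (intro DERIV_cong_ev) (auto elim!: eventually_mono)
    moreover have "((\<lambda>s::real. s ^ Suc (Suc k)) has_real_derivative (2 + real k) * s ^ Suc k) (at s)"
      by (rule derivative_eq_intros refl | simp)+
    ultimately show ?thesis using 2 by (simp add: max_def)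
  next
    case 3
    have "(\<lambda>h::real. max 0 h ^ Suc k) \<midarrow>0\<rightarrow> max 0 0 ^ Suc k"
      by (intro tendsto_intros)
    moreover have "max 0 h ^ Suc (Suc k) / h = max 0 h ^ Suc k" if "h \<noteq> 0" for h :: real
      using that by (cases "h < 0") (auto simp: max_def)
    ultimately have "(\<lambda>h::real. max 0 h ^ Suc (Suc k) / h) \<midarrow>0\<rightarrow> 0"
      by (subst LIM_equal[where g="\<lambda>h. max 0 h ^ Suc k"]) auto
    then show ?thesis using 3 by (simp add: DERIV_def del: power_Suc)
  qed
qed

text \<open>The power \<open>max 0 f ^ (k + 1)\<close> has \<open>k\<close> continuous derivatives; a cutoff function of finite
  smoothness is enough, since only finitely many integrations by parts are made.\<close>

lemma bounded_derivs_max0_power: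
  assumes "0 \<le> M"
  shows "\<exists>C\<ge>0. \<forall>e S (f :: 'a::real_normed_vector \<Rightarrow> real). bounded_derivs e S k M f \<longrightarrow>
    bounded_derivs e S k C (\<lambda>x. max 0 (f x) ^ Suc (k + l))"
proof (induction k arbitrary: l)
  case 0
  have "\<bar>max 0 (f x) ^ Suc l\<bar> \<le> M ^ Suc l" if "norm (f x) \<le> M" for x and f :: "'a \<Rightarrow> real"
    unfolding power_abs using that by (intro power_mono) auto
  then show ?case
    using assms by (intro exI[of _ "M ^ Suc l"]) (auto intro!: continuous_intros simp del: power_Suc)
next
  case (Suc k)
  from Suc[of l] obtain C1 where C1: "C1 \<ge> 0" "\<And>e S (f :: 'a \<Rightarrow> real). bounded_derivs e S k M f \<Longrightarrow>
      bounded_derivs e S k C1 (\<lambda>x. max 0 (f x) ^ Suc (k + l))"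
    by blast
  from Suc[of "Suc l"] obtain C2 where C2: "C2 \<ge> 0" "\<And>e S (f :: 'a \<Rightarrow> real). bounded_derivs e S k M f \<Longrightarrow>
      bounded_derivs e S k C2 (\<lambda>x. max 0 (f x) ^ Suc (k + Suc l))"
    by blast
  define s where "s = 2 + real (k + l)"
  define C where "C = C2 + 2^k * (C1 * (\<bar>s\<bar> * M))"
  have "bounded_derivs e S (Suc k) C (\<lambda>x. max 0 (f x) ^ Suc (Suc k + l))"
    if f: "bounded_derivs e S (Suc k) M f" for e S and f :: "'a \<Rightarrow> real"
  proof -
    have fk: "bounded_derivs e S k M f" using f(1) by (rule bounded_derivs_lower)
    obtain f' where f': "\<And>x. x \<in> S \<Longrightarrow> ((\<lambda>t. f (x + t *\<^sub>R e)) has_vector_derivative f' x) (at 0)"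
        "bounded_derivs e S k M f'"
      using f(1) by (rule bounded_derivs_SucE) (rule that)
    have der: "((\<lambda>t. max 0 (f (x + t *\<^sub>R e)) ^ Suc (Suc k + l)) has_vector_derivative
        max 0 (f x) ^ Suc (k + l) * (s * f' x)) (at 0)"
      if "x \<in> S" for x
    proof -
      have "((\<lambda>t. f (x + t *\<^sub>R e)) has_real_derivative f' x) (at 0)"
        using f'(1) that by (simp add: has_real_derivative_iff_has_vector_derivative)
      from DERIV_chain2[OF has_real_derivative_max0_power this, of "k + l"]
      show ?thesis
        by (simp add: has_real_derivative_iff_has_vector_derivative s_def mult_ac)
    qed
    have "bounded_derivs e S k (\<bar>s\<bar> * M) (\<lambda>x. s * f' x)"
      using f'(2) by (rule bounded_derivs_bounded_linear) (auto simp: abs_mult bounded_linear_mult_right)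
    then have "bounded_derivs e S k (2^k * (C1 * (\<bar>s\<bar> * M))) (\<lambda>x. max 0 (f x) ^ Suc (k + l) * (s * f' x))"
      using C1 fk assms by (intro bounded_derivs_mult) auto
    then have 1: "bounded_derivs e S k C (\<lambda>x. max 0 (f x) ^ Suc (k + l) * (s * f' x))"
      by (rule bounded_derivs_mono) (use C2 in \<open>auto simp: C_def\<close>)
    have 2: "bounded_derivs e S k C (\<lambda>x. max 0 (f x) ^ Suc (Suc k + l))"
      by (rule bounded_derivs_mono[of _ _ _ C2]) (use C2(2)[OF fk] C1(1) assms in \<open>auto simp: C_def\<close>)
    show ?thesis
      by (rule bounded_derivs_SucI[OF bounded_derivs_continuous[OF 2] bounded_derivs_bound[OF 2] der 1])
  qed
  moreover have "0 \<le> C" using C1(1) C2(1) assms by (auto simp: C_def)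
  ultimately show ?case by blast
qed

section \<open>Nonstationary phase\<close>

lemma nn_integral_lborel_affine:
  fixes f :: "'a::euclidean_space \<Rightarrow> ennreal"
  assumes [measurable]: "f \<in> borel_measurable borel" and c: "c \<noteq> 0"
  shows "(\<integral>\<^sup>+x. f x \<partial>lborel) = ennreal (\<bar>c\<bar> ^ DIM('a)) * (\<integral>\<^sup>+x. f (t + c *\<^sub>R x) \<partial>lborel)"
  by (subst lborel_affine[OF c, of t])
     (simp add: nn_integral_density nn_integral_distr nn_integral_cmult)

lemma integral_lborel_affine:
  fixes f :: "'a::euclidean_space \<Rightarrow> 'b::{banach, second_countable_topology}"
  assumes [measurable]: "f \<in> borel_measurable borel" and c: "c \<noteq> 0"
  shows "integral\<^sup>L lborel f = \<bar>c\<bar> ^ DIM('a) *\<^sub>R integral\<^sup>L lborel (\<lambda>x. f (t + c *\<^sub>R x))"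
  by (subst lborel_affine[OF c, of t])
     (simp add: integral_density integral_distr)

lemma continuous_on_extend_by_zero:
  assumes "open S" "compact K" "K \<subseteq> S" "continuous_on S f" "\<And>x. x \<notin> K \<Longrightarrow> f x = 0"
  shows "continuous_on UNIV (f :: 'a::t2_space \<Rightarrow> 'b::real_normed_vector)"
proof -
  have "continuous_on (- K) f \<longleftrightarrow> continuous_on (- K) (\<lambda>_. 0 :: 'b)"
    using assms(5) by (intro continuous_on_cong) auto
  then have "continuous_on (S \<union> - K) f"
    using assms by (intro continuous_on_open_Un) (auto intro: compact_imp_closed)
  moreover have "S \<union> - K = UNIV" using assms(3) by auto
  ultimately show ?thesis by simp
qed

lemma integrable_continuous_compact_support:
  fixes f :: "'a::euclidean_space \<Rightarrow> 'b::{banach, second_countable_topology}"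
  assumes "compact K" "continuous_on UNIV f" "\<And>x. x \<notin> K \<Longrightarrow> f x = 0"
  shows "integrable lborel f"
proof -
  have "integrable lborel (\<lambda>x. indicator K x *\<^sub>R f x)"
    using assms by (intro borel_integrable_compact) (auto intro: continuous_on_subset)
  moreover have "(\<lambda>x. indicator K x *\<^sub>R f x) = f"
    using assms(3) by (auto simp: indicator_def fun_eq_iff)
  ultimately show ?thesis by simp
qed

lemma norm_integral_le_bound_on_compact:
  fixes f :: "'a::euclidean_space \<Rightarrow> 'b::{banach, second_countable_topology}"
  assumes "compact K" "\<And>x. x \<in> K \<Longrightarrow> norm (f x) \<le> M" "\<And>x. x \<notin> K \<Longrightarrow> f x = 0" "0 \<le> M"
  shows "norm (integral\<^sup>L lborel f) \<le> M * measure lborel K"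
proof (cases "integrable lborel f")
  case True
  have K: "emeasure lborel K < \<infinity>" using emeasure_compact_finite[OF assms(1)] by (simp add: less_top)
  have "norm (integral\<^sup>L lborel f) \<le> (\<integral>x. norm (f x) \<partial>lborel)" by (rule integral_norm_bound)
  also have "\<dots> \<le> (\<integral>x. M * indicator K x \<partial>lborel)"
  proof (rule integral_mono)
    show "integrable lborel (\<lambda>x. M * indicator K x)"
      using K borel_compact[OF assms(1)] by (intro integrable_mult_right) simp
  qed (use True assms in \<open>auto simp: indicator_def\<close>)
  also have "\<dots> = M * measure lborel K" using K borel_compact[OF assms(1)] by simp
  finally show ?thesis .
next
  case False
  then show ?thesis using assms(4) by (simp add: not_integrable_integral_eq)
qed

text \<open>The integral of a difference quotient vanishes by translation invariance.\<close>

lemma integral_directional_derivative_eq_0: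
  fixes F F' :: "'a::euclidean_space \<Rightarrow> 'b::{banach, second_countable_topology}"
  assumes K: "compact K" "\<And>x. x \<notin> K \<Longrightarrow> F x = 0" "\<And>x. x \<notin> K \<Longrightarrow> F' x = 0"
    and cont: "continuous_on UNIV F" "continuous_on UNIV F'"
    and der: "\<And>x. ((\<lambda>t. F (x + t *\<^sub>R e)) has_vector_derivative F' x) (at 0)"
  shows "integral\<^sup>L lborel F' = 0"
proof -
  obtain R where R: "K \<subseteq> cball 0 R" using bounded_subset_ballD[OF compact_imp_bounded[OF K(1)], of 0] ball_subset_cball by (meson subset_trans)
  have "bounded (F' ` K)"
    using K(1) cont(2) by (intro compact_imp_bounded compact_continuous_image) (auto intro: continuous_on_subset)
  then obtain M where M: "\<And>x. x \<in> K \<Longrightarrow> norm (F' x) \<le> M" "0 < M" by (auto simp: bounded_pos)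
  have M': "norm (F' x) \<le> M" for x using M K(3)[of x] by (cases "x \<in> K") auto
  \<comment> \<open>the difference quotients are dominated by the Lipschitz bound on a ball that contains all their supports\<close>
  have derh: "((\<lambda>t. F (x + t *\<^sub>R e)) has_vector_derivative F' (x + h *\<^sub>R e)) (at h)" for x h
  proof -
    have "((\<lambda>t. F ((x + h *\<^sub>R e) + t *\<^sub>R e)) \<circ> (\<lambda>t. t - h) has_vector_derivative
        1 *\<^sub>R F' (x + h *\<^sub>R e)) (at h)"
      by (rule vector_diff_chain_at) (auto intro!: derivative_eq_intros der)
    then show ?thesis by (simp add: o_def algebra_simps)
  qed
  have lip: "norm (F (x + h *\<^sub>R e) - F x) \<le> M * h" if "0 \<le> h" for x h
  proof -
    have "norm (F (x + h *\<^sub>R e) - F (x + 0 *\<^sub>R e)) \<le> M * norm (h - 0)"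
    proof (rule differentiable_bound)
      show "convex {0..h}" by simp
      show "((\<lambda>t. F (x + t *\<^sub>R e)) has_derivative (\<lambda>u. u *\<^sub>R F' (x + t *\<^sub>R e))) (at t within {0..h})" for t
        using derh[of x t] by (auto simp: has_vector_derivative_def intro: has_derivative_at_withinI)
      show "onorm (\<lambda>u. u *\<^sub>R F' (x + t *\<^sub>R e)) \<le> M" for t
        using M'[of "x + t *\<^sub>R e"] M(2) by (intro onorm_bound) (auto simp: mult.commute[of M] mult_left_mono)
    qed (use that in auto)
    then show ?thesis using that by simp
  qed
  define s where "s n x = (real n + 1) *\<^sub>R (F (x + (1 / (real n + 1)) *\<^sub>R e) - F x)" for n x
  define w where "w x = M * indicator (cball 0 (R + norm e)) x" for x :: 'a
  have Fint: "integrable lborel F" using K(1) cont(1) K(2) by (rule integrable_continuous_compact_support)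
  have [measurable]: "F \<in> borel_measurable borel" "F' \<in> borel_measurable borel"
    using cont by (auto intro: borel_measurable_continuous_onI)
  have "(\<lambda>n. integral\<^sup>L lborel (s n)) \<longlonglongrightarrow> integral\<^sup>L lborel F'"
  proof (rule integral_dominated_convergence[where w=w])
    show "F' \<in> borel_measurable lborel" by simp
    show "s n \<in> borel_measurable lborel" for n unfolding s_def by measurable
    show "integrable lborel w" unfolding w_def
      using emeasure_lborel_cball_finite[of "0::'a" "R + norm e"] by (intro integrable_mult_right) simp
    show "AE x in lborel. (\<lambda>n. s n x) \<longlonglongrightarrow> F' x"
    proof (rule AE_I2)
      fix x
      have "((\<lambda>h. (1 / h) *\<^sub>R (F (x + h *\<^sub>R e) - F x)) \<longlongrightarrow> F' x) (at 0)"
      proof (rule LIM_zero_cancel, rule tendsto_norm_zero_cancel)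
        have "(\<lambda>h. norm (F (x + h *\<^sub>R e) - F x - h *\<^sub>R F' x) / norm h) \<midarrow>0\<rightarrow> 0"
          using der[of x] by (simp add: has_vector_derivative_def has_derivative_at)
        moreover have "norm ((1 / h) *\<^sub>R (F (x + h *\<^sub>R e) - F x) - F' x) =
            norm (F (x + h *\<^sub>R e) - F x - h *\<^sub>R F' x) / norm h" if "h \<noteq> 0" for h
        proof -
          have "(1 / h) *\<^sub>R (F (x + h *\<^sub>R e) - F x) - F' x = (1 / h) *\<^sub>R (F (x + h *\<^sub>R e) - F x - h *\<^sub>R F' x)"
            using that by (simp add: scaleR_diff_right)
          then show ?thesis by (simp only: norm_scaleR) simp
        qed
        ultimately show "(\<lambda>h. norm ((1 / h) *\<^sub>R (F (x + h *\<^sub>R e) - F x) - F' x)) \<midarrow>0\<rightarrow> 0"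
          by (subst LIM_equal) auto
      qed
      moreover have "filterlim (\<lambda>n. 1 / (real n + 1)) (at 0) sequentially"
        by (intro filterlim_atI) (auto simp: LIMSEQ_inverse_real_of_nat[unfolded inverse_eq_divide Suc_eq_plus1 of_nat_add of_nat_1]
           add_nonneg_eq_0_iff intro!: always_eventually)
      ultimately have "(\<lambda>n. (1 / (1 / (real n + 1))) *\<^sub>R (F (x + (1 / (real n + 1)) *\<^sub>R e) - F x)) \<longlonglongrightarrow> F' x"
        by (rule filterlim_compose)
      then show "(\<lambda>n. s n x) \<longlonglongrightarrow> F' x" by (simp add: s_def)
    qed
    show "AE x in lborel. norm (s n x) \<le> w x" for n
    proof (rule AE_I2)
      fix x
      show "norm (s n x) \<le> w x"
      proof (cases "x \<in> cball 0 (R + norm e)")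
        case True
        have "norm (s n x) \<le> (real n + 1) * (M * (1 / (real n + 1)))"
          using lip[of "1 / (real n + 1)" x] unfolding s_def norm_scaleR by (intro mult_mono) auto
        then show ?thesis using True by (simp add: w_def)
      next
        case False
        then have nx: "R + norm e < norm x" by simp
        have "norm x \<le> norm (x + (1 / (real n + 1)) *\<^sub>R e) + norm ((1 / (real n + 1)) *\<^sub>R e)"
          using norm_triangle_ineq4[of "x + (1 / (real n + 1)) *\<^sub>R e" "(1 / (real n + 1)) *\<^sub>R e"] by simp
        also have "norm ((1 / (real n + 1)) *\<^sub>R e) \<le> norm e"
          by (simp add: field_simps mult_left_mono)
        finally have "R < norm (x + (1 / (real n + 1)) *\<^sub>R e)" "R < norm x"
          using nx norm_ge_zero[of e] by linarith+
        then have "x \<notin> K" "x + (1 / (real n + 1)) *\<^sub>R e \<notin> K" using R by force+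
        then show ?thesis by (simp add: s_def w_def K(2) M(2) less_imp_le)
      qed
    qed
  qed
  moreover have "integral\<^sup>L lborel (s n) = 0" for n
  proof -
    define h where "h = (1 / (real n + 1)) *\<^sub>R e"
    have eq: "integral\<^sup>L lborel F = integral\<^sup>L lborel (\<lambda>x. F (x + h))"
      using integral_lborel_affine[of F 1 h] by (simp add: add.commute)
    have "integrable lborel (\<lambda>x. F (x + h))"
    proof (rule integrable_continuous_compact_support)
      show "compact ((\<lambda>x. x - h) ` K)"
        using K(1) by (intro compact_continuous_image continuous_intros)
      show "F (x + h) = 0" if "x \<notin> (\<lambda>x. x - h) ` K" for x
        using that by (intro K(2)) (force intro: image_eqI[of _ _ "x + h"])
      show "continuous_on UNIV (\<lambda>x. F (x + h))"
        by (rule continuous_on_compose2[OF cont(1)]) (auto intro!: continuous_intros)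
    qed
    then have "(\<integral>x. (real n + 1) *\<^sub>R (F (x + h) - F x) \<partial>lborel) = 0"
      using Fint eq by simp
    then show ?thesis by (simp add: s_def[abs_def] h_def)
  qed
  ultimately show ?thesis by (simp add: LIMSEQ_const_iff)
qed

text \<open>Writing \<open>1 / f = f * (f * f) powr (- 1)\<close> treats both signs of \<open>f\<close> at once.\<close>

lemma bounded_derivs_reciprocal:
  assumes "0 < c" "0 \<le> M"
  shows "\<exists>C\<ge>0. \<forall>e S (f :: 'a::real_normed_vector \<Rightarrow> real). open S \<longrightarrow> bounded_derivs e S k M f \<longrightarrow>
    (\<forall>x\<in>S. c \<le> \<bar>f x\<bar>) \<longrightarrow> bounded_derivs e S k C (\<lambda>x. 1 / f x)"
proof -
  obtain C where C: "0 \<le> C" "\<And>e S (f :: 'a \<Rightarrow> real). bounded_derivs e S k (2 ^ k * (M * M)) f \<Longrightarrow>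
      \<forall>x\<in>S. c\<^sup>2 \<le> f x \<Longrightarrow> bounded_derivs e S k C (\<lambda>x. f x powr (-1))"
    using bounded_derivs_powr[of "c\<^sup>2" "2 ^ k * (M * M)" k "-1"] assms by auto
  show ?thesis
  proof (intro exI[of _ "2^k * (M * C)"] conjI allI impI)
    show "0 \<le> 2^k * (M * C)" using C(1) assms by simp
    fix e S and f :: "'a \<Rightarrow> real"
    assume f: "open S" "bounded_derivs e S k M f" "\<forall>x\<in>S. c \<le> \<bar>f x\<bar>"
    have lower: "c\<^sup>2 \<le> f x * f x" if "x \<in> S" for x
      using f(3) that assms power_mono[of c "\<bar>f x\<bar>" 2] by (simp add: power2_eq_square)
    then have "bounded_derivs e S k C (\<lambda>x. (f x * f x) powr (-1))"
      by (intro C(2) bounded_derivs_mult f assms ballI lower)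
    then have "bounded_derivs e S k (2^k * (M * C)) (\<lambda>x. f x * (f x * f x) powr (-1))"
      by (intro bounded_derivs_mult f assms C(1))
    then show "bounded_derivs e S k (2^k * (M * C)) (\<lambda>x. 1 / f x)"
    proof (rule bounded_derivs_cong[OF f(1)])
      fix x assume "x \<in> S"
      then have "f x \<noteq> 0" using f(3) assms by force
      moreover from this have "0 < f x * f x" by (metis not_real_square_gt_zero)
      ultimately show "f x * (f x * f x) powr (-1) = 1 / f x"
        by (simp add: powr_minus divide_simps)
    qed
  qed
qed

text \<open>The hypotheses for \<open>N\<close> integrations by parts along \<open>e\<close>.  The derivative of the phase is split into its size \<open>\<Lambda>\<close>
  and a factor \<open>f\<close> whose bounds do not depend on \<open>\<Lambda>\<close>.\<close>

definition nonstationary ::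
    "nat \<Rightarrow> real \<Rightarrow> real \<Rightarrow> 'a::euclidean_space \<Rightarrow> 'a set \<Rightarrow> 'a set \<Rightarrow> real \<Rightarrow> real \<Rightarrow>
      ('a \<Rightarrow> real) \<Rightarrow> ('a \<Rightarrow> complex) \<Rightarrow> bool" where
  "nonstationary N c M e S K \<Lambda> MB \<Theta> B \<longleftrightarrow>
     open S \<and> compact K \<and> K \<subseteq> S \<and> 0 < \<Lambda> \<and> 0 \<le> MB \<and> continuous_on S \<Theta> \<and>
     (\<exists>f. (\<forall>x\<in>S. ((\<lambda>t. \<Theta> (x + t *\<^sub>R e)) has_real_derivative \<Lambda> * f x) (at 0)) \<and>
          bounded_derivs e S N M f \<and> (\<forall>x\<in>S. c \<le> \<bar>f x\<bar>)) \<and>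
     bounded_derivs e S N MB B \<and> (\<forall>x. x \<notin> K \<longrightarrow> B x = 0)"

text \<open>Nonstationary phase.  Only derivatives along one direction \<open>e\<close> enter: since
  \<open>cis \<Theta> * B\<close> is, up to a total derivative, \<open>(\<i> / \<Lambda>) * cis \<Theta> * (B / f)'\<close>, every integration by
  parts gains a factor \<open>1 / \<Lambda>\<close>.\<close>

lemma nonstationary_phase:
  assumes "0 < c" "0 \<le> M"
  shows "\<exists>C\<ge>0. \<forall>e S K (\<Theta> :: 'a::euclidean_space \<Rightarrow> real) B \<Lambda> MB.
    nonstationary N c M e S K \<Lambda> MB \<Theta> B \<longrightarrow>
    cmod (\<integral>x. cis (\<Theta> x) * B x \<partial>lborel) \<le> C * MB * measure lborel K / \<Lambda> ^ N"
proof (induction N)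
  case 0
  have "cmod (\<integral>x. cis (\<Theta> x) * B x \<partial>lborel) \<le> 1 * MB * measure lborel K / \<Lambda> ^ 0"
    if "nonstationary 0 c M e S K \<Lambda> MB \<Theta> B" for e :: 'a and S K \<Theta> B \<Lambda> MB
  proof -
    have *: "compact K" "K \<subseteq> S" "0 \<le> MB" "bounded_derivs e S 0 MB B" "\<And>x. x \<notin> K \<Longrightarrow> B x = 0"
      using that by (simp_all add: nonstationary_def del: bounded_derivs.simps)
    have "cmod (\<integral>x. cis (\<Theta> x) * B x \<partial>lborel) \<le> MB * measure lborel K"
    proof (rule norm_integral_le_bound_on_compact[OF *(1) _ _ *(3)])
      show "cmod (cis (\<Theta> x) * B x) \<le> MB" if "x \<in> K" for x
        using bounded_derivs_bound[OF *(4)] that *(2) by (simp add: norm_mult subset_iff)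
      show "cis (\<Theta> x) * B x = 0" if "x \<notin> K" for x using *(5) that by simp
    qed
    then show ?thesis by simp
  qed
  then show ?case by (intro exI[of _ "1::real"]) simp
next
  case (Suc N)
  then obtain C where C: "0 \<le> C" "\<And>e S K (\<Theta> :: 'a \<Rightarrow> real) B \<Lambda> MB. nonstationary N c M e S K \<Lambda> MB \<Theta> B \<Longrightarrow>
    cmod (\<integral>x. cis (\<Theta> x) * B x \<partial>lborel) \<le> C * MB * measure lborel K / \<Lambda> ^ N"
    by blast
  obtain D where D: "0 \<le> D" "\<And>e S (f :: 'a \<Rightarrow> real). open S \<Longrightarrow> bounded_derivs e S (Suc N) M f \<Longrightarrow>
    (\<forall>x\<in>S. c \<le> \<bar>f x\<bar>) \<Longrightarrow> bounded_derivs e S (Suc N) D (\<lambda>x. 1 / f x)"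
    using bounded_derivs_reciprocal[OF assms, of "Suc N"] by metis
  show ?case
  proof (intro exI[of _ "C * (2 ^ Suc N * D)"] conjI allI impI)
    show "0 \<le> C * (2 ^ Suc N * D)" using C(1) D(1) by simp
    fix e :: 'a and S K and \<Theta> :: "'a \<Rightarrow> real" and B :: "'a \<Rightarrow> complex" and \<Lambda> MB :: real
    assume "nonstationary (Suc N) c M e S K \<Lambda> MB \<Theta> B"
    then obtain f where SK: "open S" "compact K" "K \<subseteq> S" and \<Lambda>: "0 < \<Lambda>" "0 \<le> MB" and \<Theta>: "continuous_on S \<Theta>"
      "\<forall>x\<in>S. ((\<lambda>t. \<Theta> (x + t *\<^sub>R e)) has_real_derivative \<Lambda> * f x) (at 0)"
      and f: "bounded_derivs e S (Suc N) M f" "\<forall>x\<in>S. c \<le> \<bar>f x\<bar>"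
      and B: "bounded_derivs e S (Suc N) MB B" "\<forall>x. x \<notin> K \<longrightarrow> B x = 0"
      unfolding nonstationary_def by (elim conjE exE) (rule that)
    \<comment> \<open>\<open>H2\<close> is the derivative of \<open>B / f\<close>; it vanishes outside \<open>K\<close>, and so the induction hypothesis applies to it\<close>
    define H where "H x = B x * of_real (1 / f x)" for x
    have "bounded_derivs e S (Suc N) (1 * D) (\<lambda>x. of_real (1 / f x) :: complex)"
      by (rule bounded_derivs_bounded_linear[OF D(2)[OF SK(1) f]])
         (auto simp: bounded_linear_of_real norm_divide)
    then have H: "bounded_derivs e S (Suc N) (2 ^ Suc N * (MB * D)) H"
      unfolding H_def using B(1) \<Lambda>(2) D(1) by (intro bounded_derivs_mult) simp_all
    obtain H' where H': "continuous_on S H"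
      "\<And>x. x \<in> S \<Longrightarrow> ((\<lambda>t. H (x + t *\<^sub>R e)) has_vector_derivative H' x) (at 0)"
      "bounded_derivs e S N (2 ^ Suc N * (MB * D)) H'"
      using H by (rule bounded_derivs_SucE) (rule that)
    have H0: "H x = 0" if "x \<notin> K" for x using B(2) that by (simp add: H_def)
    have oK: "open (- K)" using SK(2) by (simp add: compact_imp_closed open_Compl)
    have zero: "((\<lambda>t. H (x + t *\<^sub>R e)) has_vector_derivative 0) (at 0)" if "x \<notin> K" for x
      using has_vector_derivative_line_cong[OF oK, of x H "\<lambda>_. 0" e 0] H0 that by auto
    have H'0: "H' x = 0" if "x \<in> S" "x \<notin> K" for x
      using vector_derivative_unique_at[OF H'(2)[OF that(1)] zero[OF that(2)]] .
    define H2 where "H2 x = (if x \<in> S then H' x else 0)" for x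
    have H2: "bounded_derivs e S N (2 ^ Suc N * (MB * D)) H2"
      by (rule bounded_derivs_cong[OF SK(1) H'(3)]) (simp add: H2_def)
    have H20: "H2 x = 0" if "x \<notin> K" for x using H'0 that by (simp add: H2_def)
    have fc: "continuous_on S f" using f(1) by (rule bounded_derivs_continuous)
    have Bc: "continuous_on S B" using B(1) by (rule bounded_derivs_continuous)
    have cis: "continuous_on S (\<lambda>x. cis (\<Theta> x))" using \<Theta>(1) by (intro continuous_intros)
    have int0: "integral\<^sup>L lborel (\<lambda>x. \<i> * of_real \<Lambda> * (cis (\<Theta> x) * B x) + cis (\<Theta> x) * H2 x) = 0"
    proof (rule integral_directional_derivative_eq_0[OF SK(2), where F="\<lambda>x. cis (\<Theta> x) * H x" and e=e])
      show "continuous_on UNIV (\<lambda>x. cis (\<Theta> x) * H x)"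
        using H0 by (intro continuous_on_extend_by_zero[OF SK] continuous_on_mult cis H'(1)) simp
      show "continuous_on UNIV (\<lambda>x. \<i> * of_real \<Lambda> * (cis (\<Theta> x) * B x) + cis (\<Theta> x) * H2 x)"
        using H20 B(2) by (intro continuous_on_extend_by_zero[OF SK] continuous_on_mult continuous_on_add
          continuous_on_const cis Bc bounded_derivs_continuous[OF H2]) simp
      fix x
      show "((\<lambda>t. cis (\<Theta> (x + t *\<^sub>R e)) * H (x + t *\<^sub>R e)) has_vector_derivative
          \<i> * of_real \<Lambda> * (cis (\<Theta> x) * B x) + cis (\<Theta> x) * H2 x) (at 0)"
      proof (cases "x \<in> S")
        case True
        have d: "((\<lambda>t. \<Theta> (x + t *\<^sub>R e)) has_derivative (\<lambda>t. t * (\<Lambda> * f x))) (at 0)"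
          by (rule has_derivative_eq_rhs[OF \<Theta>(2)[rule_format, OF True, unfolded has_field_derivative_def]])
             (simp add: fun_eq_iff)
        have "((\<lambda>t. cis (\<Theta> (x + t *\<^sub>R e))) has_vector_derivative \<i> * of_real (\<Lambda> * f x) * cis (\<Theta> x)) (at 0)"
          unfolding has_vector_derivative_def
          by (rule has_derivative_eq_rhs[OF has_derivative_cis[OF d]])
             (auto simp: fun_eq_iff scaleR_conv_of_real algebra_simps)
        from has_vector_derivative_mult[OF this H'(2)[OF True]]
        have "((\<lambda>t. cis (\<Theta> (x + t *\<^sub>R e)) * H (x + t *\<^sub>R e)) has_vector_derivative
          cis (\<Theta> x) * H' x + \<i> * of_real (\<Lambda> * f x) * cis (\<Theta> x) * H x) (at 0)"
          by simp
        moreover have "f x \<noteq> 0" using f(2) True assms(1) by force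
        then have "of_real (f x) * H x = B x" by (simp add: H_def)
        then have "\<i> * of_real (\<Lambda> * f x) * cis (\<Theta> x) * H x = \<i> * of_real \<Lambda> * (cis (\<Theta> x) * B x)"
          by (simp add: mult_ac)
        ultimately show ?thesis using True by (simp only: H2_def add.commute if_True)
      next
        case False
        then have "x \<notin> K" using SK by auto
        then have "((\<lambda>t. cis (\<Theta> (x + t *\<^sub>R e)) * H (x + t *\<^sub>R e)) has_vector_derivative 0) (at 0)"
          by (subst has_vector_derivative_line_cong[OF oK, of x "\<lambda>x. cis (\<Theta> x) * H x" "\<lambda>_. 0"])
             (simp_all add: H0)
        then show ?thesis using B(2) H20 \<open>x \<notin> K\<close> by simp
      qed
    qed (use H0 H20 B(2) in auto)
    have i1: "integrable lborel (\<lambda>x. cis (\<Theta> x) * B x)"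
      using B(2) by (intro integrable_continuous_compact_support[OF SK(2)]
        continuous_on_extend_by_zero[OF SK] continuous_on_mult cis Bc) simp_all
    have i2: "integrable lborel (\<lambda>x. cis (\<Theta> x) * H2 x)"
      using H20 by (intro integrable_continuous_compact_support[OF SK(2)]
        continuous_on_extend_by_zero[OF SK] continuous_on_mult cis bounded_derivs_continuous[OF H2]) simp_all
    have "\<i> * of_real \<Lambda> * (\<integral>x. cis (\<Theta> x) * B x \<partial>lborel) + (\<integral>x. cis (\<Theta> x) * H2 x \<partial>lborel) = 0"
      using int0 i1 i2 by simp
    then have *: "\<i> * of_real \<Lambda> * (\<integral>x. cis (\<Theta> x) * B x \<partial>lborel) = - (\<integral>x. cis (\<Theta> x) * H2 x \<partial>lborel)"
      by (simp add: eq_neg_iff_add_eq_0)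
    have "\<Lambda> * cmod (\<integral>x. cis (\<Theta> x) * B x \<partial>lborel) = cmod (\<integral>x. cis (\<Theta> x) * H2 x \<partial>lborel)"
    proof -
      have "cmod (\<i> * of_real \<Lambda> * (\<integral>x. cis (\<Theta> x) * B x \<partial>lborel)) = cmod (- (\<integral>x. cis (\<Theta> x) * H2 x \<partial>lborel))"
        using * by (rule arg_cong)
      then show ?thesis using \<Lambda>(1) by (simp add: norm_mult)
    qed
    also have "\<dots> \<le> C * (2 ^ Suc N * (MB * D)) * measure lborel K / \<Lambda> ^ N"
    proof (rule C(2))
      have "0 \<le> 2 ^ Suc N * (MB * D)" using \<Lambda>(2) D(1) by simp
      then show "nonstationary N c M e S K \<Lambda> (2 ^ Suc N * (MB * D)) \<Theta> H2"
        unfolding nonstationary_def using SK \<Lambda>(1) \<Theta> bounded_derivs_lower[OF f(1)] f(2) H2 H20 by blast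
    qed
    finally show "cmod (\<integral>x. cis (\<Theta> x) * B x \<partial>lborel) \<le>
        C * (2 ^ Suc N * D) * MB * measure lborel K / \<Lambda> ^ Suc N"
      using \<Lambda>(1) by (simp add: field_simps)
  qed
qed

section \<open>Correlations of an oscillatory integrand\<close>

lemma integrable_bounded_compact_support:
  fixes f :: "'a::euclidean_space \<Rightarrow> 'b::{banach, second_countable_topology}"
  assumes "compact K" "f \<in> borel_measurable borel" "\<And>x. x \<in> K \<Longrightarrow> norm (f x) \<le> B" "\<And>x. x \<notin> K \<Longrightarrow> f x = 0"
  shows "integrable lborel f"
  by (rule integrableI_bounded_set[where A=K and B=B])
     (use assms emeasure_compact_finite[OF assms(1)] borel_compact[OF assms(1)] in \<open>auto simp: less_top\<close>)

lemma nn_integral_lborel_translate: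
  fixes f :: "'a::euclidean_space \<Rightarrow> ennreal"
  assumes "f \<in> borel_measurable borel"
  shows "(\<integral>\<^sup>+x. f (x - t) \<partial>lborel) = (\<integral>\<^sup>+x. f x \<partial>lborel)"
  using nn_integral_lborel_affine[OF assms, of 1 "- t"] by simp

text \<open>The square of an oscillatory integral is controlled by the correlations of its integrand.
  Averaging over translations by \<open>h \<in> W\<close> does not change the integral of \<open>g\<close>; Cauchy--Schwarz
  then produces the correlations of \<open>g\<close> with its translates.\<close>

lemma norm_integral_squared_le_correlations:
  fixes g :: "'a::euclidean_space \<Rightarrow> complex" and \<beta> :: "'a \<Rightarrow> ennreal"
  assumes g: "continuous_on UNIV g" "compact K" "\<And>x. x \<notin> K \<Longrightarrow> g x = 0"
    and W: "compact W"
    and K': "compact K'" "\<And>x h. h \<in> W \<Longrightarrow> x + h \<in> K \<Longrightarrow> x \<in> K'"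
    and \<beta>[measurable]: "\<beta> \<in> borel_measurable borel"
    and corr: "\<And>h k. h \<in> W \<Longrightarrow> k \<in> W \<Longrightarrow>
        ennreal (cmod (\<integral>x. g (x + (h - k)) * cnj (g x) \<partial>lborel)) \<le> \<beta> (h - k)"
  shows "ennreal (measure lborel W * (cmod (\<integral>x. g x \<partial>lborel))\<^sup>2)
           \<le> ennreal (measure lborel K') * (\<integral>\<^sup>+d. \<beta> d \<partial>lborel)"
proof -
  let ?I = "\<integral>x. g x \<partial>lborel"
  have [measurable]: "cnj \<in> borel_measurable borel"
    by (intro borel_measurable_continuous_onI continuous_intros)
  have [measurable]: "g \<in> borel_measurable borel" using g(1) by (rule borel_measurable_continuous_onI)
  have [measurable]: "W \<in> sets borel" "K' \<in> sets borel" using W K' by (auto intro: borel_compact)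
  have Wfin: "emeasure lborel W < \<infinity>" using emeasure_compact_finite[OF W] by (simp add: less_top)
  have Kfin: "emeasure lborel K' < \<infinity>" using emeasure_compact_finite[OF K'(1)] by (simp add: less_top)
  have "bounded (g ` K)"
    using g by (intro compact_imp_bounded compact_continuous_image) (auto intro: continuous_on_subset)
  then obtain M where M: "\<And>x. x \<in> K \<Longrightarrow> cmod (g x) \<le> M" "0 < M" by (auto simp: bounded_pos)
  have gM: "cmod (g x) \<le> M" for x using M g(3)[of x] by (cases "x \<in> K") auto
  define w where "w h = complex_of_real (indicator W h)" for h :: 'a
  have [measurable]: "w \<in> borel_measurable borel" unfolding w_def by measurable
  have w1: "cmod (w h) \<le> 1" for h by (simp add: w_def indicator_def)
  have w0: "w h = 0" if "h \<notin> W" for h using that by (simp add: w_def)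
  have gK': "w h * g (x + h) = 0" if "x \<notin> K'" for x h
    using that K'(2)[of h x] g(3)[of "x + h"] by (cases "h \<in> W") (auto simp: w_def)
  define G where "G x = (\<integral>h. w h * g (x + h) \<partial>lborel)" for x
  have [measurable]: "G \<in> borel_measurable borel" unfolding G_def by measurable
  have G0: "G x = 0" if "x \<notin> K'" for x unfolding G_def gK'[OF that] by simp
  have intw: "integrable lborel (\<lambda>h. w h * g (x + h))" for x
    by (rule integrable_bounded_compact_support[OF W, where B="1 * M"])
       (auto simp: norm_mult w0 intro!: mult_mono[OF w1 gM, simplified])
  \<comment> \<open>the integral of \<open>G\<close>\<close>
  have "integrable lborel (\<lambda>(x, h). w h * g (x + h))"
  proof (rule integrable_bounded_compact_support[OF compact_Times[OF K'(1) W], where B="1 * M"])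
    show "(\<lambda>(x, h). w h * g (x + h)) \<in> borel_measurable borel"
      unfolding borel_prod[symmetric] by measurable
    show "cmod (case p of (x, h) \<Rightarrow> w h * g (x + h)) \<le> 1 * M" for p
      using mult_mono[OF w1 gM] by (simp add: norm_mult split: prod.split)
    show "(case p of (x, h) \<Rightarrow> w h * g (x + h)) = 0" if "p \<notin> K' \<times> W" for p
      using that gK' w0 by (cases p) auto
  qed
  then have "integrable (lborel \<Otimes>\<^sub>M lborel) (\<lambda>(x, h). w h * g (x + h))" by (simp add: lborel_prod)
  from lborel_pair.Fubini_integral[OF this]
  have "(\<integral>x. G x \<partial>lborel) = (\<integral>h. (\<integral>x. w h * g (x + h) \<partial>lborel) \<partial>lborel)" by (simp add: G_def)
  also have "\<dots> = (\<integral>h. w h * ?I \<partial>lborel)"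
  proof (rule Bochner_Integration.integral_cong[OF refl])
    fix h
    have "(\<integral>x. g (x + h) \<partial>lborel) = ?I"
      using integral_lborel_affine[of g 1 h] by (simp add: add.commute)
    then show "(\<integral>x. w h * g (x + h) \<partial>lborel) = w h * ?I" by simp
  qed
  also have "\<dots> = of_real (measure lborel W) * ?I"
  proof -
    have "integrable lborel (indicator W :: 'a \<Rightarrow> real)" using Wfin by simp
    then show ?thesis by (simp add: w_def)
  qed
  finally have intG: "(\<integral>x. G x \<partial>lborel) = of_real (measure lborel W) * ?I" .
  \<comment> \<open>the square integral of \<open>G\<close>, as an integral of correlations\<close>
  define F where "F x = (\<lambda>(h, k). (w h * g (x + h)) * cnj (w k * g (x + k)))" for x
  have FM: "cmod (F x p) \<le> (1 * M) * (1 * M)" for x p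
    unfolding F_def split_beta norm_mult complex_mod_cnj using M(2)
    by (intro mult_mono w1 gM mult_nonneg_nonneg) auto
  have Fint: "integrable lborel (\<lambda>(x, p). F x p)"
  proof (rule integrable_bounded_compact_support[OF compact_Times[OF K'(1) compact_Times[OF W W]],
          where B="(1 * M) * (1 * M)"])
    show "(\<lambda>(x, p). F x p) \<in> borel_measurable borel"
      unfolding F_def borel_prod[symmetric] by measurable
    show "cmod (case q of (x, p) \<Rightarrow> F x p) \<le> (1 * M) * (1 * M)" for q
      using FM by (simp split: prod.split)
    show "(case q of (x, p) \<Rightarrow> F x p) = 0" if notin: "q \<notin> K' \<times> (W \<times> W)" for q
    proof -
      obtain x h k where q: "q = (x, h, k)" by (cases q) auto
      consider "x \<notin> K'" | "h \<notin> W" | "k \<notin> W" using notin q by auto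
      then have "w h = 0 \<or> g (x + h) = 0 \<or> w k = 0"
        using gK'[of x h] w0 by cases auto
      then show ?thesis by (auto simp: q F_def)
    qed
  qed
  then have Fint': "integrable (lborel \<Otimes>\<^sub>M lborel) (\<lambda>(x, p). F x p)" by (simp add: lborel_prod)
  have inner: "(\<integral>p. F x p \<partial>lborel) = of_real ((cmod (G x))\<^sup>2)" for x
  proof -
    have "integrable lborel (F x)"
    proof (rule integrable_bounded_compact_support[OF compact_Times[OF W W] _ FM])
      show "F x \<in> borel_measurable borel" unfolding F_def borel_prod[symmetric] by measurable
      show "F x p = 0" if "p \<notin> W \<times> W" for p using that w0 by (cases p) (auto simp: F_def)
    qed
    then have "(\<integral>p. F x p \<partial>lborel) = (\<integral>h. (\<integral>k. F x (h, k) \<partial>lborel) \<partial>lborel)"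
      by (subst lborel_pair.integral_fst') (simp_all add: lborel_prod)
    also have "\<dots> = (\<integral>h. (w h * g (x + h)) * cnj (G x) \<partial>lborel)"
      by (simp add: F_def G_def integral_cnj[symmetric] del: complex_cnj_mult)
    also have "\<dots> = G x * cnj (G x)" by (simp add: G_def)
    finally show ?thesis by (simp add: complex_norm_square[symmetric])
  qed
  have corr_eq: "(\<integral>x. F x (h, k) \<partial>lborel) = w h * w k * (\<integral>x. g (x + (h - k)) * cnj (g x) \<partial>lborel)" for h k
  proof -
    have "(\<integral>x. g (x + (h - k)) * cnj (g x) \<partial>lborel) = (\<integral>x. g (x + h) * cnj (g (x + k)) \<partial>lborel)"
      by (subst integral_lborel_affine[of _ 1 k]) (simp_all add: algebra_simps)
    moreover have "F x (h, k) = (w h * w k) * (g (x + h) * cnj (g (x + k)))" for x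
      by (simp add: F_def w_def)
    ultimately show ?thesis by simp
  qed
  have sq: "of_real (\<integral>x. (cmod (G x))\<^sup>2 \<partial>lborel) = (\<integral>p. (\<integral>x. F x p \<partial>lborel) \<partial>lborel)"
  proof -
    have "of_real (\<integral>x. (cmod (G x))\<^sup>2 \<partial>lborel) = (\<integral>x. complex_of_real ((cmod (G x))\<^sup>2) \<partial>lborel)"
      by (rule integral_complex_of_real[symmetric])
    also have "\<dots> = (\<integral>x. (\<integral>p. F x p \<partial>lborel) \<partial>lborel)" by (simp only: inner)
    also have "\<dots> = (\<integral>p. (\<integral>x. F x p \<partial>lborel) \<partial>lborel)"
      by (rule lborel_pair.Fubini_integral[OF Fint', symmetric])
    finally show ?thesis .
  qed
  have intp: "integrable lborel (\<lambda>p. (\<integral>x. F x p \<partial>lborel))"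
    using lborel_pair.integrable_snd[OF Fint'] .
  have "ennreal (\<integral>x. (cmod (G x))\<^sup>2 \<partial>lborel) \<le> ennreal (cmod (\<integral>p. (\<integral>x. F x p \<partial>lborel) \<partial>lborel))"
    unfolding sq[symmetric] by (intro ennreal_leI) simp
  also have "\<dots> \<le> (\<integral>\<^sup>+p. ennreal (cmod (\<integral>x. F x p \<partial>lborel)) \<partial>lborel)"
    using intp by (rule integral_norm_bound_ennreal)
  also have "\<dots> \<le> (\<integral>\<^sup>+p. indicator W (snd p) * \<beta> (fst p - snd p) \<partial>lborel)"
  proof (rule nn_integral_mono)
    fix p :: "'a \<times> 'a"
    obtain h k where p: "p = (h, k)" by (cases p)
    show "ennreal (cmod (\<integral>x. F x p \<partial>lborel)) \<le> indicator W (snd p) * \<beta> (fst p - snd p)"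
    proof (cases "h \<in> W \<and> k \<in> W")
      case True
      then show ?thesis using corr[of h k] by (simp add: p corr_eq w_def)
    next
      case False
      then have "w h * w k = 0" using w0 by auto
      then have "(\<integral>x. F x p \<partial>lborel) = 0" unfolding p corr_eq by (simp only: mult_zero_left)
      then show ?thesis by simp
    qed
  qed
  also have "\<dots> = (\<integral>\<^sup>+k. (\<integral>\<^sup>+h. indicator W k * \<beta> (h - k) \<partial>lborel) \<partial>lborel)"
    by (simp add: lborel_prod[symmetric] lborel_pair.nn_integral_snd[symmetric])
  also have "\<dots> = (\<integral>\<^sup>+k. indicator W k * (\<integral>\<^sup>+d. \<beta> d \<partial>lborel) \<partial>lborel)"
    by (simp add: nn_integral_cmult nn_integral_lborel_translate)
  also have "\<dots> = emeasure lborel W * (\<integral>\<^sup>+d. \<beta> d \<partial>lborel)" by (simp add: nn_integral_multc)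
  finally have G2: "ennreal (\<integral>x. (cmod (G x))\<^sup>2 \<partial>lborel) \<le> emeasure lborel W * (\<integral>\<^sup>+d. \<beta> d \<partial>lborel)" .
  have intG2: "integrable lborel (\<lambda>x. (cmod (G x))\<^sup>2)"
  proof -
    have "integrable lborel (\<lambda>x. complex_of_real ((cmod (G x))\<^sup>2))"
      using lborel_pair.integrable_fst'[OF Fint'] by (simp only: inner prod.case)
    then show ?thesis unfolding complex_of_real_integrable_eq .
  qed
  have G2': "ennreal (\<integral>x. (cmod (G x))\<^sup>2 \<partial>lborel) = (\<integral>\<^sup>+x. ennreal (cmod (G x)) ^ 2 \<partial>lborel)"
    using nn_integral_eq_integral[OF intG2] by (simp add: ennreal_power)
  \<comment> \<open>Cauchy--Schwarz on \<open>K'\<close>\<close>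
  have intGx: "integrable lborel G"
    using lborel_pair.integrable_fst[OF \<open>integrable (lborel \<Otimes>\<^sub>M lborel) (\<lambda>(x, h). w h * g (x + h))\<close>]
    by (simp add: G_def[abs_def])
  have "ennreal (cmod (\<integral>x. G x \<partial>lborel)) \<le> (\<integral>\<^sup>+x. ennreal (cmod (G x)) \<partial>lborel)"
    using intGx by (rule integral_norm_bound_ennreal)
  also have "\<dots> = (\<integral>\<^sup>+x. indicator K' x * ennreal (cmod (G x)) \<partial>lborel)"
    using G0 by (intro nn_integral_cong) (auto simp: indicator_def)
  finally have "(ennreal (cmod (\<integral>x. G x \<partial>lborel)))\<^sup>2 \<le> (\<integral>\<^sup>+x. indicator K' x * ennreal (cmod (G x)) \<partial>lborel)\<^sup>2"
    by (rule power_mono) simp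
  also have "\<dots> \<le> (\<integral>\<^sup>+x. (indicator K' x)\<^sup>2 \<partial>lborel) * (\<integral>\<^sup>+x. ennreal (cmod (G x)) ^ 2 \<partial>lborel)"
    by (rule Cauchy_Schwarz_nn_integral) simp_all
  also have "(\<integral>\<^sup>+x. (indicator K' x :: ennreal)\<^sup>2 \<partial>lborel) = (\<integral>\<^sup>+x. indicator K' x \<partial>lborel)"
    by (intro nn_integral_cong) (simp add: indicator_def)
  also have "\<dots> = emeasure lborel K'" by simp
  also have "emeasure lborel K' * (\<integral>\<^sup>+x. ennreal (cmod (G x)) ^ 2 \<partial>lborel)
      \<le> emeasure lborel K' * (emeasure lborel W * (\<integral>\<^sup>+d. \<beta> d \<partial>lborel))"
    using G2 by (intro mult_left_mono) (simp_all add: G2')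
  finally have "ennreal ((measure lborel W * cmod ?I)\<^sup>2) \<le>
      emeasure lborel W * (ennreal (measure lborel K') * (\<integral>\<^sup>+d. \<beta> d \<partial>lborel))"
    using Kfin by (simp add: intG norm_mult ennreal_power emeasure_eq_ennreal_measure less_top mult_ac)
  then have main: "ennreal (measure lborel W) * ennreal (measure lborel W * (cmod ?I)\<^sup>2) \<le>
      ennreal (measure lborel W) * (ennreal (measure lborel K') * (\<integral>\<^sup>+d. \<beta> d \<partial>lborel))"
    using Wfin by (simp add: emeasure_eq_ennreal_measure less_top power2_eq_square mult_ac flip: ennreal_mult)
  show ?thesis
  proof (cases "measure lborel W = 0")
    case False
    then have "0 < measure lborel W" by (simp add: zero_less_measure_iff)
    then show ?thesis using main by (subst (asm) ennreal_mult_le_mult_iff) auto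
  qed simp
qed

section \<open>Hoelder's inequality and dyadic integrals\<close>

lemma nn_integral_eq_0_if_zeros_subset:
  assumes "f \<in> borel_measurable M" "(\<integral>\<^sup>+x. f x \<partial>M) = 0" "\<And>x. f x = 0 \<Longrightarrow> g x = (0::ennreal)"
  shows "(\<integral>\<^sup>+x. g x \<partial>M) = 0"
proof -
  have "AE x in M. f x = 0" using assms(1,2) by (simp add: nn_integral_0_iff_AE)
  then have "AE x in M. g x = 0" by eventually_elim (rule assms(3))
  then show ?thesis by (subst nn_integral_cong_AE[of _ "\<lambda>_. 0"]) auto
qed

lemma epowr_pos: "t \<noteq> 0 \<Longrightarrow> 0 < epowr t s"
  by (cases t) (auto simp: epowr_def)

text \<open>Hoelder's inequality follows by integrating Young's inequality for the normalized functions.\<close>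

lemma Holder_nn_integral:
  fixes f g :: "'a \<Rightarrow> real"
  assumes [measurable]: "f \<in> borel_measurable M" "g \<in> borel_measurable M"
    and nonneg: "\<And>x. 0 \<le> f x" "\<And>x. 0 \<le> g x"
    and pq: "1 < p" "1 < q" "1 / p + 1 / q = 1"
  shows "(\<integral>\<^sup>+x. ennreal (f x * g x) \<partial>M) \<le>
    epowr (\<integral>\<^sup>+x. ennreal (f x powr p) \<partial>M) (1 / p) * epowr (\<integral>\<^sup>+x. ennreal (g x powr q) \<partial>M) (1 / q)"
proof -
  define A where "A = (\<integral>\<^sup>+x. ennreal (f x powr p) \<partial>M)"
  define B where "B = (\<integral>\<^sup>+x. ennreal (g x powr q) \<partial>M)"
  consider "A = 0 \<or> B = 0" | "A \<noteq> 0" "B \<noteq> 0" "A = \<infinity> \<or> B = \<infinity>" | "A \<noteq> 0" "B \<noteq> 0" "A \<noteq> \<infinity>" "B \<noteq> \<infinity>" by blast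
  then have "(\<integral>\<^sup>+x. ennreal (f x * g x) \<partial>M) \<le> epowr A (1 / p) * epowr B (1 / q)"
  proof cases
    case 1
    then have "(\<integral>\<^sup>+x. ennreal (f x * g x) \<partial>M) = 0"
    proof
      assume "A = 0"
      show ?thesis
        by (rule nn_integral_eq_0_if_zeros_subset[where f="\<lambda>x. ennreal (f x powr p)"])
           (use nonneg \<open>A = 0\<close> in \<open>auto simp: ennreal_eq_0_iff A_def powr_eq_0_iff\<close>)
    next
      assume "B = 0"
      show ?thesis
        by (rule nn_integral_eq_0_if_zeros_subset[where f="\<lambda>x. ennreal (g x powr q)"])
           (use nonneg \<open>B = 0\<close> in \<open>auto simp: ennreal_eq_0_iff B_def powr_eq_0_iff\<close>)
    qed
    then show ?thesis by simp
  next
    case 2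
    have "epowr A (1 / p) * epowr B (1 / q) = \<infinity>"
      using 2 epowr_pos[of A "1 / p"] epowr_pos[of B "1 / q"]
      by (auto simp: epowr_def ennreal_top_mult ennreal_mult_top split: if_splits)
    then show ?thesis by simp
  next
    case 3
    define a b where "a = enn2real A" and "b = enn2real B"
    have ab: "A = ennreal a" "B = ennreal b" "0 < a" "0 < b"
      using 3 by (auto simp: a_def b_def enn2real_positive_iff less_top zero_less_iff_neq_zero)
    define \<alpha> where "\<alpha> = a powr (1 / p)"
    define \<beta> where "\<beta> = b powr (1 / q)"
    have pos: "0 < \<alpha>" "0 < \<beta>" using ab by (auto simp: \<alpha>_def \<beta>_def)
    have \<alpha>: "\<alpha> powr p = a" "\<beta> powr q = b" using ab pq(1,2) by (simp_all add: \<alpha>_def \<beta>_def powr_powr)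
    have young: "f x * g x \<le> (\<alpha> * \<beta>) * (f x powr p / (p * a) + g x powr q / (q * b))" for x
    proof -
      have "(f x / \<alpha>) * (g x / \<beta>) \<le> (f x / \<alpha>) powr p / p + (g x / \<beta>) powr q / q"
        using nonneg[of x] pos by (intro Youngs_inequality pq) simp_all
      also have "\<dots> = f x powr p / (p * a) + g x powr q / (q * b)"
        using pos nonneg[of x] by (simp add: powr_divide \<alpha> mult.commute)
      finally have "(f x * g x) / (\<alpha> * \<beta>) \<le> f x powr p / (p * a) + g x powr q / (q * b)" by simp
      then show ?thesis using pos by (simp only: pos_divide_le_eq mult_pos_pos mult.commute)
    qed
    have "(\<integral>\<^sup>+x. ennreal (f x * g x) \<partial>M) \<le>
        (\<integral>\<^sup>+x. ennreal (\<alpha> * \<beta>) * (ennreal (1 / (p * a)) * ennreal (f x powr p) + ennreal (1 / (q * b)) * ennreal (g x powr q)) \<partial>M)"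
    proof (rule nn_integral_mono)
      fix x
      have "ennreal (f x * g x) \<le> ennreal ((\<alpha> * \<beta>) * (1 / (p * a) * f x powr p + 1 / (q * b) * g x powr q))"
        using young[of x] by (intro ennreal_leI) simp
      also have "\<dots> = ennreal (\<alpha> * \<beta>) * (ennreal (1 / (p * a)) * ennreal (f x powr p) + ennreal (1 / (q * b)) * ennreal (g x powr q))"
      proof -
        have "ennreal (1 / (p * a) * f x powr p) = ennreal (1 / (p * a)) * ennreal (f x powr p)"
          "ennreal (1 / (q * b) * g x powr q) = ennreal (1 / (q * b)) * ennreal (g x powr q)"
          using ab(3,4) pq(1,2) by (intro ennreal_mult; simp)+
        moreover have "0 \<le> 1 / (p * a) * f x powr p" "0 \<le> 1 / (q * b) * g x powr q"
          using ab(3,4) pq(1,2) by (intro mult_nonneg_nonneg; simp)+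
        ultimately show ?thesis using pos
          by (metis ennreal_mult ennreal_plus add_nonneg_nonneg mult_nonneg_nonneg less_imp_le)
      qed
      finally show "ennreal (f x * g x) \<le> \<dots>" .
    qed
    also have "\<dots> = ennreal (\<alpha> * \<beta>) * (ennreal (1 / (p * a)) * A + ennreal (1 / (q * b)) * B)"
      by (simp add: nn_integral_cmult nn_integral_add A_def B_def)
    also have "\<dots> = ennreal (\<alpha> * \<beta>) * ennreal (1 / p + 1 / q)"
      using ab(3,4) pq(1,2) unfolding ab(1,2) by (simp add: ennreal_mult[symmetric] ennreal_plus[symmetric] del: ennreal_plus)
    also have "\<dots> = epowr A (1 / p) * epowr B (1 / q)"
      using pos ab(3,4) unfolding ab(1,2) pq(3) by (simp add: epowr_def \<alpha>_def \<beta>_def ennreal_mult)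
    finally show ?thesis .
  qed
  then show ?thesis by (simp only: A_def B_def)
qed

lemma power_powr: "0 \<le> x \<Longrightarrow> (x ^ j) powr a = (x powr a) ^ j" for x :: real
  by (induction j) (simp_all add: powr_mult)

text \<open>The decay function is dominated by the sum of \<open>2 powr (-t * k)\<close> times the indicators of the
  balls of radius \<open>2 ^ k\<close>, up to a constant, so that the integral is bounded by a geometric series.\<close>

lemma nn_integral_decay_finite:
  fixes f :: "'a::euclidean_space \<Rightarrow> ennreal"
  assumes [measurable]: "f \<in> borel_measurable lebesgue"
    and growth: "\<And>k. (\<integral>\<^sup>+y\<in>ball 0 (2 ^ k). f y \<partial>lebesgue) \<le> ennreal (C * \<tau> ^ k)"
    and \<tau>: "0 \<le> \<tau>" "\<tau> < 2 powr t" and t: "0 \<le> t" and C: "0 \<le> C"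
  shows "(\<integral>\<^sup>+y. ennreal ((1 + norm y) powr (- t)) * f y \<partial>lebesgue) < \<infinity>"
proof -
  have [measurable]: "ball (0::'a) r \<in> sets lebesgue" for r by simp
  define c where "c k = 2 powr t * (1 / 2 powr t) ^ k" for k :: nat
  have c0: "0 \<le> c k" for k by (simp add: c_def)
  have dom: "ennreal ((1 + norm y) powr (- t)) \<le> (\<Sum>k. ennreal (c k) * indicator (ball 0 (2 ^ k)) y)" for y :: 'a
  proof -
    obtain k0 where "norm y < 2 ^ k0" using real_arch_pow[of 2 "norm y"] by auto
    then have ex: "\<exists>k. norm y < 2 ^ k" by blast
    define k where "k = (LEAST k. norm y < 2 ^ k)"
    have k: "norm y < 2 ^ k" unfolding k_def using ex by (rule LeastI_ex)
    have "(1 + norm y) powr (- t) \<le> c k"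
    proof (cases k)
      case 0
      have "(1 + norm y) powr (- t) \<le> 1" using t by (simp add: powr_minus ge_one_powr_ge_zero inverse_le_1_iff)
      also have "1 \<le> c k" using 0 t by (simp add: c_def ge_one_powr_ge_zero)
      finally show ?thesis .
    next
      case (Suc j)
      then have "\<not> norm y < 2 ^ j" using not_less_Least[of j "\<lambda>k. norm y < 2 ^ k"] by (simp add: k_def)
      then have "2 ^ j \<le> 1 + norm y" by simp
      then have "(1 + norm y) powr (- t) \<le> (2 ^ j) powr (- t)" using t by (intro powr_mono2') auto
      also have "\<dots> = c k" 
        by (simp add: c_def Suc power_powr powr_minus divide_inverse power_inverse)
      finally show ?thesis .
    qed
    then have "ennreal ((1 + norm y) powr (- t)) \<le> ennreal (c k) * indicator (ball 0 (2 ^ k)) y"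
      using k by (simp add: ennreal_leI)
    also have "\<dots> = (\<Sum>i\<in>{k}. ennreal (c i) * indicator (ball 0 (2 ^ i)) y)" by (simp only: sum.insert sum.empty finite.emptyI empty_iff not_False_eq_True add_0_right)
    also have "\<dots> \<le> (\<Sum>k. ennreal (c k) * indicator (ball 0 (2 ^ k)) y)"
      by (rule sum_le_suminf) auto
    finally show ?thesis .
  qed
  have "(\<integral>\<^sup>+y. ennreal ((1 + norm y) powr (- t)) * f y \<partial>lebesgue)
      \<le> (\<integral>\<^sup>+y. (\<Sum>k. ennreal (c k) * (f y * indicator (ball 0 (2 ^ k)) y)) \<partial>lebesgue)"
  proof (rule nn_integral_mono)
    fix y :: 'a
    have "ennreal ((1 + norm y) powr (- t)) * f y \<le> (\<Sum>k. ennreal (c k) * indicator (ball 0 (2 ^ k)) y) * f y"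
      using dom by (rule mult_right_mono) simp
    also have "\<dots> = (\<Sum>k. ennreal (c k) * (f y * indicator (ball 0 (2 ^ k)) y))"
      by (subst ennreal_suminf_multc[symmetric]) (simp add: mult_ac)
    finally show "ennreal ((1 + norm y) powr (- t)) * f y \<le> (\<Sum>k. ennreal (c k) * (f y * indicator (ball 0 (2 ^ k)) y))" .
  qed
  also have "\<dots> = (\<Sum>k. ennreal (c k) * (\<integral>\<^sup>+y\<in>ball 0 (2 ^ k). f y \<partial>lebesgue))"
    by (subst nn_integral_suminf) (measurable, simp add: nn_integral_cmult)
  also have "\<dots> \<le> (\<Sum>k. ennreal (c k) * ennreal (C * \<tau> ^ k))"
    by (intro suminf_le mult_left_mono growth) auto
  also have "\<dots> = (\<Sum>k. ennreal ((2 powr t * C) * (\<tau> / 2 powr t) ^ k))"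
    using c0 C \<tau> by (intro suminf_cong) (simp add: c_def power_divide flip: ennreal_mult)
  also have "\<dots> < \<infinity>"
  proof -
    have "summable (\<lambda>k. (2 powr t * C) * (\<tau> / 2 powr t) ^ k)"
      using \<tau> by (intro summable_mult summable_geometric) (simp add: abs_div)
    moreover have "0 \<le> (2 powr t * C) * (\<tau> / 2 powr t) ^ k" for k using C \<tau> by simp
    ultimately show ?thesis by (simp add: suminf_ennreal_eq[OF _ summable_sums] less_top)
  qed
  finally show ?thesis .
qed

text \<open>The dyadic shells shrink to the origin instead.\<close>

lemma nn_integral_singularity_finite:
  assumes "0 \<le> s" "s < real DIM('a)"
  shows "(\<integral>\<^sup>+y\<in>cball (0::'a::euclidean_space) 1. ennreal (norm y powr (- s)) \<partial>lborel) < \<infinity>"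
proof -
  define n where "n = DIM('a)"
  define b where "b = unit_ball_vol (real n)"
  define c where "c k = 2 powr s * (2 powr s) ^ k" for k :: nat
  have dom: "ennreal (norm y powr (- s)) * indicator (cball 0 1) y \<le>
      (\<Sum>k. ennreal (c k) * indicator (cball 0 ((1/2) ^ k)) y)" for y :: 'a
  proof (cases "y = 0 \<or> y \<notin> cball 0 1")
    case False
    then have y: "0 < norm y" "norm y \<le> 1" by auto
    have ex: "\<exists>k. (1/2) ^ k < norm y" using real_arch_pow_inv[of "norm y" "1/2"] y by auto
    define k where "k = (LEAST k. (1/2) ^ k < norm y)"
    have k: "(1/2) ^ k < norm y" unfolding k_def using ex by (rule LeastI_ex)
    have "k \<noteq> 0" using k y by (cases k) auto
    then obtain j where j: "k = Suc j" by (cases k) auto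
    then have "\<not> (1/2) ^ j < norm y" using not_less_Least[of j "\<lambda>k. (1/2) ^ k < norm y"] by (simp add: k_def)
    then have jy: "norm y \<le> (1/2) ^ j" by simp
    have "norm y powr (- s) \<le> ((1/2) ^ k) powr (- s)" using assms(1) k by (intro powr_mono2') auto
    also have "\<dots> = c j"
      by (simp add: c_def j power_powr powr_minus powr_divide power_one_over powr_mult)
    finally have "ennreal (norm y powr (- s)) * indicator (cball 0 1) y \<le> ennreal (c j) * indicator (cball 0 ((1/2) ^ j)) y"
      using jy y by (simp add: ennreal_leI)
    also have "\<dots> = (\<Sum>i\<in>{j}. ennreal (c i) * indicator (cball 0 ((1/2) ^ i)) y)" by (simp only: sum.insert sum.empty finite.emptyI empty_iff not_False_eq_True add_0_right)
    also have "\<dots> \<le> (\<Sum>k. ennreal (c k) * indicator (cball 0 ((1/2) ^ k)) y)"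
      by (rule sum_le_suminf) auto
    finally show ?thesis .
  qed auto
  have "(\<integral>\<^sup>+y\<in>cball (0::'a) 1. ennreal (norm y powr (- s)) \<partial>lborel)
      \<le> (\<integral>\<^sup>+y. (\<Sum>k. ennreal (c k) * indicator (cball (0::'a) ((1/2) ^ k)) y) \<partial>lborel)"
    using dom by (intro nn_integral_mono) auto
  also have "\<dots> = (\<Sum>k. ennreal (c k) * emeasure lborel (cball (0::'a) ((1/2) ^ k)))"
  proof (subst nn_integral_suminf)
    show "(\<lambda>y. ennreal (c i) * indicator (cball (0::'a) ((1/2) ^ i)) y) \<in> borel_measurable lborel" for i
      by (intro borel_measurable_times_ennreal borel_measurable_const borel_measurable_indicator) simp
    show "(\<Sum>i. \<integral>\<^sup>+y. ennreal (c i) * indicator (cball (0::'a) ((1/2) ^ i)) y \<partial>lborel) =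
        (\<Sum>k. ennreal (c k) * emeasure lborel (cball (0::'a) ((1/2) ^ k)))"
      by (intro suminf_cong nn_integral_cmult_indicator) simp
  qed
  also have "\<dots> = (\<Sum>k. ennreal ((2 powr s * b) * (2 powr s / 2 ^ n) ^ k))"
  proof (intro suminf_cong)
    fix k
    have "((1/2::real) ^ k) ^ n = (1 / 2 ^ n) ^ k"
      by (simp add: power_one_over power_mult[symmetric] mult.commute)
    then have "c k * (b * ((1/2) ^ k) ^ n) = (2 powr s * b) * (2 powr s / 2 ^ n) ^ k"
      by (simp add: c_def power_divide)
    then show "ennreal (c k) * emeasure lborel (cball (0::'a) ((1/2) ^ k)) = ennreal ((2 powr s * b) * (2 powr s / 2 ^ n) ^ k)"
      by (simp add: emeasure_cball b_def n_def c_def ennreal_mult[symmetric])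
  qed
  also have "\<dots> < \<infinity>"
  proof -
    have "2 powr s < 2 powr real n" using assms(2) by (simp add: n_def)
    then have "2 powr s / 2 ^ n < 1" by (simp add: powr_realpow)
    then have "summable (\<lambda>k. (2 powr s * b) * (2 powr s / 2 ^ n) ^ k)"
      by (intro summable_mult summable_geometric) simp
    moreover have "0 \<le> (2 powr s * b) * (2 powr s / 2 ^ n) ^ k" for k by (simp add: b_def)
    ultimately show ?thesis by (simp add: suminf_ennreal_eq[OF _ summable_sums] less_top)
  qed
  finally show ?thesis .
qed

section \<open>Reverse doubling and the dual weight\<close>

lemma Ap_weight_measurable:
  assumes "w \<in> Ap_weights p"
  shows "w \<in> borel_measurable lebesgue"
proof (rule borel_measurable_LIMSEQ_real)
  show "(\<lambda>x. indicator (cball 0 (real k)) x *\<^sub>R w x) \<in> borel_measurable lebesgue" for k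
    using assms by (auto simp: Ap_weights_def locally_integrable_def set_integrable_def
        intro!: borel_measurable_integrable)
  show "(\<lambda>k. indicator (cball 0 (real k)) x *\<^sub>R w x) \<longlonglongrightarrow> w x" for x
  proof (rule tendsto_eventually)
    obtain k0 where "norm x \<le> real k0" using real_arch_simple by blast
    then show "\<forall>\<^sub>F k in sequentially. indicator (cball 0 (real k)) x *\<^sub>R w x = w x"
      by (intro eventually_sequentiallyI[of k0]) (auto simp: indicator_def)
  qed
qed

lemma Ap_weight_finite_on_compact:
  assumes "w \<in> Ap_weights p" "compact K"
  shows "(\<integral>\<^sup>+x\<in>K. ennreal (w x) \<partial>lebesgue) < \<infinity>"
proof -
  have "integrable lebesgue (\<lambda>x. indicator K x *\<^sub>R w x)" "\<And>x. 0 < w x"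
    using assms by (auto simp: Ap_weights_def locally_integrable_def set_integrable_def)
  then have "(\<integral>\<^sup>+x. ennreal (indicator K x *\<^sub>R w x) \<partial>lebesgue) < \<infinity>"
    by (subst nn_integral_eq_integral) (auto simp: less_imp_le)
  moreover have "ennreal (indicator K x *\<^sub>R w x) = ennreal (w x) * indicator K x" for x
    by (simp add: indicator_def)
  ultimately show ?thesis by simp
qed

text \<open>Hoelder's inequality and the \<open>A\<^sub>p\<close> condition bound the mass of the dual weight on a ball of radius \<open>R\<close> by
  \<open>R powr (n * p / (p - 1))\<close>, which is just short of what is needed.  The gain comes from reverse doubling of \<open>w\<close>:
  the shell between two consecutive dyadic balls carries a fixed proportion of the mass of \<open>w\<close>, so
  the mass of the balls grows geometrically, and the \<open>A\<^sub>p\<close> condition turns this growth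
  into a bound for the dual weight with a smaller exponent.\<close>

lemma Ap_dual_weight_decay:
  fixes w :: "real^'n::finite \<Rightarrow> real"
  assumes p: "1 < p" and w: "w \<in> Ap_weights p"
  obtains s where "0 \<le> s" "s < real CARD('n)"
    "(\<integral>\<^sup>+y. ennreal ((1 + norm y) powr (- (s * (p / (p - 1))))) * ennreal (w y powr (- 1 / (p - 1))) \<partial>lebesgue) < \<infinity>"
proof -
  define n where "n = CARD('n)"
  define q where "q = p / (p - 1)"
  define \<sigma> where "\<sigma> y = w y powr (- 1 / (p - 1))" for y
  define B where "B k = ball (0::real^'n) (2 ^ k)" for k :: nat
  define W where "W k = (\<integral>\<^sup>+x\<in>B k. ennreal (w x) \<partial>lebesgue)" for k
  define S where "S k = (\<integral>\<^sup>+x\<in>B k. ennreal (\<sigma> x) \<partial>lebesgue)" for k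
  define b where "b = unit_ball_vol (real n)"
  define \<beta> where "\<beta> k = b * (2 ^ n) ^ k" for k :: nat
  have n: "0 < n" by (simp add: n_def)
  have q: "1 < q" "1 / p + 1 / q = 1" "q / p = 1 / (p - 1)" "p / q = p - 1"
    using p by (auto simp: q_def field_simps)
  have b: "0 < b" by (simp add: b_def)
  have \<beta>0: "0 < \<beta> k" for k using b by (simp add: \<beta>_def)
  have wpos: "0 < w x" for x using w by (simp add: Ap_weights_def)
  have wm[measurable]: "w \<in> borel_measurable lebesgue" using w by (rule Ap_weight_measurable)
  have \<sigma>m[measurable]: "\<sigma> \<in> borel_measurable lebesgue" unfolding \<sigma>_def by measurable
  have Bm[measurable]: "B k \<in> sets lebesgue" for k by (simp add: B_def)
  have Bmeas: "emeasure lebesgue (B k) = ennreal (\<beta> k)" for k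
    by (simp add: B_def emeasure_ball n_def b_def \<beta>_def power_mult[symmetric] mult.commute)
  have Bsub: "B k \<subseteq> B (Suc k)" for k
    unfolding B_def by (intro ball_subset_ball_iff[THEN iffD2] disjI1) simp
  have Wfin: "W k < \<infinity>" for k
  proof -
    have "W k \<le> (\<integral>\<^sup>+x\<in>cball 0 (2 ^ k). ennreal (w x) \<partial>lebesgue)"
      unfolding W_def B_def by (intro nn_integral_mono) (auto simp: indicator_def)
    then show ?thesis using Ap_weight_finite_on_compact[OF w compact_cball] by (rule le_less_trans)
  qed
  have Wpos: "W k \<noteq> 0" for k
  proof
    assume "W k = 0"
    then have "AE x in lebesgue. ennreal (w x) * indicator (B k) x = 0"
      unfolding W_def by (subst (asm) nn_integral_0_iff_AE) auto
    then have "AE x in lebesgue. x \<notin> B k"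
      by eventually_elim (use wpos in \<open>auto simp: indicator_def ennreal_eq_0_iff simp flip: not_less split: if_splits\<close>)
    then have "emeasure lebesgue (B k) = 0"
      by (subst (asm) AE_iff_measurable[where N="B k"]) auto
    then show False using \<beta>0[of k] by (simp add: Bmeas)
  qed
  define Wr where "Wr k = enn2real (W k)" for k
  have W: "W k = ennreal (Wr k)" "0 < Wr k" for k
    using Wfin[of k] Wpos[of k] by (auto simp: Wr_def enn2real_positive_iff less_top zero_less_iff_neq_zero)
  define A where "A = (SUP (c, r)\<in>UNIV \<times> {0<..}. ball_avg c r w * epowr (ball_avg c r \<sigma>) (p - 1))"
  have A: "A < \<infinity>" using w by (simp add: Ap_weights_def A_def \<sigma>_def[abs_def])
  define A0 where "A0 = enn2real A"
  have A0: "A = ennreal A0" "0 \<le> A0" using A by (auto simp: A0_def)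
  have avg: "ball_avg 0 (2 ^ k) w = ennreal (Wr k / \<beta> k)" for k
    using W(2)[of k] \<beta>0[of k] by (simp add: ball_avg_def W_def[symmetric, unfolded B_def] Bmeas[unfolded B_def] W(1) divide_ennreal)
  have avg\<sigma>: "ball_avg 0 (2 ^ k) \<sigma> = S k / ennreal (\<beta> k)" for k
    by (simp add: ball_avg_def S_def B_def Bmeas[unfolded B_def])
  have le: "ennreal (Wr k / \<beta> k) * epowr (S k / ennreal (\<beta> k)) (p - 1) \<le> A" for k
    unfolding avg[symmetric] avg\<sigma>[symmetric] A_def
    by (rule SUP_upper2[of "(0, 2 ^ k)"]) auto
  have Sfin: "S k < \<infinity>" for k
  proof (rule ccontr)
    assume "\<not> S k < \<infinity>"
    then have "S k = \<infinity>" by (simp add: less_top[symmetric])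
    then have "ennreal (Wr k / \<beta> k) * epowr (S k / ennreal (\<beta> k)) (p - 1) = \<infinity>"
      using W(2)[of k] \<beta>0[of k] by (simp add: ennreal_top_divide epowr_def ennreal_mult_top)
    then show False using le[of k] A by simp
  qed
  define Sr where "Sr k = enn2real (S k)" for k
  have S: "S k = ennreal (Sr k)" "0 \<le> Sr k" for k
    using Sfin[of k] by (auto simp: Sr_def)
  have Ap: "Wr k * Sr k powr (p - 1) \<le> A0 * \<beta> k powr p" for k
  proof -
    have "ennreal ((Wr k / \<beta> k) * (Sr k / \<beta> k) powr (p - 1)) \<le> ennreal A0"
    proof -
      have "epowr (S k / ennreal (\<beta> k)) (p - 1) = ennreal ((Sr k / \<beta> k) powr (p - 1))"
        using \<beta>0[of k] S(2)[of k] by (simp add: S(1) divide_ennreal epowr_def)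
      then show ?thesis
        using le[of k] W(2)[of k] \<beta>0[of k] unfolding A0(1)
        by (subst ennreal_mult) simp_all
    qed
    then have "(Wr k / \<beta> k) * (Sr k / \<beta> k) powr (p - 1) \<le> A0" using A0(2) by (simp add: ennreal_le_iff)
    moreover have "\<beta> k powr p = \<beta> k * \<beta> k powr (p - 1)"
      using \<beta>0[of k] powr_add[of "\<beta> k" 1 "p - 1"] by simp
    ultimately show ?thesis
      using \<beta>0[of k] S(2)[of k] by (simp add: powr_divide divide_le_eq mult_ac)
  qed
  have Hoelder: "measure lebesgue E powr p \<le> e * Sr k powr (p - 1)"
    if [measurable]: "E \<in> sets lebesgue" and E: "E \<subseteq> B k" "(\<integral>\<^sup>+x\<in>E. ennreal (w x) \<partial>lebesgue) = ennreal e" "0 \<le> e" for E k e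
  proof -
    define f where "f x = indicator E x * w x powr (1 / p)" for x
    define g where "g x = indicator (B k) x * w x powr (- (1 / p))" for x
    have [measurable]: "f \<in> borel_measurable lebesgue" "g \<in> borel_measurable lebesgue"
      unfolding f_def g_def by measurable
    have "ennreal (f x * g x) = indicator E x" for x
      using E(1) wpos[of x] by (auto simp: f_def g_def indicator_def powr_minus)
    moreover have "ennreal (f x powr p) = ennreal (w x) * indicator E x" for x
      using wpos[of x] p by (auto simp: f_def indicator_def powr_powr)
    moreover have "ennreal (g x powr q) = ennreal (\<sigma> x) * indicator (B k) x" for x
      using q(3) by (auto simp: g_def indicator_def powr_powr \<sigma>_def)
    moreover have "(\<integral>\<^sup>+x. ennreal (f x * g x) \<partial>lebesgue) \<le>
        epowr (\<integral>\<^sup>+x. ennreal (f x powr p) \<partial>lebesgue) (1 / p) * epowr (\<integral>\<^sup>+x. ennreal (g x powr q) \<partial>lebesgue) (1 / q)"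
      by (rule Holder_nn_integral) (use p q in \<open>auto simp: f_def g_def\<close>)
    ultimately have le: "emeasure lebesgue E \<le> ennreal (e powr (1 / p) * Sr k powr (1 / q))"
      using E S(2)[of k] by (simp add: S_def[symmetric] S(1) epowr_def ennreal_mult)
    then have "measure lebesgue E \<le> e powr (1 / p) * Sr k powr (1 / q)"
      by (simp add: measure_def enn2real_leI)
    then have "measure lebesgue E powr p \<le> (e powr (1 / p) * Sr k powr (1 / q)) powr p"
      using p by (intro powr_mono2) auto
    also have "\<dots> = e * Sr k powr (p - 1)"
      using p q E(3) by (simp add: powr_mult powr_powr)
    finally show ?thesis .
  qed
  \<comment> \<open>the proportion of the mass of a dyadic ball that lies in its outer shell, which is at least half of the ball\<close>
  define c where "c = (1 / 2) powr p / A0"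
  have A0pos: "0 < A0"
  proof -
    have "\<beta> 0 powr p \<le> Wr 0 * Sr 0 powr (p - 1)"
      using Hoelder[of "B 0" 0 "Wr 0"] W[of 0] \<beta>0[of 0] by (simp add: W_def[symmetric] measure_def Bmeas)
    also have "\<dots> \<le> A0 * \<beta> 0 powr p" by (rule Ap)
    finally show ?thesis using \<beta>0[of 0] by (auto simp: zero_less_mult_iff intro: ccontr)
  qed
  have shell: "Wr k \<le> (1 - c) * Wr (Suc k)" for k
  proof -
    define E where "E = B (Suc k) - B k"
    have [measurable]: "E \<in> sets lebesgue" by (simp add: E_def)
    have split: "W (Suc k) = (\<integral>\<^sup>+x\<in>E. ennreal (w x) \<partial>lebesgue) + W k"
      unfolding W_def
      by (subst nn_integral_add[symmetric])
         (use Bsub[of k] in \<open>auto intro!: nn_integral_cong simp: E_def indicator_def split: if_splits\<close>)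
    then have Ew: "(\<integral>\<^sup>+x\<in>E. ennreal (w x) \<partial>lebesgue) = ennreal (Wr (Suc k) - Wr k)"
      using W[of k] W[of "Suc k"] by (simp add: ennreal_minus[symmetric] ennreal_add_diff_cancel_right)
    have "W k \<le> W (Suc k)" using split by simp
    then have mono: "Wr k \<le> Wr (Suc k)" using W[of k] W[of "Suc k"] by simp
    have "measure lebesgue E = \<beta> (Suc k) - \<beta> k"
      unfolding E_def using Bsub[of k] Bmeas \<beta>0
      by (subst measure_Diff) (auto simp: measure_def less_imp_le)
    moreover have "2 * \<beta> k \<le> \<beta> (Suc k)"
      using b n power_increasing[of 1 n "2::real"] by (simp add: \<beta>_def)
    ultimately have Em: "\<beta> (Suc k) / 2 \<le> measure lebesgue E" by simp
    have "(\<beta> (Suc k) / 2) powr p \<le> measure lebesgue E powr p"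
      using Em \<beta>0[of "Suc k"] p by (intro powr_mono2) auto
    also have "\<dots> \<le> (Wr (Suc k) - Wr k) * Sr (Suc k) powr (p - 1)"
      by (rule Hoelder[OF _ _ Ew]) (use mono in \<open>auto simp: E_def\<close>)
    finally have "Wr (Suc k) * (\<beta> (Suc k) / 2) powr p \<le> Wr (Suc k) * ((Wr (Suc k) - Wr k) * Sr (Suc k) powr (p - 1))"
      using W(2)[of "Suc k"] by (intro mult_left_mono) auto
    also have "\<dots> = (Wr (Suc k) - Wr k) * (Wr (Suc k) * Sr (Suc k) powr (p - 1))" by simp
    also have "\<dots> \<le> (Wr (Suc k) - Wr k) * (A0 * \<beta> (Suc k) powr p)"
      using mono by (intro mult_left_mono Ap) auto
    finally have "(Wr (Suc k) * (1 / 2) powr p) * \<beta> (Suc k) powr p \<le> ((Wr (Suc k) - Wr k) * A0) * \<beta> (Suc k) powr p"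
      using \<beta>0[of "Suc k"] by (simp add: powr_divide mult_ac)
    then have "Wr (Suc k) * (1 / 2) powr p \<le> (Wr (Suc k) - Wr k) * A0"
      using \<beta>0[of "Suc k"] by (simp add: mult_le_cancel_right)
    then show ?thesis using A0pos by (simp add: c_def field_simps)
  qed
  have c0: "0 < c" using A0pos by (simp add: c_def)
  have c1: "c < 1"
  proof (rule ccontr)
    assume "\<not> c < 1"
    then have "(1 - c) * Wr 1 \<le> 0" using W(2)[of 1] by (simp add: mult_nonpos_nonneg)
    then show False using shell[of 0] W(2)[of 0] by simp
  qed
  have growth: "Wr 0 \<le> (1 - c) ^ k * Wr k" for k
  proof (induction k)
    case (Suc k)
    also have "(1 - c) ^ k * Wr k \<le> (1 - c) ^ k * ((1 - c) * Wr (Suc k))"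
      using shell[of k] c1 by (intro mult_left_mono) auto
    finally show ?case by (simp add: mult_ac)
  qed simp
  define D where "D = A0 * b powr p / Wr 0"
  define \<tau>0 where "\<tau>0 = (2 ^ n) powr p * (1 - c)"
  define \<tau> where "\<tau> = \<tau>0 powr (1 / (p - 1))"
  have D: "0 < D" using A0pos b W(2)[of 0] by (simp add: D_def)
  have \<tau>0: "0 < \<tau>0" using c1 by (simp add: \<tau>0_def)
  have Sgrowth: "Sr k \<le> D powr (1 / (p - 1)) * \<tau> ^ k" for k
  proof -
    have "Wr 0 * Sr k powr (p - 1) \<le> (1 - c) ^ k * (Wr k * Sr k powr (p - 1))"
      using mult_right_mono[OF growth[of k], of "Sr k powr (p - 1)"] by (simp add: mult_ac)
    also have "\<dots> \<le> (1 - c) ^ k * (A0 * \<beta> k powr p)"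
      using c1 by (intro mult_left_mono Ap) auto
    also have "\<beta> k powr p = b powr p * ((2 ^ n) powr p) ^ k"
      using b by (simp add: \<beta>_def powr_mult power_powr)
    finally have "Sr k powr (p - 1) \<le> D * \<tau>0 ^ k"
      using W(2)[of 0] by (simp add: D_def \<tau>0_def power_mult_distrib pos_le_divide_eq mult_ac)
    then have "(Sr k powr (p - 1)) powr (1 / (p - 1)) \<le> (D * \<tau>0 ^ k) powr (1 / (p - 1))"
      using p by (intro powr_mono2) auto
    then show ?thesis using p S(2)[of k] D \<tau>0 by (simp add: powr_powr powr_mult power_powr \<tau>_def)
  qed
  have \<tau>pos: "0 < \<tau>" using \<tau>0 by (simp add: \<tau>_def)
  have \<tau>less: "\<tau> < 2 powr (real n * q)"
  proof -
    have "\<tau>0 < (2 ^ n) powr p" using c0 by (simp add: \<tau>0_def)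
    then have "\<tau> < ((2 ^ n) powr p) powr (1 / (p - 1))"
      unfolding \<tau>_def using \<tau>0 p by (intro powr_less_mono2) auto
    also have "\<dots> = 2 powr (real n * q)"
      using p by (simp add: powr_powr q_def powr_realpow[symmetric])
    finally show ?thesis .
  qed
  \<comment> \<open>\<open>s\<close> lies halfway between the growth exponent of the dual weight, divided by \<open>q\<close>, and \<open>n\<close>\<close>
  define L where "L = log 2 \<tau>"
  have \<tau>L: "\<tau> = 2 powr L" using \<tau>pos by (simp add: L_def)
  then have "L < real n * q" using \<tau>less by simp
  then have Lq: "L / q < real n" using q by (simp add: divide_less_eq)
  define s where "s = max 0 ((L / q + real n) / 2)"
  have mid: "u < (u + v) / 2 \<and> (u + v) / 2 < v" if "u < v" for u v :: real using that by simp
  have s: "0 \<le> s" "s < real n" "L / q < s" using n mid[OF Lq] by (simp_all add: s_def less_max_iff_disj)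
  show ?thesis
  proof (rule that)
    show "0 \<le> s" "s < real CARD('n)" using s by (auto simp: n_def)
    have "(\<integral>\<^sup>+y. ennreal ((1 + norm y) powr (- (s * q))) * ennreal (\<sigma> y) \<partial>lebesgue) < \<infinity>"
    proof (rule nn_integral_decay_finite)
      show "(\<integral>\<^sup>+y\<in>ball 0 (2 ^ k). ennreal (\<sigma> y) \<partial>lebesgue) \<le> ennreal (D powr (1 / (p - 1)) * \<tau> ^ k)" for k
        using Sgrowth[of k] S(1)[of k] by (simp add: S_def B_def ennreal_leI)
      show "\<tau> < 2 powr (s * q)" unfolding \<tau>L using s(3) q by (simp add: divide_less_eq)
    qed (use \<tau>pos s q in auto)
    then show "(\<integral>\<^sup>+y. ennreal ((1 + norm y) powr (- (s * (p / (p - 1))))) * ennreal (w y powr (- 1 / (p - 1))) \<partial>lebesgue) < \<infinity>"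
      by (simp add: \<sigma>_def q_def)
  qed
qed

section \<open>Homogeneous phase functions\<close>

lemma smooth_on_differentiable: "smooth_on S f \<Longrightarrow> x \<in> S \<Longrightarrow> f differentiable (at x)"
  unfolding smooth_on_def by (metis Ck_on.simps(2))

lemma smooth_on_continuous: "smooth_on S f \<Longrightarrow> continuous_on S f"
  unfolding smooth_on_def by (metis Ck_on.simps(1))

lemma smooth_on_derivative: "smooth_on S f \<Longrightarrow> b \<in> Basis \<Longrightarrow> smooth_on S (\<lambda>x. frechet_derivative f (at x) b)"
  unfolding smooth_on_def by (metis Ck_on.simps(2))

lemma has_vector_derivative_along_line:
  fixes f :: "'a::real_normed_vector \<Rightarrow> 'b::real_normed_vector"
  assumes "f differentiable (at (x + s *\<^sub>R v))"
  shows "((\<lambda>t. f (x + t *\<^sub>R v)) has_vector_derivative frechet_derivative f (at (x + s *\<^sub>R v)) v) (at s)"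
proof -
  have d: "(f has_derivative frechet_derivative f (at (x + s *\<^sub>R v))) (at (x + s *\<^sub>R v))"
    using assms by (simp add: frechet_derivative_works)
  have "((\<lambda>t. x + t *\<^sub>R v) has_derivative (\<lambda>t. t *\<^sub>R v)) (at s)"
    by (auto intro!: derivative_eq_intros)
  from has_derivative_compose[OF this d]
  show ?thesis using linear_frechet_derivative[OF assms]
    by (simp add: has_vector_derivative_def linear_scale)
qed

text \<open>The \<open>k\<close>-th derivative of the phase in \<open>\<xi>\<^sub>j\<close>.  Joint continuity in \<open>(x, \<xi>)\<close> gives bounds that
  are uniform for \<open>x\<close> in a compact set, hence the derivatives are taken on the product.\<close>

definition phase_deriv :: "(real^'n::finite \<Rightarrow> real^'n \<Rightarrow> real) \<Rightarrow> 'n \<Rightarrow> nat \<Rightarrow> (real^'n) \<times> (real^'n) \<Rightarrow> real" where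
  "phase_deriv \<phi> j k = ((\<lambda>g p. frechet_derivative g (at p) (0, axis j 1)) ^^ k) (\<lambda>(x, \<xi>). \<phi> x \<xi>)"

locale homogeneous_phase =
  fixes \<phi> :: "real^'n::finite \<Rightarrow> real^'n \<Rightarrow> real"
  assumes smooth: "smooth_on (UNIV \<times> (UNIV - {0})) (\<lambda>(x, \<xi>). \<phi> x \<xi>)"
    and homogeneous: "\<And>x \<xi> t. \<xi> \<noteq> 0 \<Longrightarrow> 0 < t \<Longrightarrow> \<phi> x (t *\<^sub>R \<xi>) = t * \<phi> x \<xi>"
    and rank_hessian: "\<And>x \<xi>. \<xi> \<noteq> 0 \<Longrightarrow> rank (hessian (\<phi> x) \<xi>) = CARD('n) - 1"
begin

abbreviation "punctured \<equiv> (UNIV :: (real^'n) set) \<times> (UNIV - {0 :: real^'n})"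

abbreviation "D \<equiv> phase_deriv \<phi>"

definition "G j k p v = frechet_derivative (D j k) (at p) (0, v)"

lemma axis_snd_in_Basis: "(0 :: real^'n, axis j 1 :: real^'n) \<in> Basis"
  by (simp add: Basis_prod_def axis_in_Basis_iff)

lemma D_0: "D j 0 (x, \<xi>) = \<phi> x \<xi>"
  by (simp add: phase_deriv_def)

lemma D_Suc: "D j (Suc k) p = G j k p (axis j 1)"
  by (simp add: phase_deriv_def G_def)

lemma smooth_D: "smooth_on punctured (D j k)"
proof (induction k)
  case 0
  then show ?case using smooth by (simp add: phase_deriv_def)
next
  case (Suc k)
  then show ?case unfolding D_Suc[abs_def] G_def
    using smooth_on_derivative[OF Suc axis_snd_in_Basis] by simp
qed

lemma differentiable_D: "\<xi> \<noteq> 0 \<Longrightarrow> D j k differentiable (at (x, \<xi>))"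
  by (rule smooth_on_differentiable[OF smooth_D]) simp

lemma G_sum:
  assumes "\<xi> \<noteq> 0"
  shows "G j k (x, \<xi>) v = (\<Sum>i\<in>UNIV. v $ i * G j k (x, \<xi>) (axis i 1))"
proof -
  interpret linear "frechet_derivative (D j k) (at (x, \<xi>))"
    using differentiable_D[OF assms] by (rule linear_frechet_derivative)
  have "(0, v) = (\<Sum>i\<in>UNIV. v $ i *\<^sub>R (0 :: real^'n, axis i 1 :: real^'n))"
    by (simp add: prod_eq_iff fst_sum snd_sum basis_expansion scalar_mult_eq_scaleR[symmetric])
  then have "G j k (x, \<xi>) v = frechet_derivative (D j k) (at (x, \<xi>)) (\<Sum>i\<in>UNIV. v $ i *\<^sub>R (0, axis i 1))"
    by (simp only: G_def)
  then show ?thesis by (simp only: sum scale G_def real_scaleR_def)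
qed

lemma D_line:
  assumes "\<xi> + s *\<^sub>R v \<noteq> 0"
  shows "((\<lambda>t. D j k (x, \<xi> + t *\<^sub>R v)) has_real_derivative G j k (x, \<xi> + s *\<^sub>R v) v) (at s)"
proof -
  have "D j k differentiable (at ((x, \<xi>) + s *\<^sub>R (0, v)))"
    using differentiable_D[OF assms] by simp
  from has_vector_derivative_along_line[OF this]
  show ?thesis by (simp add: G_def has_real_derivative_iff_has_vector_derivative)
qed

lemma continuous_on_D: "continuous_on punctured (D j k)"
  by (rule smooth_on_continuous[OF smooth_D])

lemma continuous_on_G: "continuous_on (punctured \<times> UNIV) (\<lambda>(p, v). G j k p v)"
proof -
  have "continuous_on punctured (\<lambda>p. G j k p (axis i 1))" for i
    using smooth_on_continuous[OF smooth_on_derivative[OF smooth_D axis_snd_in_Basis]] by (simp add: G_def)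
  then have c: "continuous_on (punctured \<times> UNIV) (\<lambda>q. G j k (fst q) (axis i 1))" for i
    by (rule continuous_on_compose2) (auto intro!: continuous_intros)
  have "continuous_on (punctured \<times> (UNIV :: (real^'n) set)) (\<lambda>q. \<Sum>i\<in>UNIV. snd q $ i * G j k (fst q) (axis i 1))"
    by (intro continuous_intros c)
  moreover have "(\<Sum>i\<in>UNIV. snd q $ i * G j k (fst q) (axis i 1)) = (\<lambda>(p, v). G j k p v) q"
    if "q \<in> punctured \<times> UNIV" for q
  proof -
    obtain x \<xi> v where q: "q = ((x, \<xi>), v)" by (cases q) auto
    then have "\<xi> \<noteq> 0" using that by auto
    from G_sum[OF this, of j k x v] show ?thesis by (simp only: q prod.case fst_conv snd_conv)
  qed
  ultimately show ?thesis by (rule continuous_on_eq)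
qed

lemma partial_phi: "\<xi> \<noteq> 0 \<Longrightarrow> partial j (\<phi> x) \<xi> = D j 1 (x, \<xi>)"
proof -
  assume \<xi>: "\<xi> \<noteq> 0"
  have d: "((\<lambda>(x, \<xi>). \<phi> x \<xi>) has_derivative frechet_derivative (\<lambda>(x, \<xi>). \<phi> x \<xi>) (at (x, \<xi>))) (at (x, \<xi>))"
    using smooth_on_differentiable[OF smooth, of "(x, \<xi>)"] \<xi> by (simp add: frechet_derivative_works)
  have "(Pair x has_derivative (\<lambda>v. (0, v))) (at \<xi>)"
    by (auto intro!: derivative_eq_intros)
  from has_derivative_compose[OF this d]
  have "(\<phi> x has_derivative (\<lambda>v. frechet_derivative (\<lambda>(x, \<xi>). \<phi> x \<xi>) (at (x, \<xi>)) (0, v))) (at \<xi>)"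
    by simp
  from frechet_derivative_at[OF this]
  show ?thesis by (simp add: partial_def phase_deriv_def fun_eq_iff)
qed

lemma hessian_phi:
  assumes "\<xi> \<noteq> 0"
  shows "hessian (\<phi> x) \<xi> $ i $ j = G j 1 (x, \<xi>) (axis i 1)"
proof -
  have "(Pair x has_derivative (\<lambda>v. (0, v))) (at \<xi>)"
    by (auto intro!: derivative_eq_intros)
  from has_derivative_compose[OF this differentiable_D[OF assms, unfolded frechet_derivative_works]]
  have "((\<lambda>\<xi>. D j 1 (x, \<xi>)) has_derivative (\<lambda>v. G j 1 (x, \<xi>) v)) (at \<xi>)"
    by (simp add: G_def)
  then have "(partial j (\<phi> x) has_derivative (\<lambda>v. G j 1 (x, \<xi>) v)) (at \<xi>)"
    by (rule has_derivative_transform_within_open[of _ _ _ _ "UNIV - {0}"])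
       (use assms partial_phi in auto)
  from frechet_derivative_at[OF this]
  show ?thesis by (simp add: hessian_def partial_def fun_eq_iff)
qed

text \<open>The gradient of \<open>\<phi>\<close> in \<open>\<xi>\<close> is homogeneous of degree zero, so its derivative in the radial
  direction vanishes.\<close>

lemma D1_homogeneous:
  assumes "\<xi> \<noteq> 0" "0 < t"
  shows "D j 1 (x, t *\<^sub>R \<xi>) = D j 1 (x, \<xi>)"
proof -
  have nz: "t *\<^sub>R \<xi> \<noteq> 0" using assms by simp
  have 1: "((\<lambda>s. D j 0 (x, \<xi> + s *\<^sub>R axis j 1)) has_real_derivative D j 1 (x, \<xi>)) (at 0)"
    using D_line[of \<xi> 0 "axis j 1" j 0 x] assms by (simp add: D_Suc)
  have 2: "((\<lambda>s. D j 0 (x, t *\<^sub>R \<xi> + s *\<^sub>R axis j 1)) has_real_derivative D j 1 (x, t *\<^sub>R \<xi>)) (at (t * 0))"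
    using D_line[of "t *\<^sub>R \<xi>" 0 "axis j 1" j 0 x] nz by (simp add: D_Suc)
  have "((\<lambda>s. t * s) has_real_derivative t) (at 0)" by (auto intro!: derivative_eq_intros)
  from DERIV_chain2[OF 2 this]
  have 3: "((\<lambda>s. D j 0 (x, t *\<^sub>R \<xi> + (t * s) *\<^sub>R axis j 1)) has_real_derivative D j 1 (x, t *\<^sub>R \<xi>) * t) (at 0)" .
  have ev: "\<forall>\<^sub>F s in nhds 0. \<xi> + s *\<^sub>R axis j 1 \<in> UNIV - {0}"
    using assms by (intro line_in_open_eventually) auto
  have "((\<lambda>s. t * D j 0 (x, \<xi> + s *\<^sub>R axis j 1)) has_real_derivative D j 1 (x, t *\<^sub>R \<xi>) * t) (at 0)"
  proof (subst DERIV_cong_ev[OF refl _ refl])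
    show "\<forall>\<^sub>F s in nhds 0. t * D j 0 (x, \<xi> + s *\<^sub>R axis j 1) = D j 0 (x, t *\<^sub>R \<xi> + (t * s) *\<^sub>R axis j 1)"
      using ev
    proof eventually_elim
      case (elim s)
      then have "\<phi> x (t *\<^sub>R (\<xi> + s *\<^sub>R axis j 1)) = t * \<phi> x (\<xi> + s *\<^sub>R axis j 1)"
        using assms by (intro homogeneous) auto
      then show ?case by (simp add: D_0 scaleR_add_right)
    qed
  qed (rule 3)
  moreover have "((\<lambda>s. t * D j 0 (x, \<xi> + s *\<^sub>R axis j 1)) has_real_derivative t * D j 1 (x, \<xi>)) (at 0)"
    using 1 by (rule DERIV_cmult)
  ultimately have "D j 1 (x, t *\<^sub>R \<xi>) * t = t * D j 1 (x, \<xi>)" by (rule DERIV_unique)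
  then show ?thesis using assms by simp
qed

lemma G_radial:
  assumes "\<xi> \<noteq> 0"
  shows "G j 1 (x, \<xi>) \<xi> = 0"
proof -
  have 1: "((\<lambda>s. D j 1 (x, \<xi> + s *\<^sub>R \<xi>)) has_real_derivative G j 1 (x, \<xi>) \<xi>) (at 0)"
    using D_line[of \<xi> 0 \<xi> j 1 x] assms by simp
  have "((\<lambda>s. D j 1 (x, \<xi> + s *\<^sub>R \<xi>)) has_real_derivative 0) (at 0)"
  proof (subst DERIV_cong_ev[OF refl _ refl])
    show "\<forall>\<^sub>F s in nhds (0::real). D j 1 (x, \<xi> + s *\<^sub>R \<xi>) = D j 1 (x, \<xi>)"
      using eventually_nhds_in_open[of "{-1<..}" "0::real", simplified]
    proof eventually_elim
      case (elim s)
      then show ?case using D1_homogeneous[OF assms, of "1 + s" j x] by (simp add: scaleR_add_left)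
    qed
  qed simp
  from DERIV_unique[OF 1 this] show ?thesis .
qed

text \<open>The Hessian has rank \<open>n - 1\<close>, so its kernel is the radial line and nothing more.\<close>

lemma G_eq_0_imp_radial:
  assumes "\<xi> \<noteq> 0" "\<And>j. G j 1 (x, \<xi>) v = 0"
  shows "v \<in> span {\<xi>}"
proof -
  define H where "H = hessian (\<phi> x) \<xi>"
  define N where "N = {y \<in> UNIV. \<forall>z\<in>span (columns H). orthogonal z y}"
  have "column j H \<bullet> y = (\<Sum>i\<in>UNIV. y $ i * G j 1 (x, \<xi>) (axis i 1))" for j y
    by (simp add: column_def inner_vec_def H_def hessian_phi[OF assms(1)] mult.commute)
  then have col: "column j H \<bullet> y = G j 1 (x, \<xi>) y" for j y
    by (simp only: G_sum[OF assms(1), of j 1 x y])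
  have mem: "y \<in> N" if "\<And>j. G j 1 (x, \<xi>) y = 0" for y
  proof -
    have "orthogonal y z" if "z \<in> columns H" for z
      using that \<open>\<And>j. G j 1 (x, \<xi>) y = 0\<close>
      by (auto simp: columns_def orthogonal_def inner_commute[of y] col simp del: One_nat_def)
    then show ?thesis
      by (auto simp: N_def orthogonal_commute[of _ y] intro: orthogonal_to_span)
  qed
  have "dim N + dim (span (columns H)) = dim (UNIV :: (real^'n) set)"
    unfolding N_def by (rule dim_subspace_orthogonal_to_vectors) auto
  then have "dim N + dim (columns H) = CARD('n)" by (simp add: dim_span)
  moreover have "dim (columns H) = CARD('n) - 1"
    using rank_hessian[OF assms(1), of x] by (simp add: H_def column_rank_def)
  moreover have "0 < CARD('n)" by simp
  ultimately have "dim N = 1" by linarith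
  moreover have "subspace N" unfolding N_def by (simp add: subspace_orthogonal_to_vectors)
  moreover have "span {\<xi>} \<subseteq> N" using mem[OF G_radial[OF assms(1)]] \<open>subspace N\<close>
    by (simp add: span_minimal)
  moreover have "dim (span {\<xi>}) = 1" using assms(1) by (simp add: dim_span dim_singleton)
  ultimately have "span {\<xi>} = N" by (intro subspace_dim_equal) auto
  then show ?thesis using mem[of v] assms(2) by simp
qed

text \<open>After a dilation by the size of the frequency, all balls in question lie in this compact set.\<close>

definition annulus :: "(real^'n) set" where
  "annulus = cball 0 2 - ball 0 (1 / 2)"

lemma compact_annulus: "compact annulus"
  unfolding annulus_def by (intro compact_diff compact_cball open_ball)

lemma annulus_nonzero: "\<zeta> \<in> annulus \<Longrightarrow> \<zeta> \<noteq> 0"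
  by (auto simp: annulus_def)

lemma ball_subset_annulus:
  assumes "norm \<omega> = 1" "\<zeta> \<in> ball \<omega> (1 / 2)"
  shows "\<zeta> \<in> annulus"
proof -
  have "norm (\<omega> - \<zeta>) < 1 / 2" using assms(2) by (simp add: dist_norm)
  then show ?thesis
    using assms(1) norm_triangle_ineq2[of \<omega> "\<zeta>"] norm_triangle_ineq2[of "\<zeta>" \<omega>]
    by (simp add: annulus_def dist_norm norm_minus_commute)
qed

lemma D_G_bounded:
  assumes K: "compact K"
  shows "\<exists>M\<ge>0. \<forall>j k x \<zeta>. k \<le> N \<longrightarrow> x \<in> K \<longrightarrow> \<zeta> \<in> annulus \<longrightarrow>
    \<bar>D j k (x, \<zeta>)\<bar> \<le> M \<and> (\<forall>v. \<bar>G j k (x, \<zeta>) v\<bar> \<le> M * norm v)"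
proof -
  have sub: "K \<times> annulus \<subseteq> punctured" using annulus_nonzero by auto
  have "\<exists>M\<ge>0. \<forall>x\<in>K. \<forall>\<zeta>\<in>annulus. \<bar>D j k (x, \<zeta>)\<bar> \<le> M \<and> (\<forall>v. \<bar>G j k (x, \<zeta>) v\<bar> \<le> M * norm v)" for j k
  proof -
    have "compact (D j k ` (K \<times> annulus))"
      by (intro compact_continuous_image continuous_on_subset[OF continuous_on_D] sub compact_Times K compact_annulus)
    then obtain M1 where M1: "\<forall>x\<in>K. \<forall>\<zeta>\<in>annulus. \<bar>D j k (x, \<zeta>)\<bar> \<le> M1" "0 < M1"
      using compact_imp_bounded bounded_pos by (metis (no_types, lifting) imageI mem_Sigma_iff real_norm_def)
    have "compact ((\<lambda>(p, v). G j k p v) ` ((K \<times> annulus) \<times> sphere 0 1))"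
      by (intro compact_continuous_image continuous_on_subset[OF continuous_on_G] compact_Times K compact_annulus compact_sphere)
         (use sub in auto)
    then have "bounded ((\<lambda>(p, v). G j k p v) ` ((K \<times> annulus) \<times> sphere 0 1))"
      by (rule compact_imp_bounded)
    then obtain M2 where M2': "\<forall>y\<in>(\<lambda>(p, v). G j k p v) ` ((K \<times> annulus) \<times> sphere 0 1). norm y \<le> M2" "0 < M2"
      unfolding bounded_pos by blast
    then have M2: "\<bar>G j k (x, \<zeta>) v\<bar> \<le> M2" if "x \<in> K" "\<zeta> \<in> annulus" "norm v = 1" for x \<zeta> v
      using that by force
    have "\<bar>G j k (x, \<zeta>) v\<bar> \<le> (M1 + M2) * norm v" if "x \<in> K" "\<zeta> \<in> annulus" for x \<zeta> v
    proof -
      interpret linear "frechet_derivative (D j k) (at (x, \<zeta>))"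
        using differentiable_D[OF annulus_nonzero[OF that(2)]] by (rule linear_frechet_derivative)
      have hom: "G j k (x, \<zeta>) (c *\<^sub>R y) = c * G j k (x, \<zeta>) y" for c y
        using scale[of c "(0, y)"] by (simp add: G_def)
      show ?thesis
      proof (cases "v = 0")
        case False
        have "G j k (x, \<zeta>) v = norm v * G j k (x, \<zeta>) ((1 / norm v) *\<^sub>R v)"
          using False by (simp add: hom)
        also have "\<bar>\<dots>\<bar> \<le> norm v * M2"
          using M2[OF that, of "(1 / norm v) *\<^sub>R v"] False by (simp add: abs_mult mult_left_mono)
        also have "\<dots> \<le> (M1 + M2) * norm v" using M1(2) by (simp add: algebra_simps)
        finally show ?thesis .
      qed (use hom[of 0 0] in simp)
    qed
    moreover have "\<bar>D j k (x, \<zeta>)\<bar> \<le> M1 + M2" if "x \<in> K" "\<zeta> \<in> annulus" for x \<zeta>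
      using M1(1) M2'(2) that by force
    ultimately show ?thesis using M1(2) M2'(2) by (intro exI[of _ "M1 + M2"]) auto
  qed
  then obtain M where M: "\<And>j k. 0 \<le> M j k" "\<And>j k x \<zeta>. x \<in> K \<Longrightarrow> \<zeta> \<in> annulus \<Longrightarrow> \<bar>D j k (x, \<zeta>)\<bar> \<le> M j k"
      "\<And>j k x \<zeta> v. x \<in> K \<Longrightarrow> \<zeta> \<in> annulus \<Longrightarrow> \<bar>G j k (x, \<zeta>) v\<bar> \<le> M j k * norm v"
    by metis
  define M0 where "M0 = (\<Sum>k\<le>N. \<Sum>j\<in>UNIV. M j k)"
  have le: "M j k \<le> M0" if "k \<le> N" for j k
  proof -
    have "M j k \<le> (\<Sum>j\<in>UNIV. M j k)" using M(1) by (intro member_le_sum) auto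
    also have "\<dots> \<le> M0" unfolding M0_def
      using M(1) that by (intro member_le_sum[where f="\<lambda>k. \<Sum>j\<in>UNIV. M j k"]) (auto intro: sum_nonneg)
    finally show ?thesis .
  qed
  show ?thesis
  proof (intro exI[of _ M0] conjI allI impI)
    show "0 \<le> M0" unfolding M0_def by (intro sum_nonneg M(1))
    fix j k x \<zeta> v assume *: "k \<le> N" "x \<in> K" "\<zeta> \<in> annulus"
    show "\<bar>D j k (x, \<zeta>)\<bar> \<le> M0" using M(2)[OF *(2,3), of j k] le[OF *(1), of j] by linarith
    show "\<bar>G j k (x, \<zeta>) v\<bar> \<le> M0 * norm v"
      using M(3)[OF *(2,3), of j k v] mult_right_mono[OF le[OF *(1), of j] norm_ge_zero[of v]] by linarith
  qed
qed

text \<open>The mean value theorem on the segment from \<open>\<zeta>\<close> to \<open>\<zeta> + h\<close>, which stays in the ball and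
  hence away from the origin.\<close>

lemma D_difference:
  assumes "norm \<omega> = 1" "\<zeta> \<in> ball \<omega> r" "\<zeta> + h \<in> ball \<omega> r" "r \<le> 1 / 2"
  shows "\<exists>\<zeta>'\<in>ball \<omega> r. D j k (x, \<zeta> + h) - D j k (x, \<zeta>) = G j k (x, \<zeta>') h"
proof -
  have seg: "\<zeta> + t *\<^sub>R h \<in> ball \<omega> r" if "0 \<le> t" "t \<le> 1" for t
  proof -
    have "(1 - t) *\<^sub>R \<zeta> + t *\<^sub>R (\<zeta> + h) \<in> ball \<omega> r"
      using assms(2,3) that by (intro convexD[OF convex_ball]) auto
    then show ?thesis by (simp add: algebra_simps)
  qed
  have der: "((\<lambda>t. D j k (x, \<zeta> + t *\<^sub>R h)) has_real_derivative G j k (x, \<zeta> + t *\<^sub>R h) h) (at t)"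
    if "0 \<le> t" "t \<le> 1" for t
  proof (rule D_line)
    have "\<zeta> + t *\<^sub>R h \<in> ball \<omega> (1 / 2)" using seg[OF that] assms(4) by auto
    then show "\<zeta> + t *\<^sub>R h \<noteq> 0" using ball_subset_annulus[OF assms(1)] annulus_nonzero by blast
  qed
  obtain t where t: "0 < t" "t < 1"
    "D j k (x, \<zeta> + 1 *\<^sub>R h) - D j k (x, \<zeta> + 0 *\<^sub>R h) = (1 - 0) * G j k (x, \<zeta> + t *\<^sub>R h) h"
    using MVT2[of 0 1 "\<lambda>t. D j k (x, \<zeta> + t *\<^sub>R h)" "\<lambda>t. G j k (x, \<zeta> + t *\<^sub>R h) h"] der by auto
  then show ?thesis using seg[of t] by (intro bexI[of _ "\<zeta> + t *\<^sub>R h"]) auto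
qed

text \<open>Nondegeneracy, uniformly for \<open>x\<close> in a compact set.  A direction \<open>v\<close> with one coordinate much
  smaller than that of the unit vector \<open>\<omega>\<close> stays away from the radial line, so some component of the
  gradient of \<open>\<phi>\<close> moves at a definite rate in the direction \<open>v\<close>.\<close>

lemma gradient_separation:
  assumes K: "compact K"
  shows "\<exists>c>0. \<exists>\<delta>>0. \<delta> \<le> 1 / 2 \<and> (\<forall>x\<in>K. \<forall>\<omega> i h. norm \<omega> = 1 \<longrightarrow> 1 \<le> real CARD('n) * \<bar>\<omega> $ i\<bar> \<longrightarrow>
    2 * real CARD('n) * \<bar>h $ i\<bar> \<le> norm h \<longrightarrow>
    (\<exists>j. \<forall>\<zeta>. \<zeta> \<in> ball \<omega> \<delta> \<longrightarrow> \<zeta> + h \<in> ball \<omega> \<delta> \<longrightarrow>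
       c * norm h \<le> \<bar>D j 1 (x, \<zeta> + h) - D j 1 (x, \<zeta>)\<bar>))"
proof -
  define n where "n = real CARD('n)"
  have n: "0 < n" by (simp add: n_def)
  \<comment> \<open>the compact set of base points, unit vectors \<open>\<omega>\<close> and transversal unit directions\<close>
  define T where "T = (\<Union>i. (K \<times> sphere 0 1) \<times> sphere 0 1 \<inter>
    {q :: ((real^'n) \<times> (real^'n)) \<times> (real^'n). 1 \<le> n * \<bar>snd (fst q) $ i\<bar> \<and> 2 * n * \<bar>snd q $ i\<bar> \<le> 1})"
  have "closed {q :: ((real^'n) \<times> (real^'n)) \<times> (real^'n). 1 \<le> n * \<bar>snd (fst q) $ i\<bar> \<and> 2 * n * \<bar>snd q $ i\<bar> \<le> 1}" for i
    by (intro closed_Collect_conj closed_Collect_le continuous_intros)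
  then have T: "compact T" unfolding T_def
    by (intro compact_UN compact_Int_closed compact_Times K compact_sphere) auto
  define Q where "Q = (\<lambda>q. \<Sum>j\<in>UNIV. \<bar>(\<lambda>(p, v). G j 1 p v) q\<bar>)"
  have Tsub: "T \<subseteq> punctured \<times> UNIV" by (auto simp: T_def)
  have Qc: "continuous_on T Q" unfolding Q_def
    by (intro continuous_intros continuous_on_subset[OF continuous_on_G Tsub])
  have Qpos: "0 < Q q" if qT: "q \<in> T" for q
  proof -
    obtain x \<omega> v where q: "q = ((x, \<omega>), v)" by (cases q) auto
    obtain i where i: "norm \<omega> = 1" "norm v = 1" "1 \<le> n * \<bar>\<omega> $ i\<bar>" "2 * n * \<bar>v $ i\<bar> \<le> 1"
      using qT by (auto simp: T_def q)
    have "\<omega> \<noteq> 0" using i(1) by auto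
    have "\<exists>j. G j 1 (x, \<omega>) v \<noteq> 0"
    proof (rule ccontr)
      assume "\<not> ?thesis"
      then have "v \<in> span {\<omega>}" using G_eq_0_imp_radial[OF \<open>\<omega> \<noteq> 0\<close>] by blast
      then obtain a where a: "v = a *\<^sub>R \<omega>" by (auto simp: span_singleton)
      then have "\<bar>a\<bar> = 1" using i by simp
      then have "\<bar>v $ i\<bar> = \<bar>\<omega> $ i\<bar>" by (simp add: a abs_mult)
      then show False using i(3,4) by simp
    qed
    then obtain j where "0 < \<bar>G j 1 (x, \<omega>) v\<bar>" by auto
    also have "\<dots> \<le> Q q" unfolding Q_def q prod.case by (rule member_le_sum) auto
    finally show ?thesis .
  qed
  obtain c0 where c0: "0 < c0" "\<And>q. q \<in> T \<Longrightarrow> c0 \<le> Q q"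
  proof (cases "T = {}")
    case False
    then obtain q0 where "q0 \<in> T" "\<forall>q\<in>T. Q q0 \<le> Q q" using continuous_attains_inf[OF T False Qc] by auto
    then show ?thesis using Qpos by (intro that[of "Q q0"]) auto
  qed (auto intro: that[of 1])
  define c where "c = c0 / (2 * n)"
  have c: "0 < c" using c0(1) n by (simp add: c_def)
  have large: "\<exists>j. 2 * c \<le> \<bar>G j 1 (x, \<omega>) v\<bar>" if "((x, \<omega>), v) \<in> T" for x \<omega> v
  proof (rule ccontr)
    assume "\<not> ?thesis"
    then have "Q ((x, \<omega>), v) < (\<Sum>j\<in>(UNIV :: 'n set). 2 * c)"
      unfolding Q_def by (intro sum_strict_mono) (auto simp: not_le)
    also have "\<dots> = c0" using n by (simp add: c_def n_def)
    finally show False using c0(2)[OF that] by simp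
  qed
  define X where "X = (K \<times> annulus) \<times> sphere (0 :: real^'n) 1"
  have Xc: "compact X" unfolding X_def by (intro compact_Times K compact_annulus compact_sphere)
  have "X \<subseteq> punctured \<times> UNIV" using annulus_nonzero by (auto simp: X_def)
  then have "uniformly_continuous_on X (\<lambda>(p, v). G j 1 p v)" for j
    using Xc by (intro compact_uniformly_continuous continuous_on_subset[OF continuous_on_G])
  then have "\<exists>d>0. \<forall>q\<in>X. \<forall>q'\<in>X. dist q' q < d \<longrightarrow>
      dist ((\<lambda>(p, v). G j 1 p v) q') ((\<lambda>(p, v). G j 1 p v) q) < c" for j
    using c unfolding uniformly_continuous_on_def by blast
  then obtain d where d: "\<And>j. 0 < d j" "\<And>j q q'. q \<in> X \<Longrightarrow> q' \<in> X \<Longrightarrow> dist q' q < d j \<Longrightarrow>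
      dist ((\<lambda>(p, v). G j 1 p v) q') ((\<lambda>(p, v). G j 1 p v) q) < c"
    by metis
  define \<delta> where "\<delta> = min (1 / 2) (Min (range d))"
  have \<delta>: "0 < \<delta>" "\<delta> \<le> 1 / 2" "\<And>j. \<delta> \<le> d j"
    using d(1) by (auto simp: \<delta>_def min_le_iff_disj)
  show ?thesis
  proof (rule exI[of _ c], rule conjI[OF c], rule exI[of _ \<delta>], intro conjI ballI allI impI \<delta>(1,2))
    fix x \<omega> h :: "real^'n" and i
    assume *: "x \<in> K" "norm \<omega> = 1" "1 \<le> real CARD('n) * \<bar>\<omega> $ i\<bar>" "2 * real CARD('n) * \<bar>h $ i\<bar> \<le> norm h"
    show "\<exists>j. \<forall>\<zeta>. \<zeta> \<in> ball \<omega> \<delta> \<longrightarrow> \<zeta> + h \<in> ball \<omega> \<delta> \<longrightarrow> c * norm h \<le> \<bar>D j 1 (x, \<zeta> + h) - D j 1 (x, \<zeta>)\<bar>"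
    proof (cases "h = 0")
      case False
      define v where "v = (1 / norm h) *\<^sub>R h"
      have v: "norm v = 1" "h = norm h *\<^sub>R v" using False by (auto simp: v_def)
      have "2 * n * \<bar>v $ i\<bar> \<le> 1" using *(4) False by (simp add: v_def n_def abs_mult divide_le_eq)
      then have "((x, \<omega>), v) \<in> T" using * v(1) by (auto simp: T_def n_def)
      then obtain j where j: "2 * c \<le> \<bar>G j 1 (x, \<omega>) v\<bar>" using large by blast
      show ?thesis
      proof (intro exI[of _ j] allI impI)
        fix \<zeta> assume \<zeta>: "\<zeta> \<in> ball \<omega> \<delta>" "\<zeta> + h \<in> ball \<omega> \<delta>"
        obtain \<zeta>' where \<zeta>': "\<zeta>' \<in> ball \<omega> \<delta>" "D j 1 (x, \<zeta> + h) - D j 1 (x, \<zeta>) = G j 1 (x, \<zeta>') h"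
          using D_difference[OF *(2) \<zeta> \<delta>(2)] by blast
        have ann: "\<zeta>' \<in> annulus" "\<omega> \<in> annulus"
          using ball_subset_annulus[OF *(2)] \<zeta>'(1) \<delta>(2) by auto
        have "dist ((\<lambda>(p, v). G j 1 p v) ((x, \<zeta>'), v)) ((\<lambda>(p, v). G j 1 p v) ((x, \<omega>), v)) < c"
        proof (rule d(2))
          show "((x, \<omega>), v) \<in> X" "((x, \<zeta>'), v) \<in> X" using *(1) v(1) ann by (auto simp: X_def)
          show "dist ((x, \<zeta>'), v) ((x, \<omega>), v) < d j"
            using \<zeta>'(1) \<delta>(3)[of j] by (simp add: dist_Pair_Pair dist_commute)
        qed
        then have "c \<le> \<bar>G j 1 (x, \<zeta>') v\<bar>" using j by (simp add: dist_real_def)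
        moreover have "G j 1 (x, \<zeta>') h = norm h * G j 1 (x, \<zeta>') v"
        proof -
          interpret linear "frechet_derivative (D j 1) (at (x, \<zeta>'))"
            using differentiable_D[OF annulus_nonzero[OF ann(1)]] by (rule linear_frechet_derivative)
          show ?thesis using scale[of "norm h" "(0, v)"] v(2) by (simp add: G_def)
        qed
        ultimately show "c * norm h \<le> \<bar>D j 1 (x, \<zeta> + h) - D j 1 (x, \<zeta>)\<bar>"
          unfolding \<zeta>'(2) using mult_right_mono[of c "\<bar>G j 1 (x, \<zeta>') v\<bar>" "norm h"]
          by (simp add: abs_mult mult.commute)
      qed
    qed simp
  qed
qed

end

section \<open>Localization in frequency\<close>

text \<open>A bump of width \<open>\<delta> * norm \<xi>\<close> around \<open>\<xi>\<close>, of class \<open>C\<^sup>N\<close> away from \<open>\<xi> = 0\<close>; the power of \<open>norm \<xi>\<close> makes its mass in \<open>\<eta>\<close>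
  independent of \<open>\<xi>\<close>.\<close>

definition localizer :: "nat \<Rightarrow> real \<Rightarrow> 'a::euclidean_space \<Rightarrow> 'a \<Rightarrow> real" where
  "localizer N \<delta> \<xi> \<eta> = max 0 (1 - (norm (\<xi> - \<eta>))\<^sup>2 / (\<delta> * norm \<xi>)\<^sup>2) ^ Suc N * norm \<xi> powr (- real DIM('a))"

lemma localizer_nonneg: "0 \<le> localizer N \<delta> \<xi> \<eta>"
  by (simp add: localizer_def)

lemma localizer_measurable[measurable]:
  "(\<lambda>p. localizer N \<delta> (fst p) (snd p)) \<in> borel_measurable (borel \<Otimes>\<^sub>M borel)"
  unfolding localizer_def by measurable

lemma localizer_support:
  assumes "localizer N \<delta> \<xi> \<eta> \<noteq> 0" "0 < \<delta>"
  shows "norm (\<xi> - \<eta>) < \<delta> * norm \<xi>"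
proof -
  have "\<xi> \<noteq> 0" using assms(1) by (auto simp: localizer_def)
  then have pos: "0 < \<delta> * norm \<xi>" using assms(2) by simp
  define t where "t = (norm (\<xi> - \<eta>))\<^sup>2 / (\<delta> * norm \<xi>)\<^sup>2"
  have "max 0 (1 - t) \<noteq> 0" using assms(1) by (auto simp: localizer_def t_def[symmetric])
  then have "t < 1" by (simp add: max_def split: if_splits)
  then have "(norm (\<xi> - \<eta>))\<^sup>2 < (\<delta> * norm \<xi>)\<^sup>2"
    using pos unfolding t_def by (subst (asm) divide_less_eq_1_pos) (rule zero_less_power)
  then show ?thesis using pos by (auto intro: power_less_imp_less_base)
qed

lemma localizer_support_unit:
  assumes "localizer N \<delta> \<zeta> \<omega> \<noteq> 0" "0 < \<delta>" "\<delta> \<le> 1 / 2" "norm \<omega> = 1"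
  shows "\<zeta> \<in> cball \<omega> (2 * \<delta>)"
proof -
  have *: "norm (\<zeta> - \<omega>) < \<delta> * norm \<zeta>" using assms(1,2) by (rule localizer_support)
  have "norm \<zeta> \<le> 1 + norm (\<zeta> - \<omega>)" using norm_triangle_ineq[of \<omega> "\<zeta> - \<omega>"] assms(4) by simp
  also have "\<dots> \<le> 1 + 1 / 2 * norm \<zeta>"
    using * mult_right_mono[OF assms(3) norm_ge_zero[of \<zeta>]] by linarith
  finally have "norm \<zeta> \<le> 2" by simp
  then have "\<delta> * norm \<zeta> \<le> \<delta> * 2" using assms(2) by (intro mult_left_mono) auto
  then show ?thesis using * by (simp add: dist_norm norm_minus_commute)
qed

lemma localizer_scale:
  fixes \<zeta> \<omega> :: "'a::euclidean_space"
  assumes "0 < \<mu>"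
  shows "localizer N \<delta> (\<mu> *\<^sub>R \<zeta>) (\<mu> *\<^sub>R \<omega>) = \<mu> powr (- real DIM('a)) * localizer N \<delta> \<zeta> \<omega>"
proof -
  have "(norm (\<mu> *\<^sub>R \<zeta> - \<mu> *\<^sub>R \<omega>))\<^sup>2 / (\<delta> * norm (\<mu> *\<^sub>R \<zeta>))\<^sup>2 = (norm (\<zeta> - \<omega>))\<^sup>2 / (\<delta> * norm \<zeta>)\<^sup>2"
  proof -
    have "norm (\<mu> *\<^sub>R \<zeta> - \<mu> *\<^sub>R \<omega>) = \<mu> * norm (\<zeta> - \<omega>)" "norm (\<mu> *\<^sub>R \<zeta>) = \<mu> * norm \<zeta>"
      using assms norm_scaleR[of \<mu> "\<zeta> - \<omega>"] by (simp_all add: scaleR_diff_right)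
    then show ?thesis using assms by (simp add: power_mult_distrib)
  qed
  then show ?thesis using assms unfolding localizer_def by (simp add: powr_mult del: power_Suc)
qed

text \<open>The radius is proportional to \<open>\<xi>\<close> and not to the centre \<open>\<eta>\<close>, so that the total mass in
  \<open>\<eta>\<close> is seen to be constant by translation and dilation alone.\<close>

lemma localizer_mass:
  assumes "0 < \<delta>"
  shows "\<exists>c>0. \<forall>\<xi>::'a::euclidean_space. \<xi> \<noteq> 0 \<longrightarrow> (\<integral>\<^sup>+\<eta>. ennreal (localizer N \<delta> \<xi> \<eta>) \<partial>lborel) = ennreal c"
proof -
  define u where "u z = max 0 (1 - (norm z)\<^sup>2 / \<delta>\<^sup>2) ^ Suc N" for z :: 'a
  have um[measurable]: "u \<in> borel_measurable borel" unfolding u_def by measurable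
  have u0: "0 \<le> u z" for z by (simp add: u_def)
  have u1: "u z \<le> 1" for z unfolding u_def by (rule power_le_one) simp_all
  have us: "u z = 0" if "z \<notin> cball 0 \<delta>" for z
  proof -
    have "\<delta>\<^sup>2 \<le> (norm z)\<^sup>2" using that assms by (intro power_mono) (simp_all add: dist_norm)
    then have "1 \<le> (norm z)\<^sup>2 / \<delta>\<^sup>2" using assms by simp
    then show ?thesis by (simp add: u_def)
  qed
  define I where "I = (\<integral>\<^sup>+z. ennreal (u z) \<partial>lborel)"
  have "I \<le> (\<integral>\<^sup>+z. indicator (cball (0::'a) \<delta>) z \<partial>lborel)"
    unfolding I_def
  proof (rule nn_integral_mono)
    show "ennreal (u z) \<le> indicator (cball 0 \<delta>) z" for z
      using us[of z] u1[of z] by (cases "z \<in> cball 0 \<delta>") (simp_all add: ennreal_le_1)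
  qed
  also have "(\<integral>\<^sup>+z. indicator (cball (0::'a) \<delta>) z \<partial>lborel) < (\<infinity>::ennreal)" using emeasure_lborel_cball_finite[of "0::'a" \<delta>] by simp
  finally have Ifin: "I < \<infinity>" .
  have half: "(3/4) ^ Suc N \<le> u z" if "z \<in> ball 0 (\<delta> / 2)" for z
  proof -
    have "(norm z)\<^sup>2 \<le> (\<delta> / 2)\<^sup>2" using that assms by (intro power_mono) (simp_all add: dist_norm)
    then have "(norm z)\<^sup>2 / \<delta>\<^sup>2 \<le> 1 / 4" using assms by (simp add: divide_le_eq power_divide)
    then have "3 / 4 \<le> max 0 (1 - (norm z)\<^sup>2 / \<delta>\<^sup>2)" by (intro max.coboundedI2) linarith
    from power_mono[OF this, of "Suc N"] show ?thesis unfolding u_def by simp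
  qed
  have "0 < ennreal ((3/4) ^ Suc N) * emeasure lborel (ball (0::'a) (\<delta> / 2))"
    using assms by (simp add: emeasure_ball ennreal_zero_less_mult_iff del: power_Suc)
  also have "\<dots> = (\<integral>\<^sup>+z. ennreal ((3/4) ^ Suc N) * indicator (ball (0::'a) (\<delta> / 2)) z \<partial>lborel)"
    by (subst nn_integral_cmult_indicator) auto
  also have "\<dots> \<le> I"
    unfolding I_def using half u0
    by (intro nn_integral_mono) (auto simp: indicator_def simp del: power_Suc intro!: ennreal_leI)
  finally have Ipos: "0 < I" .
  have "(\<integral>\<^sup>+\<eta>. ennreal (localizer N \<delta> \<xi> \<eta>) \<partial>lborel) = I" if "\<xi> \<noteq> 0" for \<xi> :: 'a
  proof -
    have p: "0 < norm \<xi>" using that by simp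
    have eq: "localizer N \<delta> \<xi> (\<xi> + norm \<xi> *\<^sub>R z) = norm \<xi> powr (- real DIM('a)) * u z" for z
      using p by (simp add: localizer_def u_def power_mult_distrib)
    have "(\<integral>\<^sup>+\<eta>. ennreal (localizer N \<delta> \<xi> \<eta>) \<partial>lborel) =
        ennreal (\<bar>norm \<xi>\<bar> ^ DIM('a)) * (\<integral>\<^sup>+z. ennreal (localizer N \<delta> \<xi> (\<xi> + norm \<xi> *\<^sub>R z)) \<partial>lborel)"
      using p by (intro nn_integral_lborel_affine) (auto simp: localizer_def)
    also have "\<dots> = ennreal (norm \<xi> ^ DIM('a)) * (ennreal (norm \<xi> powr (- real DIM('a))) * I)"
      unfolding eq I_def by (simp add: ennreal_mult' nn_integral_cmult)
    also have "\<dots> = ennreal (norm \<xi> ^ DIM('a) * norm \<xi> powr (- real DIM('a))) * I"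
      by (simp add: ennreal_mult' mult.assoc)
    also have "norm \<xi> ^ DIM('a) * norm \<xi> powr (- real DIM('a)) = 1"
      using p by (simp add: powr_minus powr_realpow)
    finally show ?thesis by simp
  qed
  moreover have "I = ennreal (enn2real I)" "0 < enn2real I"
    using Ifin Ipos by (simp_all add: enn2real_positive_iff)
  ultimately show ?thesis by (intro exI[of _ "enn2real I"]) simp
qed

lemma bounded_derivs_squared_distance:
  fixes a e :: "'a::euclidean_space"
  assumes "\<And>\<zeta>. \<zeta> \<in> S \<Longrightarrow> norm (\<zeta> - a) \<le> 3" "norm e \<le> 1"
  shows "bounded_derivs e S k 9 (\<lambda>\<zeta>. (norm (\<zeta> - a))\<^sup>2)"
proof -
  define F where "F i \<zeta> = (if i = 0 then (\<zeta> - a) \<bullet> (\<zeta> - a) else if i = 1 then 2 * ((\<zeta> - a) \<bullet> e)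
      else if i = 2 then 2 * (e \<bullet> e) else 0)" for i :: nat and \<zeta>
  have "bounded_derivs e S k 9 (F 0)"
  proof (rule bounded_derivs_of_sequence)
    show "continuous_on S (F i)" for i
    proof -
      consider "i = 0" | "i = 1" | "i = 2" | "i > 2" by linarith
      then show ?thesis unfolding F_def by cases (simp_all add: continuous_intros)
    qed
    show "norm (F i x) \<le> 9" if "x \<in> S" for i x
    proof -
      have n: "norm (x - a) \<le> 3" using assms(1) that .
      have "(x - a) \<bullet> (x - a) \<le> 9" using n power_mono[of "norm (x - a)" 3 2] by (simp add: power2_norm_eq_inner)
      moreover have "\<bar>(x - a) \<bullet> e\<bar> \<le> 3 * 1"
        using n assms(2) by (intro order_trans[OF Cauchy_Schwarz_ineq2] mult_mono) auto
      moreover have "\<bar>e \<bullet> e\<bar> \<le> 1 * 1"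
        using assms(2) by (intro order_trans[OF Cauchy_Schwarz_ineq2] mult_mono) auto
      ultimately show ?thesis by (auto simp: F_def)
    qed
    show "((\<lambda>t. F i (x + t *\<^sub>R e)) has_vector_derivative F (Suc i) x) (at 0)" for i x
    proof -
      have "((\<lambda>t. (x + t *\<^sub>R e - a) \<bullet> (x + t *\<^sub>R e - a)) has_derivative
          (\<lambda>t. (x + 0 *\<^sub>R e - a) \<bullet> (t *\<^sub>R e) + (t *\<^sub>R e) \<bullet> (x + 0 *\<^sub>R e - a))) (at 0)"
        by (intro has_derivative_inner) (auto intro!: derivative_eq_intros)
      then have 0: "((\<lambda>t. (x + t *\<^sub>R e - a) \<bullet> (x + t *\<^sub>R e - a)) has_vector_derivative 2 * ((x - a) \<bullet> e)) (at 0)"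
        unfolding has_vector_derivative_def
        by (rule has_derivative_eq_rhs) (auto simp: fun_eq_iff inner_commute)
      have "((\<lambda>t. 2 * ((x + t *\<^sub>R e - a) \<bullet> e)) has_derivative (\<lambda>t. 2 * ((t *\<^sub>R e) \<bullet> e))) (at 0)"
        by (intro has_derivative_mult_right has_derivative_inner_left) (auto intro!: derivative_eq_intros)
      then have 1: "((\<lambda>t. 2 * ((x + t *\<^sub>R e - a) \<bullet> e)) has_vector_derivative 2 * (e \<bullet> e)) (at 0)"
        unfolding has_vector_derivative_def
        by (rule has_derivative_eq_rhs) (auto simp: fun_eq_iff)
      consider "i = 0" | "i = 1" | "i \<ge> 2" by linarith
      then show ?thesis using 0 1 by cases (auto simp: F_def)
    qed
  qed
  then show ?thesis by (simp add: F_def[abs_def] power2_norm_eq_inner)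
qed

lemma ball_unit_norm:
  assumes "norm \<omega> = 1" "\<zeta> \<in> ball \<omega> (1 / 2)"
  shows "1 / 2 \<le> norm \<zeta>" "norm \<zeta> \<le> 3 / 2"
proof -
  have "norm (\<omega> - \<zeta>) < 1 / 2" using assms(2) by (simp add: dist_norm)
  then show "1 / 2 \<le> norm \<zeta>" "norm \<zeta> \<le> 3 / 2"
    using assms(1) norm_triangle_ineq2[of \<omega> \<zeta>] norm_triangle_ineq2[of \<zeta> \<omega>]
    by (simp_all add: norm_minus_commute)
qed

lemma localizer_bounded_derivs:
  assumes "0 < \<delta>"
  shows "\<exists>C\<ge>0. \<forall>(\<omega>::'a::euclidean_space) e. norm \<omega> = 1 \<longrightarrow> norm e \<le> 1 \<longrightarrow>
    bounded_derivs e (ball \<omega> (1 / 2)) N C (\<lambda>\<zeta>. localizer N \<delta> \<zeta> \<omega>)"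
proof -
  obtain C1 where C1: "0 \<le> C1" "\<And>e S (f :: 'a \<Rightarrow> real). bounded_derivs e S N 9 f \<Longrightarrow>
    \<forall>x\<in>S. 1 / 4 \<le> f x \<Longrightarrow> bounded_derivs e S N C1 (\<lambda>x. f x powr (- 1))"
    using bounded_derivs_powr[of "1/4" 9 N "-1"] by auto
  obtain C2 where C2: "0 \<le> C2" "\<And>e S (f :: 'a \<Rightarrow> real). bounded_derivs e S N 9 f \<Longrightarrow>
    \<forall>x\<in>S. 1 / 4 \<le> f x \<Longrightarrow> bounded_derivs e S N C2 (\<lambda>x. f x powr (- (real DIM('a) / 2)))"
    using bounded_derivs_powr[of "1/4" 9 N "- (real DIM('a) / 2)"] by auto
  define M where "M = 1 + 1 / \<delta>\<^sup>2 * (2 ^ N * (9 * C1))"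
  have M: "0 \<le> M" using C1 by (simp add: M_def)
  obtain C3 where C3: "0 \<le> C3" "\<And>e S (f :: 'a \<Rightarrow> real). bounded_derivs e S N M f \<Longrightarrow>
    bounded_derivs e S N C3 (\<lambda>x. max 0 (f x) ^ Suc N)"
    using bounded_derivs_max0_power[OF M, of N 0] by auto
  show ?thesis
  proof (intro exI[of _ "2 ^ N * (C3 * C2)"] conjI allI impI)
    show "0 \<le> 2 ^ N * (C3 * C2)" using C2 C3 by simp
    fix \<omega> e :: 'a assume \<omega>: "norm \<omega> = 1" and e: "norm e \<le> 1"
    let ?S = "ball \<omega> (1 / 2)"
    have r: "bounded_derivs e ?S N 9 (\<lambda>\<zeta>. (norm \<zeta>)\<^sup>2)"
      using bounded_derivs_squared_distance[of ?S 0 e N] ball_unit_norm(2)[OF \<omega>] e by force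
    have q: "bounded_derivs e ?S N 9 (\<lambda>\<zeta>. (norm (\<zeta> - \<omega>))\<^sup>2)"
      by (rule bounded_derivs_squared_distance[OF _ e]) (simp add: dist_norm norm_minus_commute)
    have low: "\<forall>\<zeta>\<in>?S. 1 / 4 \<le> (norm \<zeta>)\<^sup>2"
    proof
      fix \<zeta> assume "\<zeta> \<in> ?S"
      then have "(1 / 2)\<^sup>2 \<le> (norm \<zeta>)\<^sup>2" using ball_unit_norm(1)[OF \<omega>] by (intro power_mono) auto
      then show "1 / 4 \<le> (norm \<zeta>)\<^sup>2" by (simp add: power_divide)
    qed
    have "bounded_derivs e ?S N (2 ^ N * (9 * C1)) (\<lambda>\<zeta>. (norm (\<zeta> - \<omega>))\<^sup>2 * (norm \<zeta>)\<^sup>2 powr (- 1))"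
      by (rule bounded_derivs_mult[OF q C1(2)[OF r low] _ C1(1)]) simp
    then have "bounded_derivs e ?S N (1 / \<delta>\<^sup>2 * (2 ^ N * (9 * C1)))
        (\<lambda>\<zeta>. - (1 / \<delta>\<^sup>2) * ((norm (\<zeta> - \<omega>))\<^sup>2 * (norm \<zeta>)\<^sup>2 powr (- 1)))"
    proof (rule bounded_derivs_bounded_linear)
      show "bounded_linear (\<lambda>y. - (1 / \<delta>\<^sup>2) * y)" by (rule bounded_linear_mult_right)
      show "norm (- (1 / \<delta>\<^sup>2) * y) \<le> 1 / \<delta>\<^sup>2 * norm y" for y :: real by (simp add: abs_mult)
    qed simp
    then have "bounded_derivs e ?S N M
        (\<lambda>\<zeta>. 1 + - (1 / \<delta>\<^sup>2) * ((norm (\<zeta> - \<omega>))\<^sup>2 * (norm \<zeta>)\<^sup>2 powr (- 1)))"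
      unfolding M_def by (rule bounded_derivs_add[rotated], intro bounded_derivs_const) simp
    from bounded_derivs_mult[OF C3(2)[OF this] C2(2)[OF r low] C3(1) C2(1)]
    show "bounded_derivs e ?S N (2 ^ N * (C3 * C2)) (\<lambda>\<zeta>. localizer N \<delta> \<zeta> \<omega>)"
    proof (rule bounded_derivs_cong[OF open_ball])
      fix \<zeta> assume "\<zeta> \<in> ?S"
      then have p: "0 < norm \<zeta>" using ball_unit_norm(1)[OF \<omega>] by fastforce
      have "(norm \<zeta>)\<^sup>2 powr (- (real DIM('a) / 2)) = norm \<zeta> powr (- real DIM('a))"
      proof -
        have sq: "(norm \<zeta>)\<^sup>2 = norm \<zeta> powr 2" using p by simp
        show ?thesis unfolding sq powr_powr by simp
      qed
      moreover have "1 + - (1 / \<delta>\<^sup>2) * ((norm (\<zeta> - \<omega>))\<^sup>2 * (norm \<zeta>)\<^sup>2 powr (- 1)) =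
          1 - (norm (\<zeta> - \<omega>))\<^sup>2 / (\<delta> * norm \<zeta>)\<^sup>2"
        using p unfolding power_mult_distrib by (simp add: powr_minus divide_inverse)
      ultimately show "max 0 (1 + - (1 / \<delta>\<^sup>2) * ((norm (\<zeta> - \<omega>))\<^sup>2 * (norm \<zeta>)\<^sup>2 powr (- 1))) ^ Suc N *
          (norm \<zeta>)\<^sup>2 powr (- (real DIM('a) / 2)) = localizer N \<delta> \<zeta> \<omega>"
        unfolding localizer_def by (simp only:)
    qed
  qed
qed

section \<open>Symbols at a fixed point\<close>

text \<open>The symbol estimates at one point \<open>x\<close>, for the pure derivatives up to order \<open>N\<close>.\<close>

definition symbol_bound :: "nat \<Rightarrow> real \<Rightarrow> real \<Rightarrow> real \<Rightarrow> (real^'n::finite \<Rightarrow> complex) \<Rightarrow> bool" where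
  "symbol_bound N m \<rho> A \<alpha> \<longleftrightarrow> smooth_on UNIV \<alpha> \<and>
     (\<forall>j k \<xi>. k \<le> N \<longrightarrow> cmod ((partial j ^^ k) \<alpha> \<xi>) \<le> A * japanese \<xi> powr (m - \<rho> * real k))"

text \<open>Each derivative of the symbol, dilated by \<open>\<mu>\<close>, costs at most this factor.\<close>

definition symbol_scale :: "real \<Rightarrow> real \<Rightarrow> real" where
  "symbol_scale \<rho> \<mu> = (if \<mu> \<le> 1 then 1 else \<mu> powr (1 - \<rho>))"

text \<open>The size of the dilated symbol, up to constants; at low frequencies \<open>\<mu> \<le> 1\<close> it stays bounded.\<close>

definition symbol_size :: "real \<Rightarrow> real \<Rightarrow> real" where
  "symbol_size m \<mu> = (if \<mu> \<le> 1 then 1 else \<mu> powr m)"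

lemma symbol_scale_ge_1: "\<rho> \<le> 1 \<Longrightarrow> 1 \<le> symbol_scale \<rho> \<mu>"
  by (simp add: symbol_scale_def ge_one_powr_ge_zero)

lemma symbol_size_pos: "0 < \<mu> \<Longrightarrow> 0 < symbol_size m \<mu>"
  by (simp add: symbol_size_def)

lemma smooth_on_partial: "smooth_on UNIV f \<Longrightarrow> smooth_on UNIV ((partial j ^^ k) f)"
proof (induction k)
  case (Suc k)
  have "axis j (1::real) \<in> Basis" by (simp add: axis_in_Basis_iff)
  from smooth_on_derivative[OF Suc.IH[OF Suc.prems] this]
  show ?case by (simp add: partial_def[abs_def])
qed simp

lemma powr_le_3_powr_abs:
  assumes "1 / 3 \<le> t" "t \<le> (3::real)"
  shows "t powr s \<le> 3 powr \<bar>s\<bar>"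
proof (cases "0 \<le> s")
  case True
  then show ?thesis using assms by (auto intro: powr_mono2)
next
  case False
  then have "t powr s \<le> (1 / 3) powr s" using assms by (intro powr_mono2') auto
  also have "\<dots> = 3 powr \<bar>s\<bar>" using False by (simp add: powr_divide powr_minus_divide[symmetric])
  finally show ?thesis .
qed

lemma japanese_bounds:
  assumes "0 < \<mu>" "norm \<omega> = 1" "\<zeta> \<in> ball \<omega> (1 / 2)"
  shows "max 1 \<mu> / 3 \<le> japanese (\<mu> *\<^sub>R \<zeta>)" "japanese (\<mu> *\<^sub>R \<zeta>) \<le> 3 * max 1 \<mu>"
proof -
  note n = ball_unit_norm[OF assms(2,3)]
  have "1 \<le> japanese (\<mu> *\<^sub>R \<zeta>)" by (simp add: japanese_def)
  moreover have "\<mu> * norm \<zeta> \<le> japanese (\<mu> *\<^sub>R \<zeta>)"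
    unfolding japanese_def using assms(1) by (intro real_le_rsqrt) (simp add: power_mult_distrib)
  moreover have "\<mu> * (1 / 2) \<le> \<mu> * norm \<zeta>" using n assms(1) by (intro mult_left_mono) auto
  ultimately have "1 \<le> japanese (\<mu> *\<^sub>R \<zeta>)" "\<mu> / 2 \<le> japanese (\<mu> *\<^sub>R \<zeta>)" by linarith+
  then show "max 1 \<mu> / 3 \<le> japanese (\<mu> *\<^sub>R \<zeta>)" using assms(1) by (simp add: max_def)
  have "japanese (\<mu> *\<^sub>R \<zeta>) \<le> 1 + \<mu> * norm \<zeta>"
    unfolding japanese_def using assms(1) by (intro real_le_lsqrt) (auto simp: power2_eq_square algebra_simps)
  moreover have "\<mu> * norm \<zeta> \<le> \<mu> * (3 / 2)" using n assms(1) by (intro mult_left_mono) auto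
  ultimately show "japanese (\<mu> *\<^sub>R \<zeta>) \<le> 3 * max 1 \<mu>" by (simp add: max_def)
qed

text \<open>After rescaling to the unit sphere, a derivative of a symbol of type \<open>\<rho>\<close> costs \<open>\<mu> powr (1 - \<rho>)\<close>;
  this factor is absorbed in the length of the direction of differentiation.\<close>

lemma rescaled_symbol_bounded_derivs:
  fixes \<alpha> :: "real^'n::finite \<Rightarrow> complex"
  assumes \<rho>: "0 \<le> \<rho>" "\<rho> \<le> 1" and A: "0 \<le> A" "symbol_bound N m \<rho> A \<alpha>" and \<mu>: "0 < \<mu>" and \<omega>: "norm \<omega> = 1"
  shows "bounded_derivs ((1 / symbol_scale \<rho> \<mu>) *\<^sub>R axis j 1) (ball \<omega> (1 / 2)) N
     (3 powr (\<bar>m\<bar> + real N) * A * symbol_size m \<mu>) (\<lambda>\<zeta>. \<alpha> (\<mu> *\<^sub>R \<zeta>))"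
proof -
  define \<nu> where "\<nu> = symbol_scale \<rho> \<mu>"
  have \<nu>: "1 \<le> \<nu>" using \<rho> by (simp add: \<nu>_def symbol_scale_ge_1)
  define F where "F k \<zeta> = (\<mu> / \<nu>) ^ k *\<^sub>R (partial j ^^ k) \<alpha> (\<mu> *\<^sub>R \<zeta>)" for k \<zeta>
  have sm: "smooth_on UNIV ((partial j ^^ k) \<alpha>)" for k
    using A(2) by (intro smooth_on_partial) (simp add: symbol_bound_def)
  have "bounded_derivs ((1 / \<nu>) *\<^sub>R axis j 1) (ball \<omega> (1 / 2)) N (3 powr (\<bar>m\<bar> + real N) * A * symbol_size m \<mu>) (F 0)"
  proof (rule bounded_derivs_of_sequence)
    show "continuous_on (ball \<omega> (1 / 2)) (F k)" for k
      unfolding F_def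
      by (intro continuous_intros continuous_on_compose2[OF smooth_on_continuous[OF sm]]) auto
    show "((\<lambda>t. F k (\<zeta> + t *\<^sub>R (1 / \<nu>) *\<^sub>R axis j 1)) has_vector_derivative F (Suc k) \<zeta>) (at 0)" for k \<zeta>
    proof -
      let ?g = "(partial j ^^ k) \<alpha>" and ?v = "(\<mu> / \<nu>) *\<^sub>R axis j 1 :: real^'n"
      have d: "?g differentiable (at (\<mu> *\<^sub>R \<zeta> + 0 *\<^sub>R ?v))" by (rule smooth_on_differentiable[OF sm]) simp
      have "frechet_derivative ?g (at (\<mu> *\<^sub>R \<zeta>)) ?v = (\<mu> / \<nu>) *\<^sub>R partial j ?g (\<mu> *\<^sub>R \<zeta>)"
        using linear_frechet_derivative[of ?g "at (\<mu> *\<^sub>R \<zeta>)"] d by (simp only: partial_def linear_scale scaleR_zero_left add_0_right)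
      then have "((\<lambda>t. ?g (\<mu> *\<^sub>R \<zeta> + t *\<^sub>R ?v)) has_vector_derivative (\<mu> / \<nu>) *\<^sub>R partial j ?g (\<mu> *\<^sub>R \<zeta>)) (at 0)"
        using has_vector_derivative_along_line[OF d] by simp
      then have "((\<lambda>t. (\<mu> / \<nu>) ^ k *\<^sub>R ?g (\<mu> *\<^sub>R \<zeta> + t *\<^sub>R ?v)) has_vector_derivative
          (\<mu> / \<nu>) ^ k *\<^sub>R ((\<mu> / \<nu>) *\<^sub>R partial j ?g (\<mu> *\<^sub>R \<zeta>))) (at 0)"
        by (rule bounded_linear.has_vector_derivative[OF bounded_linear_scaleR_right])
      then show ?thesis by (simp add: F_def scaleR_add_right mult.commute)
    qed
    show "norm (F k \<zeta>) \<le> 3 powr (\<bar>m\<bar> + real N) * A * symbol_size m \<mu>" if "k \<le> N" "\<zeta> \<in> ball \<omega> (1 / 2)" for k \<zeta>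
    proof -
      define t where "t = japanese (\<mu> *\<^sub>R \<zeta>) / max 1 \<mu>"
      define s where "s = m - \<rho> * real k"
      have t: "1 / 3 \<le> t" "t \<le> 3" "japanese (\<mu> *\<^sub>R \<zeta>) = t * max 1 \<mu>"
        using japanese_bounds[OF \<mu> \<omega> that(2)] \<mu> by (auto simp: t_def field_simps)
      have "\<rho> * real k \<le> 1 * real N" using that(1) \<rho> by (intro mult_mono) auto
      moreover have "0 \<le> \<rho> * real k" using \<rho> by simp
      ultimately have "\<bar>s\<bar> \<le> \<bar>m\<bar> + real N" using abs_triangle_ineq4[of m "\<rho> * real k"] by (simp add: s_def)
      then have ts: "t powr s \<le> 3 powr (\<bar>m\<bar> + real N)"
        using powr_le_3_powr_abs[OF t(1,2), of s] powr_mono[of "\<bar>s\<bar>" "\<bar>m\<bar> + real N" 3] by linarith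
      have size: "(\<mu> / \<nu>) ^ k * max 1 \<mu> powr s \<le> symbol_size m \<mu>"
      proof (cases "\<mu> \<le> 1")
        case True
        then show ?thesis using \<mu> by (simp add: \<nu>_def symbol_scale_def symbol_size_def power_le_one)
      next
        case False
        then have "\<mu> / \<nu> = \<mu> powr \<rho>"
          using \<mu> by (simp add: \<nu>_def symbol_scale_def powr_diff)
        then have "(\<mu> / \<nu>) ^ k * \<mu> powr s = \<mu> powr (\<rho> * real k + s)"
          using \<mu> by (simp add: powr_add powr_powr powr_realpow[symmetric])
        also have "\<dots> = \<mu> powr m" by (simp add: s_def)
        finally show ?thesis using False by (simp add: symbol_size_def max_def)
      qed
      have "norm (F k \<zeta>) = (\<mu> / \<nu>) ^ k * cmod ((partial j ^^ k) \<alpha> (\<mu> *\<^sub>R \<zeta>))"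
        using \<mu> \<nu> by (simp add: F_def)
      also have "\<dots> \<le> (\<mu> / \<nu>) ^ k * (A * japanese (\<mu> *\<^sub>R \<zeta>) powr s)"
        using A(2) that(1) \<mu> \<nu> by (intro mult_left_mono) (auto simp: symbol_bound_def s_def)
      also have "\<dots> = A * (t powr s * ((\<mu> / \<nu>) ^ k * max 1 \<mu> powr s))"
        using t \<mu> by (simp add: powr_mult mult_ac)
      also have "\<dots> \<le> A * (3 powr (\<bar>m\<bar> + real N) * symbol_size m \<mu>)"
        using A(1) \<mu> \<nu> by (intro mult_left_mono mult_mono ts size) auto
      finally show ?thesis by (simp add: mult_ac)
    qed
  qed
  then show ?thesis by (simp add: F_def[abs_def] \<nu>_def)
qed

section \<open>Estimates of the localized kernels\<close>

lemma bounded_derivs_translate: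
  "bounded_derivs e S k M f \<Longrightarrow> bounded_derivs e {x. x + h \<in> S} k M (\<lambda>x. f (x + h))"
proof (induction k arbitrary: f)
  case 0
  then show ?case by (auto intro!: continuous_on_compose2[of S f] continuous_intros)
next
  case (Suc k)
  obtain f' where f': "continuous_on S f" "\<And>x. x \<in> S \<Longrightarrow> norm (f x) \<le> M"
    "\<And>x. x \<in> S \<Longrightarrow> ((\<lambda>t. f (x + t *\<^sub>R e)) has_vector_derivative f' x) (at 0)" "bounded_derivs e S k M f'"
    using Suc.prems by (rule bounded_derivs_SucE) (rule that)
  show ?case
  proof (rule bounded_derivs_SucI[OF _ _ _ Suc.IH[OF f'(4)]])
    show "continuous_on {x. x + h \<in> S} (\<lambda>x. f (x + h))"
      by (rule continuous_on_compose2[OF f'(1)]) (auto intro!: continuous_intros)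
    show "((\<lambda>t. f (x + t *\<^sub>R e + h)) has_vector_derivative f' (x + h)) (at 0)" if "x \<in> {x. x + h \<in> S}" for x
      using f'(3)[of "x + h"] that by (simp add: ac_simps)
  qed (use f'(2) in auto)
qed

lemma norm_le_card_mult_component: "\<exists>i. norm y \<le> real CARD('n) * \<bar>y $ i\<bar>" for y :: "real^'n::finite"
proof (rule ccontr)
  assume "\<not> ?thesis"
  then have "(\<Sum>i\<in>(UNIV :: 'n set). \<bar>y $ i\<bar>) < (\<Sum>i\<in>(UNIV :: 'n set). norm y / real CARD('n))"
    by (intro sum_strict_mono) (auto simp: field_simps not_le)
  also have "\<dots> = norm y" by simp
  finally show False using norm_le_l1_cart[of y] by simp
qed

context homogeneous_phase
begin

text \<open>The amplitude has \<open>n + 1\<close> derivatives: the correlations have to be integrable over \<open>n\<close>-space, which takes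
  one integration by parts more than the dimension.\<close>

definition amplitude :: "real \<Rightarrow> (real^'n \<Rightarrow> complex) \<Rightarrow> real \<Rightarrow> real^'n \<Rightarrow> real^'n \<Rightarrow> complex" where
  "amplitude \<delta> \<alpha> \<mu> \<omega> \<zeta> = \<alpha> (\<mu> *\<^sub>R \<zeta>) * of_real (localizer (Suc CARD('n)) \<delta> \<zeta> \<omega>)"

text \<open>The part of the kernel of the operator that comes from frequencies near \<open>\<mu> *\<^sub>R \<omega>\<close>, after dilation to the unit sphere.\<close>

definition kernel :: "real \<Rightarrow> (real^'n \<Rightarrow> complex) \<Rightarrow> real^'n \<Rightarrow> real \<Rightarrow> real^'n \<Rightarrow> real^'n \<Rightarrow> complex" where
  "kernel \<delta> \<alpha> x \<mu> \<omega> y = (\<integral>\<zeta>. cis (\<mu> * (\<phi> x \<zeta> - y \<bullet> \<zeta>)) * amplitude \<delta> \<alpha> \<mu> \<omega> \<zeta> \<partial>lborel)"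

lemma amplitude_bounded_derivs:
  assumes "0 \<le> \<rho>" "\<rho> \<le> 1" "0 < \<delta>"
  shows "\<exists>C\<ge>0. \<forall>A \<alpha> \<mu> \<omega> j. 0 \<le> A \<longrightarrow> symbol_bound (Suc CARD('n)) m \<rho> A \<alpha> \<longrightarrow> 0 < \<mu> \<longrightarrow> norm \<omega> = 1 \<longrightarrow>
    bounded_derivs ((1 / symbol_scale \<rho> \<mu>) *\<^sub>R axis j 1) (ball \<omega> (1 / 2)) (Suc CARD('n)) (C * A * symbol_size m \<mu>)
      (amplitude \<delta> \<alpha> \<mu> \<omega>)"
proof -
  obtain C where C: "0 \<le> C" "\<And>(\<omega>::real^'n) e. norm \<omega> = 1 \<Longrightarrow> norm e \<le> 1 \<Longrightarrow>
    bounded_derivs e (ball \<omega> (1 / 2)) (Suc CARD('n)) C (\<lambda>\<zeta>. localizer (Suc CARD('n)) \<delta> \<zeta> \<omega>)"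
    using localizer_bounded_derivs[OF assms(3), of "Suc CARD('n)" ] by blast
  define C' where "C' = 2 ^ (Suc CARD('n)) * (3 powr (\<bar>m\<bar> + real (Suc CARD('n))) * C)"
  show ?thesis
  proof (intro exI[of _ C'] conjI allI impI)
    show "0 \<le> C'" using C(1) by (simp add: C'_def)
    fix A \<mu> :: real and \<alpha> :: "real^'n \<Rightarrow> complex" and \<omega> :: "real^'n" and j assume *: "0 \<le> A" "symbol_bound (Suc CARD('n)) m \<rho> A \<alpha>" "0 < \<mu>" "norm (\<omega>::real^'n) = 1"
    let ?e = "(1 / symbol_scale \<rho> \<mu>) *\<^sub>R axis j 1 :: real^'n"
    have "norm ?e \<le> 1" using symbol_scale_ge_1[OF assms(2), of \<mu>] by simp
    have "bounded_derivs ?e (ball \<omega> (1 / 2)) (Suc CARD('n)) (1 * C) (\<lambda>\<zeta>. complex_of_real (localizer (Suc CARD('n)) \<delta> \<zeta> \<omega>))"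
      by (rule bounded_derivs_bounded_linear[OF C(2)[OF *(4) \<open>norm ?e \<le> 1\<close>] bounded_linear_of_real]) simp_all
    then have "bounded_derivs ?e (ball \<omega> (1 / 2)) (Suc CARD('n)) C (\<lambda>\<zeta>. complex_of_real (localizer (Suc CARD('n)) \<delta> \<zeta> \<omega>))"
      by (simp only: mult_1)
    from bounded_derivs_mult[OF rescaled_symbol_bounded_derivs[OF assms(1,2) *] this] C(1) *
    have "bounded_derivs ?e (ball \<omega> (1 / 2)) (Suc CARD('n)) (2 ^ (Suc CARD('n)) * (3 powr (\<bar>m\<bar> + real (Suc CARD('n))) * A * symbol_size m \<mu> * C))
        (\<lambda>\<zeta>. \<alpha> (\<mu> *\<^sub>R \<zeta>) * of_real (localizer (Suc CARD('n)) \<delta> \<zeta> \<omega>))"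
      using symbol_size_pos[OF *(3), of m] by (simp del: bounded_derivs.simps power_Suc)
    moreover have "2 ^ (Suc CARD('n)) * (3 powr (\<bar>m\<bar> + real (Suc CARD('n))) * A * symbol_size m \<mu> * C) = C' * A * symbol_size m \<mu>"
      by (simp add: C'_def)
    ultimately show "bounded_derivs ?e (ball \<omega> (1 / 2)) (Suc CARD('n)) (C' * A * symbol_size m \<mu>) (amplitude \<delta> \<alpha> \<mu> \<omega>)"
      by (simp only: amplitude_def[abs_def])
  qed
qed

lemma amplitude_eq_0:
  assumes "\<zeta> \<notin> cball \<omega> (2 * \<delta>)" "0 < \<delta>" "\<delta> \<le> 1 / 2" "norm \<omega> = 1"
  shows "amplitude \<delta> \<alpha> \<mu> \<omega> \<zeta> = 0"
  using localizer_support_unit[of "Suc CARD('n)"  \<delta> \<zeta> \<omega>] assms by (auto simp: amplitude_def)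

lemma continuous_on_D_slice: "0 \<notin> S \<Longrightarrow> continuous_on S (\<lambda>\<zeta>. D j k (x, \<zeta>))"
  by (rule continuous_on_compose2[OF continuous_on_D]) (auto intro!: continuous_intros)

lemma continuous_on_phase: "0 \<notin> S \<Longrightarrow> continuous_on S (\<phi> x)"
  using continuous_on_D_slice[of S undefined 0 x] by (simp add: D_0)

lemma measure_cball_le: "0 \<le> r \<Longrightarrow> r \<le> 1 \<Longrightarrow> measure lborel (cball (\<omega> :: real^'n) r) \<le> unit_ball_vol (real CARD('n))"
  by (simp add: content_cball power_le_one mult_left_le)

lemma D_line_axis:
  assumes "\<zeta> \<noteq> 0"
  shows "((\<lambda>t. D j k (x, \<zeta> + t *\<^sub>R (c *\<^sub>R axis j 1))) has_real_derivative c * D j (Suc k) (x, \<zeta>)) (at 0)"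
proof -
  interpret linear "frechet_derivative (D j k) (at (x, \<zeta>))"
    using differentiable_D[OF assms] by (rule linear_frechet_derivative)
  have "G j k (x, \<zeta>) (c *\<^sub>R axis j 1) = c * D j (Suc k) (x, \<zeta>)"
    using scale[of c "(0, axis j 1)"] by (simp add: G_def D_Suc)
  then show ?thesis using D_line[of \<zeta> 0 "c *\<^sub>R axis j 1" j k x] assms by simp
qed

text \<open>For large \<open>y\<close> the phase \<open>\<phi> x \<zeta> - y \<bullet> \<zeta>\<close> has no stationary point: the largest coordinate of \<open>y\<close>
  dominates the corresponding derivative of \<open>\<phi>\<close>.\<close>

lemma kernel_bound_large_y:
  assumes K: "compact K" and \<rho>: "0 \<le> \<rho>" "\<rho> \<le> 1" and \<delta>: "0 < \<delta>" "\<delta> < 1 / 4"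
  shows "\<exists>C\<ge>0. \<exists>R\<ge>1. \<forall>A \<alpha> x \<mu> \<omega> y. 0 \<le> A \<longrightarrow> symbol_bound (Suc CARD('n)) m \<rho> A \<alpha> \<longrightarrow> x \<in> K \<longrightarrow> 0 < \<mu> \<longrightarrow> norm \<omega> = 1 \<longrightarrow>
    cmod (kernel \<delta> \<alpha> x \<mu> \<omega> y) \<le> C * A * symbol_size m \<mu> \<and>
    (R \<le> norm y \<longrightarrow> cmod (kernel \<delta> \<alpha> x \<mu> \<omega> y) \<le>
       C * A * symbol_size m \<mu> / (\<mu> / symbol_scale \<rho> \<mu> * norm y) ^ CARD('n))"
proof -
  define n where "n = CARD('n)"
  have n: "0 < n" by (simp add: n_def)
  obtain Ca where Ca: "0 \<le> Ca" "\<And>A \<alpha> \<mu> \<omega> j. 0 \<le> A \<Longrightarrow> symbol_bound (Suc CARD('n)) m \<rho> A \<alpha> \<Longrightarrow> 0 < \<mu> \<Longrightarrow> norm \<omega> = 1 \<Longrightarrow>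
    bounded_derivs ((1 / symbol_scale \<rho> \<mu>) *\<^sub>R axis j 1) (ball \<omega> (1 / 2)) (Suc CARD('n)) (Ca * A * symbol_size m \<mu>)
      (amplitude \<delta> \<alpha> \<mu> \<omega>)"
    using amplitude_bounded_derivs[OF \<rho> \<delta>(1), of m] by blast
  obtain M where M: "0 \<le> M" "\<And>j k x \<zeta>. k \<le> (Suc CARD('n)) \<Longrightarrow> x \<in> K \<Longrightarrow> \<zeta> \<in> annulus \<Longrightarrow> \<bar>D j k (x, \<zeta>)\<bar> \<le> M"
    using D_G_bounded[OF K, of "Suc CARD('n)" ] by blast
  define c where "c = 1 / (2 * real n)"
  have c: "0 < c" using n by (simp add: c_def)
  define R where "R = max 1 (2 * real n * M)"
  obtain Cn where Cn: "0 \<le> Cn" "\<And>e S Q (\<Theta> :: real^'n \<Rightarrow> real) B \<Lambda> MB. nonstationary n c (M + 1) e S Q \<Lambda> MB \<Theta> B \<Longrightarrow>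
    cmod (\<integral>x. cis (\<Theta> x) * B x \<partial>lborel) \<le> Cn * MB * measure lborel Q / \<Lambda> ^ n"
    using nonstationary_phase[of c "M + 1" n] c M(1) by auto
  define vol where "vol = unit_ball_vol (real n)"
  have vol: "0 \<le> vol" by (simp add: vol_def)
  define C where "C = (1 + Cn) * Ca * vol"
  show ?thesis
  proof (rule exI[of _ C], intro conjI, goal_cases)
    case 1
    show ?case using Ca(1) Cn(1) vol by (simp add: C_def)
  next
    case 2
    show ?case
    proof (rule exI[of _ R], intro conjI allI impI)
    show "1 \<le> R" by (simp add: R_def)
    fix A \<mu> :: real and \<alpha> :: "real^'n \<Rightarrow> complex" and x \<omega> y :: "real^'n"
    assume *: "0 \<le> A" "symbol_bound (Suc CARD('n)) m \<rho> A \<alpha>" "x \<in> K" "0 < \<mu>" "norm (\<omega>::real^'n) = 1"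
    define \<nu> where "\<nu> = symbol_scale \<rho> \<mu>"
    have \<nu>: "1 \<le> \<nu>" using \<rho> by (simp add: \<nu>_def symbol_scale_ge_1)
    define MB where "MB = Ca * A * symbol_size m \<mu>"
    have MB: "0 \<le> MB" using Ca(1) * symbol_size_pos[of \<mu> m] by (simp add: MB_def)
    have CA: "C * A * symbol_size m \<mu> = MB * vol + Cn * MB * vol"
      by (simp add: C_def MB_def algebra_simps)
    let ?Q = "cball \<omega> (2 * \<delta>)" and ?S = "ball \<omega> (1 / 2)"
    have QS: "?Q \<subseteq> ?S" using \<delta> by auto
    have ann: "\<zeta> \<in> annulus" "\<zeta> \<noteq> 0" if "\<zeta> \<in> ?S" for \<zeta>
      using ball_subset_annulus[OF *(5) that] annulus_nonzero by auto
    have mQ: "measure lborel ?Q \<le> vol" using \<delta> by (simp add: vol_def n_def measure_cball_le)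
    have amp: "bounded_derivs ((1 / \<nu>) *\<^sub>R axis j 1) ?S (Suc CARD('n)) MB (amplitude \<delta> \<alpha> \<mu> \<omega>)" for j
      unfolding \<nu>_def MB_def by (rule Ca(2)[OF *(1,2,4,5)])
    have amp0: "amplitude \<delta> \<alpha> \<mu> \<omega> \<zeta> = 0" if "\<zeta> \<notin> ?Q" for \<zeta>
      using amplitude_eq_0[OF that \<delta>(1) _ *(5)] \<delta> by simp
    have "cmod (kernel \<delta> \<alpha> x \<mu> \<omega> y) \<le> MB * measure lborel ?Q"
      unfolding kernel_def
    proof (rule norm_integral_le_bound_on_compact[OF compact_cball _ _ MB])
      show "cmod (cis (\<mu> * (\<phi> x \<zeta> - y \<bullet> \<zeta>)) * amplitude \<delta> \<alpha> \<mu> \<omega> \<zeta>) \<le> MB" if "\<zeta> \<in> ?Q" for \<zeta>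
        using bounded_derivs_bound[OF amp[of undefined]] that QS by (simp add: norm_mult subset_iff)
    qed (use amp0 in simp)
    also have "\<dots> \<le> MB * vol" using MB mQ by (rule mult_left_mono[rotated])
    also have "\<dots> \<le> C * A * symbol_size m \<mu>"
      using Cn(1) MB vol unfolding CA by simp
    finally show "cmod (kernel \<delta> \<alpha> x \<mu> \<omega> y) \<le> C * A * symbol_size m \<mu>" .
    assume y: "R \<le> norm y"
    have y1: "1 \<le> norm y" using y by (simp add: R_def)
    then have y0: "0 < norm y" by linarith
    obtain i where i: "norm y \<le> real n * \<bar>y $ i\<bar>"
      using norm_le_card_mult_component[of y] by (auto simp: n_def)
    define \<Lambda> where "\<Lambda> = \<mu> / \<nu> * norm y"
    have \<Lambda>: "0 < \<Lambda>" using *(4) \<nu> y0 by (simp add: \<Lambda>_def zero_less_mult_iff zero_less_divide_iff)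
    define F where "F k \<zeta> = (if k = 0 then (D i 1 (x, \<zeta>) - y $ i) / norm y
        else (1 / \<nu>) ^ k * D i (Suc k) (x, \<zeta>) / norm y)" for k \<zeta>
    have "nonstationary n c (M + 1) ((1 / \<nu>) *\<^sub>R axis i 1) ?S ?Q \<Lambda> MB
        (\<lambda>\<zeta>. \<mu> * (\<phi> x \<zeta> - y \<bullet> \<zeta>)) (amplitude \<delta> \<alpha> \<mu> \<omega>)"
      unfolding nonstationary_def
    proof (intro conjI exI[of _ "F 0"] open_ball compact_cball QS \<Lambda> MB)
      have z: "0 \<notin> ?S" using *(5) by (simp add: dist_norm)
      show "continuous_on ?S (\<lambda>\<zeta>. \<mu> * (\<phi> x \<zeta> - y \<bullet> \<zeta>))"
        by (intro continuous_intros continuous_on_phase z)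
      show "\<forall>\<zeta>\<in>?S. ((\<lambda>t. \<mu> * (\<phi> x (\<zeta> + t *\<^sub>R ((1 / \<nu>) *\<^sub>R axis i 1)) - y \<bullet> (\<zeta> + t *\<^sub>R ((1 / \<nu>) *\<^sub>R axis i 1))))
          has_real_derivative \<Lambda> * F 0 \<zeta>) (at 0)"
      proof
        fix \<zeta> assume "\<zeta> \<in> ?S"
        then have d: "((\<lambda>t. \<phi> x (\<zeta> + t *\<^sub>R ((1 / \<nu>) *\<^sub>R axis i 1))) has_real_derivative 1 / \<nu> * D i (Suc 0) (x, \<zeta>)) (at 0)"
          using D_line_axis[OF ann(2), of \<zeta> i 0 x "1 / \<nu>"] by (simp add: D_0)
        have "y \<bullet> axis i 1 = y $ i" by (simp add: inner_axis)
        then have "((\<lambda>t. y \<bullet> (\<zeta> + t *\<^sub>R ((1 / \<nu>) *\<^sub>R axis i 1))) has_real_derivative 1 / \<nu> * y $ i) (at 0)"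
          using \<nu> by (auto simp: inner_add_right intro!: derivative_eq_intros)
        from DERIV_cmult[OF DERIV_diff[OF d this], of \<mu>]
        show "((\<lambda>t. \<mu> * (\<phi> x (\<zeta> + t *\<^sub>R ((1 / \<nu>) *\<^sub>R axis i 1)) - y \<bullet> (\<zeta> + t *\<^sub>R ((1 / \<nu>) *\<^sub>R axis i 1))))
          has_real_derivative \<Lambda> * F 0 \<zeta>) (at 0)"
        proof (rule DERIV_cong)
          show "\<mu> * (1 / \<nu> * D i (Suc 0) (x, \<zeta>) - 1 / \<nu> * y $ i) = \<Lambda> * F 0 \<zeta>"
            using y0 \<nu> by (simp add: \<Lambda>_def F_def field_simps)
        qed
      qed
      show "bounded_derivs ((1 / \<nu>) *\<^sub>R axis i 1) ?S n (M + 1) (F 0)"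
      proof (rule bounded_derivs_of_sequence)
        show "continuous_on ?S (F k)" for k
          unfolding F_def by (cases "k = 0") (use z y1 in \<open>auto intro!: continuous_intros continuous_on_D_slice\<close>)
        show "norm (F k \<zeta>) \<le> M + 1" if k: "k \<le> n" and \<zeta>: "\<zeta> \<in> ?S" for k \<zeta>
        proof (cases "k = 0")
          case True
          have "\<bar>D i 1 (x, \<zeta>) - y $ i\<bar> \<le> M + norm y"
            using M(2)[OF _ *(3) ann(1)[OF \<zeta>], of 1 i] component_le_norm_cart[of y i] by simp
          also have "\<dots> \<le> (M + 1) * norm y" using M(1) y1 mult_left_mono[of 1 "norm y" M] by (simp add: algebra_simps)
          finally show ?thesis using True y0 by (simp add: F_def pos_divide_le_eq)
        next
          case False
          have "\<bar>D i (Suc k) (x, \<zeta>)\<bar> \<le> M"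
            using M(2)[OF _ *(3) ann(1)[OF \<zeta>], of "Suc k" i] k by (simp add: n_def)
          moreover have "\<bar>(1 / \<nu>) ^ k\<bar> \<le> 1" using \<nu> by (simp add: power_one_over)
          ultimately have "\<bar>(1 / \<nu>) ^ k * D i (Suc k) (x, \<zeta>)\<bar> \<le> 1 * M"
            unfolding abs_mult by (intro mult_mono) auto
          also have "\<dots> \<le> (M + 1) * norm y" using M(1) y1 mult_mono[of M "M + 1" 1 "norm y"] by simp
          finally show ?thesis using False y0 by (simp add: F_def pos_divide_le_eq)
        qed
        show "((\<lambda>t. F k (\<zeta> + t *\<^sub>R ((1 / \<nu>) *\<^sub>R axis i 1))) has_vector_derivative F (Suc k) \<zeta>) (at 0)"
          if "\<zeta> \<in> ?S" for k \<zeta>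
        proof -
          note d = D_line_axis[OF ann(2)[OF that], of i _ x "1 / \<nu>"]
          show ?thesis
          proof (cases "k = 0")
            case True
            have "((\<lambda>t. (D i 1 (x, \<zeta> + t *\<^sub>R ((1 / \<nu>) *\<^sub>R axis i 1)) - y $ i) / norm y) has_real_derivative
                (1 / \<nu> * D i (Suc 1) (x, \<zeta>) - 0) / norm y) (at 0)"
              by (intro DERIV_cdivide DERIV_diff d DERIV_const)
            then show ?thesis using True by (simp add: F_def has_real_derivative_iff_has_vector_derivative)
          next
            case False
            have "((\<lambda>t. (1 / \<nu>) ^ k * D i (Suc k) (x, \<zeta> + t *\<^sub>R ((1 / \<nu>) *\<^sub>R axis i 1)) / norm y) has_real_derivative
                (1 / \<nu>) ^ k * (1 / \<nu> * D i (Suc (Suc k)) (x, \<zeta>)) / norm y) (at 0)"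
              by (intro DERIV_cdivide DERIV_cmult d)
            then show ?thesis using False by (simp add: F_def has_real_derivative_iff_has_vector_derivative mult_ac)
          qed
        qed
      qed
      show "\<forall>\<zeta>\<in>?S. c \<le> \<bar>F 0 \<zeta>\<bar>"
      proof
        fix \<zeta> assume \<zeta>: "\<zeta> \<in> ?S"
        have "2 * real n * \<bar>D i 1 (x, \<zeta>)\<bar> \<le> norm y"
          using mult_left_mono[OF M(2)[OF _ *(3) ann(1)[OF \<zeta>], of 1 i], of "2 * real n"] y by (simp add: R_def)
        then have "norm y \<le> 2 * real n * (\<bar>y $ i\<bar> - \<bar>D i 1 (x, \<zeta>)\<bar>)"
          using i by (simp add: algebra_simps)
        also have "\<dots> \<le> 2 * real n * \<bar>D i 1 (x, \<zeta>) - y $ i\<bar>"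
          by (intro mult_left_mono) auto
        finally show "c \<le> \<bar>F 0 \<zeta>\<bar>"
          using n y0 by (simp add: c_def F_def field_simps)
      qed
      show "bounded_derivs ((1 / \<nu>) *\<^sub>R axis i 1) ?S n MB (amplitude \<delta> \<alpha> \<mu> \<omega>)"
        by (rule bounded_derivs_le_order[OF amp]) (simp add: n_def)
      show "\<forall>\<zeta>. \<zeta> \<notin> ?Q \<longrightarrow> amplitude \<delta> \<alpha> \<mu> \<omega> \<zeta> = 0" using amp0 by blast
    qed
    then have "cmod (kernel \<delta> \<alpha> x \<mu> \<omega> y) \<le> Cn * MB * measure lborel ?Q / \<Lambda> ^ n"
      unfolding kernel_def by (rule Cn(2))
    also have "\<dots> \<le> Cn * MB * vol / \<Lambda> ^ n"
      using Cn(1) MB mQ \<Lambda> by (intro divide_right_mono mult_left_mono) auto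
    also have "\<dots> \<le> C * A * symbol_size m \<mu> / \<Lambda> ^ n"
      using Cn(1) MB vol \<Lambda> unfolding CA by (intro divide_right_mono) simp_all
    finally show "cmod (kernel \<delta> \<alpha> x \<mu> \<omega> y) \<le>
       C * A * symbol_size m \<mu> / (\<mu> / symbol_scale \<rho> \<mu> * norm y) ^ CARD('n)"
      by (simp add: \<Lambda>_def \<nu>_def n_def)
    qed
  qed
qed

text \<open>The phase may be stationary somewhere in the ball, and the bound has to be uniform in \<open>y\<close>.
  The factor \<open>\<mu> powr (- \<rho> * (n - 1) / 2)\<close> is the square root of the gain of the correlation estimate: the correlation at distance \<open>d\<close>
  decays like \<open>(1 + s * \<bar>d\<bar>) powr (- (n + 1))\<close> with \<open>s = \<mu> powr \<rho>\<close> and has integral \<open>O(s powr (- n))\<close>, of which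
  the division by the volume \<open>1 / s\<close> of the averaging box \<open>W\<close> gives back one power of \<open>s\<close>.\<close>

lemma kernel_bound_stationary:
  assumes K: "compact K" and \<rho>: "0 \<le> \<rho>" "\<rho> \<le> 1"
    and c: "0 < c" and \<delta>0: "\<delta>0 \<le> 1 / 2"
    and sep: "\<And>x \<omega> i h. x \<in> K \<Longrightarrow> norm \<omega> = 1 \<Longrightarrow> 1 \<le> real CARD('n) * \<bar>\<omega> $ i\<bar> \<Longrightarrow>
      2 * real CARD('n) * \<bar>h $ i\<bar> \<le> norm h \<Longrightarrow>
      \<exists>j. \<forall>\<zeta>. \<zeta> \<in> ball \<omega> \<delta>0 \<longrightarrow> \<zeta> + h \<in> ball \<omega> \<delta>0 \<longrightarrow> c * norm h \<le> \<bar>D j 1 (x, \<zeta> + h) - D j 1 (x, \<zeta>)\<bar>"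
    and \<delta>: "0 < \<delta>" "2 * \<delta> < \<delta>0"
  shows "\<exists>C\<ge>0. \<forall>A \<alpha> x \<mu> \<omega> y. 0 \<le> A \<longrightarrow> symbol_bound (Suc CARD('n)) m \<rho> A \<alpha> \<longrightarrow> x \<in> K \<longrightarrow> 1 \<le> \<mu> \<longrightarrow> norm \<omega> = 1 \<longrightarrow>
    cmod (kernel \<delta> \<alpha> x \<mu> \<omega> y) \<le> C * A * \<mu> powr (m - \<rho> * (real CARD('n) - 1) / 2)"
proof -
  define n where "n = CARD('n)"
  have n: "0 < n" by (simp add: n_def)
  obtain Ca where Ca: "0 \<le> Ca" "\<And>A \<alpha> \<mu> \<omega> j. 0 \<le> A \<Longrightarrow> symbol_bound (Suc n) m \<rho> A \<alpha> \<Longrightarrow> 0 < \<mu> \<Longrightarrow> norm \<omega> = 1 \<Longrightarrow>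
    bounded_derivs ((1 / symbol_scale \<rho> \<mu>) *\<^sub>R axis j 1) (ball \<omega> (1 / 2)) (Suc n) (Ca * A * symbol_size m \<mu>)
      (amplitude \<delta> \<alpha> \<mu> \<omega>)"
    using amplitude_bounded_derivs[OF \<rho> \<delta>(1), of m] unfolding n_def by blast
  obtain M where M: "0 \<le> M" "\<And>j k x \<zeta> v. k \<le> Suc (Suc n) \<Longrightarrow> x \<in> K \<Longrightarrow> \<zeta> \<in> annulus \<Longrightarrow> \<bar>G j k (x, \<zeta>) v\<bar> \<le> M * norm v"
    using D_G_bounded[OF K, of "Suc (Suc n)"] by blast
  obtain Cn where Cn: "0 \<le> Cn" "\<And>e S Q (\<Theta> :: real^'n \<Rightarrow> real) B \<Lambda> MB. nonstationary (Suc n) c M e S Q \<Lambda> MB \<Theta> B \<Longrightarrow>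
    cmod (\<integral>x. cis (\<Theta> x) * B x \<partial>lborel) \<le> Cn * MB * measure lborel Q / \<Lambda> ^ Suc n"
    using nonstationary_phase[OF c M(1), of "Suc n"] by blast
  define vol where "vol = unit_ball_vol (real n)"
  have vol: "0 < vol" by (simp add: vol_def)
  have "(\<integral>\<^sup>+d. ennreal ((1 + norm (d::real^'n)) powr (- real (Suc n))) * 1 \<partial>lebesgue) < \<infinity>"
  proof (rule nn_integral_decay_finite)
    show "(\<integral>\<^sup>+y\<in>ball (0::real^'n) (2 ^ k). 1 \<partial>lebesgue) \<le> ennreal (vol * (2 ^ n) ^ k)" for k
      by (simp add: emeasure_ball vol_def n_def power_mult[symmetric] mult.commute)
    show "(2::real) ^ n < 2 powr real (Suc n)" by (simp add: powr_realpow del: of_nat_Suc)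
  qed (use vol in auto)
  then obtain J where J: "(\<integral>\<^sup>+d. ennreal ((1 + norm (d::real^'n)) powr (- real (Suc n))) \<partial>lborel) = ennreal J" "0 \<le> J"
    by (simp add: nn_integral_completion less_top_ennreal) (metis ennreal_cases top.not_eq_extremum infinity_ennreal_def)
  define V where "V = vol * (1 + real n) ^ n"
  have V: "0 < V" using vol by (simp add: V_def)
  define P0 where "P0 = vol * (Cn * 2 ^ Suc n * 2 ^ Suc n + (1 + 2 * real n) ^ Suc n)"
  have P0: "0 \<le> P0" using vol Cn(1) by (simp add: P0_def)
  show ?thesis
  proof (intro exI[of _ "sqrt (V * P0 * J) * Ca"] conjI allI impI)
    show "0 \<le> sqrt (V * P0 * J) * Ca" using V P0 J(2) Ca(1) by simp
    fix A \<mu> :: real and \<alpha> :: "real^'n \<Rightarrow> complex" and x \<omega> y :: "real^'n"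
    assume *: "0 \<le> A" "symbol_bound (Suc CARD('n)) m \<rho> A \<alpha>" "x \<in> K" "1 \<le> \<mu>" "norm \<omega> = 1"
    have \<mu>: "0 < \<mu>" using *(4) by simp
    define \<nu> where "\<nu> = symbol_scale \<rho> \<mu>"
    have \<nu>: "1 \<le> \<nu>" using \<rho> by (simp add: \<nu>_def symbol_scale_ge_1)
    define s where "s = \<mu> powr \<rho>"
    have s: "1 \<le> s" using *(4) \<rho> by (simp add: s_def ge_one_powr_ge_zero)
    have s\<nu>: "\<mu> / \<nu> = s"
      using *(4) by (cases "\<mu> = 1") (simp_all add: \<nu>_def symbol_scale_def s_def powr_diff)
    define MB where "MB = Ca * A * \<mu> powr m"
    have MB: "0 \<le> MB" using Ca(1) *(1) by (simp add: MB_def)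
    have size: "symbol_size m \<mu> = \<mu> powr m" using *(4) by (auto simp: symbol_size_def)
    define b where "b = amplitude \<delta> \<alpha> \<mu> \<omega>"
    let ?Q = "cball \<omega> (2 * \<delta>)" and ?S = "ball \<omega> \<delta>0"
    have QS: "?Q \<subseteq> ?S" using \<delta> by auto
    have S2: "?S \<subseteq> ball \<omega> (1 / 2)" using \<delta>0 by auto
    have ann: "\<zeta> \<in> annulus" "\<zeta> \<noteq> 0" if "\<zeta> \<in> ?S" for \<zeta>
      using ball_subset_annulus[OF *(5) subsetD[OF S2 that]] annulus_nonzero by auto
    have z: "0 \<notin> ?S" using ann(2) by blast
    have mQ: "measure lborel ?Q \<le> vol" using \<delta> \<delta>0 by (simp add: vol_def n_def measure_cball_le)
    have amp: "bounded_derivs ((1 / \<nu>) *\<^sub>R axis j 1) ?S (Suc n) MB b" for j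
      unfolding \<nu>_def MB_def b_def size[symmetric]
      by (rule bounded_derivs_mono[OF Ca(2)[OF *(1) _ \<mu> *(5)] order_refl S2]) (use *(2) in \<open>simp add: n_def\<close>)
    have b0: "b \<zeta> = 0" if "\<zeta> \<notin> ?Q" for \<zeta>
      unfolding b_def using amplitude_eq_0[OF that \<delta>(1) _ *(5)] \<delta> \<delta>0 by simp
    have bM: "cmod (b \<zeta>) \<le> MB" for \<zeta>
      using bounded_derivs_bound[OF amp[of undefined], of \<zeta>] b0[of \<zeta>] QS MB by (cases "\<zeta> \<in> ?Q") auto
    define g where "g \<zeta> = cis (\<mu> * (\<phi> x \<zeta> - y \<bullet> \<zeta>)) * b \<zeta>" for \<zeta>
    have g0: "g \<zeta> = 0" if "\<zeta> \<notin> ?Q" for \<zeta> using b0[OF that] by (simp add: g_def)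
    have gM: "cmod (g \<zeta>) \<le> MB" for \<zeta> using bM[of \<zeta>] by (simp add: g_def norm_mult)
    have gc: "continuous_on UNIV g"
    proof (rule continuous_on_extend_by_zero[OF open_ball compact_cball QS _ g0])
      show "continuous_on ?S g" unfolding g_def
        by (intro continuous_intros continuous_on_phase z bounded_derivs_continuous[OF amp])
    qed
    obtain i where i: "1 \<le> real n * \<bar>\<omega> $ i\<bar>"
      using norm_le_card_mult_component[of \<omega>] *(5) by (auto simp: n_def)
    \<comment> \<open>\<open>W\<close> is thin in a coordinate in which \<open>\<omega>\<close> is large, so that differences of points of \<open>W\<close> that are
      long compared with \<open>1 / s\<close> are transversal to the radial direction\<close>
    define a where "a = (\<chi> k. if k = i then 1 / (2 * s) else (1 / 2 :: real))"
    define W where "W = cbox (- a) a"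
    have a0: "0 < a $ k" for k using s by (simp add: a_def)
    have mW: "measure lborel W = 1 / s"
    proof -
      have "0 \<in> W" using a0 by (simp add: W_def mem_box_cart less_imp_le)
      then have "W \<noteq> {}" by blast
      then have "measure lborel W = (\<Prod>k\<in>UNIV. a $ k - (- a) $ k)"
        unfolding W_def by (rule content_cbox_cart)
      also have "\<dots> = (\<Prod>k\<in>UNIV. if k = i then 1 / s else 1)"
        using s by (intro prod.cong) (auto simp: a_def field_simps)
      also have "\<dots> = 1 / s" by simp
      finally show ?thesis .
    qed
    have Wc: "\<bar>h $ k\<bar> \<le> a $ k" if "h \<in> W" for h k
      using that by (auto simp: W_def mem_box_cart abs_le_iff minus_le_iff)
    have Wn: "norm h \<le> real n / 2" if "h \<in> W" for h
    proof -
      have "norm h \<le> (\<Sum>k\<in>UNIV. \<bar>h $ k\<bar>)" by (rule norm_le_l1_cart)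
      also have "\<dots> \<le> (\<Sum>k\<in>(UNIV::'n set). 1 / 2)"
      proof (rule sum_mono)
        fix k
        have "a $ k \<le> 1 / 2" using s by (simp add: a_def field_simps)
        then show "\<bar>h $ k\<bar> \<le> 1 / 2" using Wc[OF that, of k] by linarith
      qed
      finally show ?thesis by (simp add: n_def)
    qed
    define P where "P = P0 * MB\<^sup>2"
    have P: "0 \<le> P" using P0 by (simp add: P_def)
    define \<beta> where "\<beta> d = ennreal (P * (1 + s * norm d) powr (- real (Suc n)))" for d :: "real^'n"
    have corr: "cmod (\<integral>\<zeta>. g (\<zeta> + d) * cnj (g \<zeta>) \<partial>lborel) \<le> P * (1 + s * norm d) powr (- real (Suc n))"
      if d: "\<bar>d $ i\<bar> \<le> 1 / s" for d
    proof -
      define t where "t = s * norm d"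
      have t0: "0 \<le> t" using s by (simp add: t_def)
      have tp: "(1 + t) powr (- real (Suc n)) = 1 / (1 + t) ^ Suc n"
        using t0 by (simp add: powr_minus powr_realpow divide_inverse del: of_nat_Suc power_Suc)
      have split: "P = MB\<^sup>2 * vol * (Cn * 2 ^ Suc n * 2 ^ Suc n) + MB\<^sup>2 * vol * (1 + 2 * real n) ^ Suc n"
        by (simp add: P_def P0_def algebra_simps)
      \<comment> \<open>for \<open>t < 2 * n\<close> there may be no oscillation and the trivial bound is used\<close>
      have "cmod (\<integral>\<zeta>. g (\<zeta> + d) * cnj (g \<zeta>) \<partial>lborel) \<le> P / (1 + t) ^ Suc n"
      proof (cases "t < 2 * real n")
        case True
        have "cmod (\<integral>\<zeta>. g (\<zeta> + d) * cnj (g \<zeta>) \<partial>lborel) \<le> (MB * MB) * measure lborel ?Q"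
        proof (rule norm_integral_le_bound_on_compact[OF compact_cball])
          show "cmod (g (\<zeta> + d) * cnj (g \<zeta>)) \<le> MB * MB" for \<zeta>
            using mult_mono[OF gM[of "\<zeta> + d"] gM[of \<zeta>] MB] by (simp add: norm_mult)
        qed (use g0 MB in auto)
        also have "\<dots> \<le> (MB * MB) * vol" using MB mQ by (intro mult_left_mono) auto
        also have "\<dots> = (MB\<^sup>2 * vol) * 1" by (simp add: power2_eq_square)
        also have "\<dots> \<le> (MB\<^sup>2 * vol) * ((1 + 2 * real n) ^ Suc n / (1 + t) ^ Suc n)"
        proof (rule mult_left_mono)
          have "(1 + t) ^ Suc n \<le> (1 + 2 * real n) ^ Suc n" using True t0 by (intro power_mono) auto
          moreover have "0 < (1 + t) ^ Suc n" using t0 by (intro zero_less_power) simp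
          ultimately show "1 \<le> (1 + 2 * real n) ^ Suc n / (1 + t) ^ Suc n" by (simp only: pos_le_divide_eq mult_1)
        qed (use vol in simp)
        also have "\<dots> \<le> P / (1 + t) ^ Suc n"
          unfolding split using t0 vol Cn(1) by (simp add: add_divide_distrib del: power_Suc)
        finally show ?thesis .
      next
        case False
        then have t: "2 * real n \<le> t" by simp
        then have t1: "1 \<le> t" using n by linarith
        then have d0: "d \<noteq> 0" using t_def by auto
        have "2 * real n * \<bar>d $ i\<bar> \<le> 2 * real n * (1 / s)" using d by (intro mult_left_mono) auto
        also have "\<dots> \<le> norm d" using t s by (simp add: t_def divide_le_eq mult.commute)
        finally obtain j where j: "\<And>\<zeta>. \<zeta> \<in> ?S \<Longrightarrow> \<zeta> + d \<in> ?S \<Longrightarrow> c * norm d \<le> \<bar>D j 1 (x, \<zeta> + d) - D j 1 (x, \<zeta>)\<bar>"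
          using sep[OF *(3,5) i[unfolded n_def], of d] by (auto simp: n_def)
        let ?e = "(1 / \<nu>) *\<^sub>R axis j 1 :: real^'n"
        define S' where "S' = ?S \<inter> {\<zeta>. \<zeta> + d \<in> ?S}"
        define Q' where "Q' = ?Q \<inter> {\<zeta>. \<zeta> + d \<in> ?Q}"
        have oS: "open {\<zeta>. \<zeta> + d \<in> ?S}"
          using open_vimage[OF open_ball, of "\<lambda>\<zeta>. \<zeta> + d" \<omega> \<delta>0] by (simp add: vimage_def continuous_on_add)
        have cQ: "closed {\<zeta>. \<zeta> + d \<in> ?Q}"
          using closed_vimage[OF closed_cball, of "\<lambda>\<zeta>. \<zeta> + d" \<omega> "2 * \<delta>"] by (simp add: vimage_def continuous_on_add)
        have S': "open S'" "S' \<subseteq> ?S" "S' \<subseteq> {\<zeta>. \<zeta> + d \<in> ?S}" using oS by (auto simp: S'_def)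
        have S'D: "\<zeta> \<in> ?S" "\<zeta> + d \<in> ?S" if "\<zeta> \<in> S'" for \<zeta>
          using that unfolding S'_def by blast+
        have Q': "compact Q'" "Q' \<subseteq> S'" "Q' \<subseteq> ?Q"
          using cQ QS by (auto simp: Q'_def S'_def intro: compact_Int_closed)
        define F where "F k \<zeta> = (1 / \<nu>) ^ k * (D j (Suc k) (x, \<zeta> + d) - D j (Suc k) (x, \<zeta>)) / norm d" for k \<zeta>
        define B where "B \<zeta> = b (\<zeta> + d) * cnj (b \<zeta>)" for \<zeta>
        have B0: "B \<zeta> = 0" if "\<zeta> \<notin> Q'" for \<zeta>
          using that b0[of \<zeta>] b0[of "\<zeta> + d"] by (auto simp: B_def Q'_def)
        have slice: "continuous_on S' (\<lambda>\<zeta>. D j' k (x, \<zeta> + d))" "continuous_on S' (\<lambda>\<zeta>. D j' k (x, \<zeta>))" for j' k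
          using S' by (auto intro!: continuous_on_compose2[OF continuous_on_D_slice[OF z, of j' k x]] continuous_intros)
        have nz: "\<zeta> \<noteq> 0" "\<zeta> + d \<noteq> 0" if "\<zeta> \<in> S'" for \<zeta>
          using ann(2)[OF S'D(1)[OF that]] ann(2)[OF S'D(2)[OF that]] by auto
        have shift: "((\<lambda>t. D j k (x, \<zeta> + t *\<^sub>R ?e + d)) has_real_derivative 1 / \<nu> * D j (Suc k) (x, \<zeta> + d)) (at 0)"
          if "\<zeta> \<in> S'" for k \<zeta>
          using D_line_axis[OF nz(2)[OF that], of j k x "1 / \<nu>"] by (simp add: ac_simps)
        have "nonstationary (Suc n) c M ?e S' Q' t (2 ^ Suc n * (MB * MB)) (\<lambda>\<zeta>. \<mu> * (\<phi> x (\<zeta> + d) - \<phi> x \<zeta>)) B"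
          unfolding nonstationary_def
        proof (intro conjI exI[of _ "F 0"] S'(1) Q'(1,2))
          show "0 < t" "0 \<le> 2 ^ Suc n * (MB * MB)" using t1 by simp_all
          show "continuous_on S' (\<lambda>\<zeta>. \<mu> * (\<phi> x (\<zeta> + d) - \<phi> x \<zeta>))"
            using slice[of undefined 0] by (intro continuous_intros) (simp_all add: D_0)
          show "\<forall>\<zeta>\<in>S'. ((\<lambda>u. \<mu> * (\<phi> x (\<zeta> + u *\<^sub>R ?e + d) - \<phi> x (\<zeta> + u *\<^sub>R ?e))) has_real_derivative t * F 0 \<zeta>) (at 0)"
          proof
            fix \<zeta> assume \<zeta>: "\<zeta> \<in> S'"
            from DERIV_cmult[OF DERIV_diff[OF shift[OF \<zeta>, of 0] D_line_axis[OF nz(1)[OF \<zeta>], of j 0 x "1 / \<nu>"]], of \<mu>]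
            have "((\<lambda>u. \<mu> * (\<phi> x (\<zeta> + u *\<^sub>R ?e + d) - \<phi> x (\<zeta> + u *\<^sub>R ?e))) has_real_derivative
              \<mu> * (1 / \<nu> * D j (Suc 0) (x, \<zeta> + d) - 1 / \<nu> * D j (Suc 0) (x, \<zeta>))) (at 0)"
              by (simp only: D_0)
            moreover have "\<mu> * (1 / \<nu> * D j (Suc 0) (x, \<zeta> + d) - 1 / \<nu> * D j (Suc 0) (x, \<zeta>)) =
                \<mu> / \<nu> * (D j (Suc 0) (x, \<zeta> + d) - D j (Suc 0) (x, \<zeta>))"
              by (simp add: right_diff_distrib)
            moreover have "\<dots> = t * F 0 \<zeta>" unfolding s\<nu> using d0 by (simp add: t_def F_def)
            ultimately show "((\<lambda>u. \<mu> * (\<phi> x (\<zeta> + u *\<^sub>R ?e + d) - \<phi> x (\<zeta> + u *\<^sub>R ?e))) has_real_derivative t * F 0 \<zeta>) (at 0)"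
              by (simp only:)
          qed
          show "bounded_derivs ?e S' (Suc n) M (F 0)"
          proof (rule bounded_derivs_of_sequence)
            show "continuous_on S' (F k)" for k
              unfolding F_def using d0 by (intro continuous_intros slice) auto
            show "norm (F k \<zeta>) \<le> M" if k: "k \<le> Suc n" and \<zeta>: "\<zeta> \<in> S'" for k \<zeta>
            proof -
              obtain \<zeta>' where \<zeta>': "\<zeta>' \<in> ?S" "D j (Suc k) (x, \<zeta> + d) - D j (Suc k) (x, \<zeta>) = G j (Suc k) (x, \<zeta>') d"
                using D_difference[OF *(5), of \<zeta> \<delta>0 d j "Suc k" x] \<zeta> \<delta>0 by (auto simp: S'_def)
              have "\<bar>D j (Suc k) (x, \<zeta> + d) - D j (Suc k) (x, \<zeta>)\<bar> \<le> M * norm d"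
                unfolding \<zeta>'(2) by (rule M(2)) (use k *(3) ann(1)[OF \<zeta>'(1)] in auto)
              moreover have "\<bar>(1 / \<nu>) ^ k\<bar> \<le> 1" using \<nu> by (simp add: power_one_over)
              ultimately have "\<bar>(1 / \<nu>) ^ k * (D j (Suc k) (x, \<zeta> + d) - D j (Suc k) (x, \<zeta>))\<bar> \<le> 1 * (M * norm d)"
                unfolding abs_mult by (intro mult_mono) auto
              then show ?thesis using d0 by (simp add: F_def divide_le_eq)
            qed
            show "((\<lambda>u. F k (\<zeta> + u *\<^sub>R ?e)) has_vector_derivative F (Suc k) \<zeta>) (at 0)" if "\<zeta> \<in> S'" for k \<zeta>
            proof -
              have "((\<lambda>u. (1 / \<nu>) ^ k * (D j (Suc k) (x, \<zeta> + u *\<^sub>R ?e + d) - D j (Suc k) (x, \<zeta> + u *\<^sub>R ?e)) / norm d) has_real_derivative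
                  (1 / \<nu>) ^ k * (1 / \<nu> * D j (Suc (Suc k)) (x, \<zeta> + d) - 1 / \<nu> * D j (Suc (Suc k)) (x, \<zeta>)) / norm d) (at 0)"
                by (intro DERIV_cdivide DERIV_cmult DERIV_diff shift[OF that] D_line_axis nz[OF that])
              moreover have "(1 / \<nu>) ^ k * (1 / \<nu> * D j (Suc (Suc k)) (x, \<zeta> + d) - 1 / \<nu> * D j (Suc (Suc k)) (x, \<zeta>)) / norm d = F (Suc k) \<zeta>"
                by (simp add: F_def right_diff_distrib)
              ultimately show ?thesis
                by (simp only: F_def[of k] has_real_derivative_iff_has_vector_derivative)
            qed
          qed
          show "\<forall>\<zeta>\<in>S'. c \<le> \<bar>F 0 \<zeta>\<bar>"
          proof
            fix \<zeta> assume "\<zeta> \<in> S'"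
            then have "c * norm d \<le> \<bar>D j 1 (x, \<zeta> + d) - D j 1 (x, \<zeta>)\<bar>" by (intro j S'D)
            then show "c \<le> \<bar>F 0 \<zeta>\<bar>" using d0 by (simp add: F_def le_divide_eq)
          qed
          have b1: "bounded_derivs ?e S' (Suc n) MB (\<lambda>\<zeta>. b (\<zeta> + d))"
            by (rule bounded_derivs_mono[OF bounded_derivs_translate[OF amp] order_refl S'(3)])
          have "bounded_derivs ?e S' (Suc n) (1 * MB) (\<lambda>\<zeta>. cnj (b \<zeta>))"
            by (rule bounded_derivs_bounded_linear[OF bounded_derivs_mono[OF amp order_refl S'(2)] bounded_linear_cnj]) simp_all
          then have b2: "bounded_derivs ?e S' (Suc n) MB (\<lambda>\<zeta>. cnj (b \<zeta>))" by (simp only: mult_1)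
          show "bounded_derivs ?e S' (Suc n) (2 ^ Suc n * (MB * MB)) B"
            unfolding B_def by (rule bounded_derivs_mult[OF b1 b2 MB MB])
          show "\<forall>\<zeta>. \<zeta> \<notin> Q' \<longrightarrow> B \<zeta> = 0" using B0 by blast
        qed
        from Cn(2)[OF this]
        have ns: "cmod (\<integral>\<zeta>. cis (\<mu> * (\<phi> x (\<zeta> + d) - \<phi> x \<zeta>)) * B \<zeta> \<partial>lborel) \<le>
            Cn * (2 ^ Suc n * (MB * MB)) * measure lborel Q' / t ^ Suc n" .
        have "g (\<zeta> + d) * cnj (g \<zeta>) = cis (- \<mu> * (y \<bullet> d)) * (cis (\<mu> * (\<phi> x (\<zeta> + d) - \<phi> x \<zeta>)) * B \<zeta>)" for \<zeta>
        proof -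
          have "g (\<zeta> + d) * cnj (g \<zeta>) =
              (cis (\<mu> * (\<phi> x (\<zeta> + d) - y \<bullet> (\<zeta> + d))) * cis (- (\<mu> * (\<phi> x \<zeta> - y \<bullet> \<zeta>)))) * B \<zeta>"
            by (simp add: g_def B_def cis_cnj)
          also have "cis (\<mu> * (\<phi> x (\<zeta> + d) - y \<bullet> (\<zeta> + d))) * cis (- (\<mu> * (\<phi> x \<zeta> - y \<bullet> \<zeta>))) =
              cis (- \<mu> * (y \<bullet> d)) * cis (\<mu> * (\<phi> x (\<zeta> + d) - \<phi> x \<zeta>))"
            unfolding cis_mult by (rule arg_cong[of _ _ cis]) (simp add: inner_add_right algebra_simps)
          finally show ?thesis by (simp only: mult.assoc)
        qed
        then have "cmod (\<integral>\<zeta>. g (\<zeta> + d) * cnj (g \<zeta>) \<partial>lborel) =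
            cmod (\<integral>\<zeta>. cis (\<mu> * (\<phi> x (\<zeta> + d) - \<phi> x \<zeta>)) * B \<zeta> \<partial>lborel)"
          by (simp add: norm_mult)
        also note ns
        also have "Cn * (2 ^ Suc n * (MB * MB)) * measure lborel Q' / t ^ Suc n \<le>
            Cn * (2 ^ Suc n * (MB * MB)) * vol / t ^ Suc n"
        proof (intro divide_right_mono mult_left_mono)
          have "measure lborel Q' \<le> measure lborel ?Q"
            using Q' by (intro measure_mono_fmeasurable) (auto simp: borel_compact intro: fmeasurable_compact)
          then show "measure lborel Q' \<le> vol" using mQ by linarith
        qed (use Cn(1) MB t0 in simp_all)
        also have "\<dots> = MB\<^sup>2 * vol * (Cn * 2 ^ Suc n) * (1 / t ^ Suc n)" by (simp add: power2_eq_square)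
        also have "\<dots> \<le> MB\<^sup>2 * vol * (Cn * 2 ^ Suc n) * (2 ^ Suc n / (1 + t) ^ Suc n)"
        proof (rule mult_left_mono)
          have "(1 + t) ^ Suc n \<le> (2 * t) ^ Suc n" using t1 by (intro power_mono) auto
          then have "(1 + t) ^ Suc n \<le> 2 ^ Suc n * t ^ Suc n" by (simp only: power_mult_distrib)
          moreover have "0 < t ^ Suc n" "0 < (1 + t) ^ Suc n" using t1 by (intro zero_less_power, simp)+
          ultimately show "1 / t ^ Suc n \<le> 2 ^ Suc n / (1 + t) ^ Suc n"
            by (simp add: divide_le_eq le_divide_eq del: power_Suc)
        qed (use Cn(1) vol in simp)
        also have "\<dots> \<le> P / (1 + t) ^ Suc n"
          unfolding split using t0 vol by (simp add: add_divide_distrib del: power_Suc) (simp add: mult_ac)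
        finally show ?thesis .
      qed
      then show ?thesis using tp by (simp add: t_def divide_inverse)
    qed
    have int\<beta>: "(\<integral>\<^sup>+d. \<beta> d \<partial>lborel) = ennreal (P * (1 / s) ^ n * J)"
    proof -
      have "(\<integral>\<^sup>+d. \<beta> d \<partial>lborel) = ennreal (\<bar>1 / s\<bar> ^ DIM(real^'n)) * (\<integral>\<^sup>+d. \<beta> (0 + (1 / s) *\<^sub>R d) \<partial>lborel)"
        using s by (intro nn_integral_lborel_affine) (auto simp: \<beta>_def)
      also have "(\<integral>\<^sup>+d. \<beta> (0 + (1 / s) *\<^sub>R d) \<partial>lborel) = (\<integral>\<^sup>+d. ennreal P * ennreal ((1 + norm (d::real^'n)) powr (- real (Suc n))) \<partial>lborel)"
        using s P by (intro nn_integral_cong) (simp add: \<beta>_def ennreal_mult)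
      also have "\<dots> = ennreal P * (\<integral>\<^sup>+d. ennreal ((1 + norm (d::real^'n)) powr (- real (Suc n))) \<partial>lborel)"
        by (rule nn_integral_cmult) measurable
      also have "\<dots> = ennreal P * ennreal J" by (simp only: J(1))
      finally show ?thesis using s P J(2) by (simp add: n_def ennreal_mult mult_ac)
    qed
    have "ennreal (measure lborel W * (cmod (\<integral>\<zeta>. g \<zeta> \<partial>lborel))\<^sup>2) \<le>
        ennreal (measure lborel (cball \<omega> (1 + real n))) * (\<integral>\<^sup>+d. \<beta> d \<partial>lborel)"
    proof (rule norm_integral_squared_le_correlations[OF gc compact_cball g0])
      show "compact W" by (simp add: W_def compact_cbox)
      show "\<zeta> \<in> cball \<omega> (1 + real n)" if "h \<in> W" "\<zeta> + h \<in> ?Q" for \<zeta> h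
      proof -
        have "dist \<omega> \<zeta> \<le> dist \<omega> (\<zeta> + h) + norm h"
          using dist_triangle[of \<omega> \<zeta> "\<zeta> + h"] by (simp add: dist_norm)
        then show ?thesis using that(2) Wn[OF that(1)] \<delta> \<delta>0 by simp
      qed
      show "\<beta> \<in> borel_measurable borel" unfolding \<beta>_def by measurable
      show "ennreal (cmod (\<integral>\<zeta>. g (\<zeta> + (h - k)) * cnj (g \<zeta>) \<partial>lborel)) \<le> \<beta> (h - k)"
        if "h \<in> W" "k \<in> W" for h k
      proof -
        have "\<bar>(h - k) $ i\<bar> \<le> 1 / (2 * s) + 1 / (2 * s)"
          using Wc[OF that(1), of i] Wc[OF that(2), of i] by (simp add: a_def)
        then have "\<bar>(h - k) $ i\<bar> \<le> 1 / s" using s by simp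
        then show ?thesis unfolding \<beta>_def by (intro ennreal_leI corr)
      qed
    qed simp_all
    moreover have "kernel \<delta> \<alpha> x \<mu> \<omega> y = (\<integral>\<zeta>. g \<zeta> \<partial>lborel)" by (simp add: kernel_def g_def b_def)
    moreover have "measure lborel (cball \<omega> (1 + real n)) = V"
      by (simp add: content_cball V_def vol_def n_def)
    ultimately have "ennreal (1 / s * (cmod (kernel \<delta> \<alpha> x \<mu> \<omega> y))\<^sup>2) \<le> ennreal (V * (P * (1 / s) ^ n * J))"
      using V by (simp add: mW int\<beta> ennreal_mult')
    then have "1 / s * (cmod (kernel \<delta> \<alpha> x \<mu> \<omega> y))\<^sup>2 \<le> V * (P * (1 / s) ^ n * J)"
      using V P s J(2) by (subst (asm) ennreal_le_iff) auto
    then have "(cmod (kernel \<delta> \<alpha> x \<mu> \<omega> y))\<^sup>2 \<le> (V * P0 * J) * (MB\<^sup>2 * (s * (1 / s) ^ n))"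
      using s by (simp add: P_def field_simps)
    also have "s * (1 / s) ^ n = (s powr (- (real n - 1) / 2))\<^sup>2"
    proof -
      have "(s powr (- (real n - 1) / 2))\<^sup>2 = s powr (1 - real n)"
        unfolding power2_eq_square powr_add[symmetric]
        by (rule arg_cong[of _ _ "\<lambda>e. s powr e"]) (simp add: field_simps)
      also have "\<dots> = s * (1 / s) ^ n"
        using s by (simp add: powr_diff powr_realpow power_one_over)
      finally show ?thesis by simp
    qed
    also have "(V * P0 * J) * (MB\<^sup>2 * (s powr (- (real n - 1) / 2))\<^sup>2) = (sqrt (V * P0 * J) * MB * s powr (- (real n - 1) / 2))\<^sup>2"
    proof -
      have "(sqrt (V * P0 * J))\<^sup>2 = V * P0 * J" using V P0 J(2) by simp
      then show ?thesis by (simp only: power_mult_distrib mult.assoc)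
    qed
    finally have "cmod (kernel \<delta> \<alpha> x \<mu> \<omega> y) \<le> sqrt (V * P0 * J) * MB * s powr (- (real n - 1) / 2)"
    proof (rule power2_le_imp_le)
      show "0 \<le> sqrt (V * P0 * J) * MB * s powr (- (real n - 1) / 2)"
        using V P0 J(2) MB by (intro mult_nonneg_nonneg) simp_all
    qed
    also have "\<dots> = sqrt (V * P0 * J) * Ca * A * \<mu> powr (m - \<rho> * (real CARD('n) - 1) / 2)"
    proof -
      have "\<mu> powr m * s powr (- (real n - 1) / 2) = \<mu> powr (m - \<rho> * (real CARD('n) - 1) / 2)"
        unfolding s_def powr_powr powr_add[symmetric]
        by (rule arg_cong[of _ _ "\<lambda>e. \<mu> powr e"]) (simp add: n_def field_simps)
      then show ?thesis by (simp only: MB_def mult.assoc)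
    qed
    finally show "cmod (kernel \<delta> \<alpha> x \<mu> \<omega> y) \<le> sqrt (V * P0 * J) * Ca * A * \<mu> powr (m - \<rho> * (real CARD('n) - 1) / 2)" .
  qed
qed

end

section \<open>Null sets and measurability\<close>

lemma dense_sequence:
  obtains d :: "nat \<Rightarrow> 'a::{second_countable_topology}"
  where "\<And>X. open X \<Longrightarrow> X \<noteq> {} \<Longrightarrow> \<exists>k. d k \<in> X"
proof -
  obtain D :: "'a set" where D: "countable D" "\<And>X. open X \<Longrightarrow> X \<noteq> {} \<Longrightarrow> \<exists>d\<in>D. d \<in> X"
    by (rule countable_dense_setE) blast
  have "D \<noteq> {}" using D(2)[of UNIV] by auto
  then have "range (from_nat_into D) = D" using D(1) by (simp add: range_from_nat_into)
  then have "\<exists>k. from_nat_into D k \<in> X" if "open X" "X \<noteq> {}" for X using D(2)[OF that] by (metis imageE)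
  then show ?thesis by (rule that)
qed

text \<open>A function that is measurable in one variable and continuous in the other is a limit of
  functions \<open>f x (d (g \<xi>))\<close> with \<open>g\<close> countably valued, hence jointly measurable.\<close>

lemma measurable_continuous_imp_jointly_measurable:
  fixes f :: "'a \<Rightarrow> 'b::{second_countable_topology, metric_space} \<Rightarrow> 'c::metric_space"
  assumes meas: "\<And>\<xi>. (\<lambda>x. f x \<xi>) \<in> borel_measurable M" and cont: "\<And>x. continuous_on UNIV (f x)"
  shows "(\<lambda>p. f (fst p) (snd p)) \<in> borel_measurable (M \<Otimes>\<^sub>M borel)"
proof -
  obtain d :: "nat \<Rightarrow> 'b" where d: "\<And>X. open X \<Longrightarrow> X \<noteq> {} \<Longrightarrow> \<exists>k. d k \<in> X"
    by (rule dense_sequence) blast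
  define g where "g k \<xi> = (LEAST j. dist (d j) \<xi> < 1 / (real k + 1))" for k :: nat and \<xi>
  have g: "dist (d (g k \<xi>)) \<xi> < 1 / (real k + 1)" for k \<xi>
  proof -
    have "ball \<xi> (1 / (real k + 1)) \<noteq> {}" by simp
    then obtain j where "d j \<in> ball \<xi> (1 / (real k + 1))" using d[OF open_ball] by blast
    then have "dist (d j) \<xi> < 1 / (real k + 1)" by (simp add: dist_commute)
    then show ?thesis unfolding g_def by (rule LeastI)
  qed
  have gm[measurable]: "g k \<in> measurable borel (count_space UNIV)" for k
    unfolding g_def by measurable
  show ?thesis
  proof (rule borel_measurable_LIMSEQ_metric)
    show "(\<lambda>p. f (fst p) (d (g k (snd p)))) \<in> borel_measurable (M \<Otimes>\<^sub>M borel)" for k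
    proof (rule measurable_compose_countable[where f="\<lambda>i p. f (fst p) (d i)" and g="\<lambda>p. g k (snd p)"])
      show "(\<lambda>p. f (fst p) (d i)) \<in> borel_measurable (M \<Otimes>\<^sub>M borel)" for i
        using meas[of "d i"] by (rule measurable_compose[OF measurable_fst])
    qed measurable
    show "(\<lambda>k. f (fst p) (d (g k (snd p)))) \<longlonglongrightarrow> f (fst p) (snd p)" for p
    proof -
      have "(\<lambda>k. d (g k (snd p))) \<longlonglongrightarrow> snd p"
      proof (rule tendstoI)
        fix e :: real assume "0 < e"
        then obtain k0 where k0: "1 / (real k0 + 1) < e"
          using nat_approx_posE by (metis of_nat_Suc add.commute)
        show "\<forall>\<^sub>F k in sequentially. dist (d (g k (snd p))) (snd p) < e"
        proof (rule eventually_sequentiallyI)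
          fix k assume "k0 \<le> k"
          then have "1 / (real k + 1) \<le> 1 / (real k0 + 1)" by (intro divide_left_mono) auto
          then show "dist (d (g k (snd p))) (snd p) < e" using g[of k "snd p"] k0 by linarith
        qed
      qed
      then show ?thesis
        by (rule continuous_on_tendsto_compose[OF cont]) auto
    qed
  qed
qed

text \<open>For a pure derivative the enumeration of the coordinates is immaterial.\<close>

lemma mderiv_pure: "mderiv (\<lambda>i. if i = j then k else 0) f = (partial j ^^ k) f"
proof -
  have "\<exists>is :: 'a list. distinct is \<and> set is = UNIV"
    using finite_distinct_list[of "UNIV :: 'a set"] by auto
  then have "distinct (coords :: 'a list) \<and> set (coords :: 'a list) = UNIV"
    unfolding coords_def by (rule someI_ex)
  then have c: "distinct (coords :: 'a list)" "set (coords :: 'a list) = UNIV" by blast+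
  have "foldr (\<lambda>i. partial i ^^ (if i = j then k else 0)) is f = (if j \<in> set is then (partial j ^^ k) f else f)"
    if "distinct is" for "is"
    using that by (induction "is") auto
  from this[OF c(1)] show ?thesis by (simp add: mderiv_def c(2))
qed

lemma mlength_pure: "mlength (\<lambda>i. if i = j then k else 0) = k"
  by (simp add: mlength_def)

lemma japanese_pos: "0 < japanese \<xi>"
  by (simp add: japanese_def add_pos_nonneg)

lemma continuous_on_japanese: "continuous_on S japanese"
  unfolding japanese_def by (intro continuous_intros)

text \<open>The exceptional null set in the definition of the symbol class depends on \<open>\<xi>\<close>; continuity in \<open>\<xi>\<close>
  allows to use only countably many of them.\<close>

lemma symbol_class_AE_symbol_bound:
  fixes a :: "real^'n::finite \<Rightarrow> real^'n \<Rightarrow> complex"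
  assumes "a \<in> symbol_class m \<rho>"
  shows "\<exists>A\<ge>0. AE x in lebesgue. symbol_bound N m \<rho> A (a x)"
proof -
  note a = assms[unfolded symbol_class_def mem_Collect_eq]
  have sm: "smooth_on UNIV (a x)" for x using a[THEN conjunct1] by (rule spec)
  define P where "P j k B \<longleftrightarrow> (AE x in lebesgue. \<forall>\<xi>. cmod ((partial j ^^ k) (a x) \<xi>) \<le> B * japanese \<xi> powr (m - \<rho> * real k))"
    for j k and B :: real
  have one: "\<exists>B\<ge>0. P j k B" for j k
  proof -
    define L where "L \<xi> = Linf_norm (\<lambda>x. (partial j ^^ k) (a x) \<xi>)" for \<xi>
    define e where "e = - m + \<rho> * real k"
    define S where "S = (SUP \<xi>. ennreal (japanese \<xi> powr e) * L \<xi>)"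
    have "S < \<infinity>"
    proof -
      from spec[OF a[THEN conjunct2, THEN conjunct2], of "\<lambda>i. if i = j then k else 0"]
      show ?thesis unfolding mderiv_pure mlength_pure S_def L_def e_def .
    qed
    then obtain B where B: "S = ennreal B" "0 \<le> B" by (cases S) auto
    have pt: "AE x in lebesgue. cmod ((partial j ^^ k) (a x) \<xi>) \<le> B * japanese \<xi> powr (m - \<rho> * real k)" for \<xi>
    proof -
      have "AE x in lebesgue. ennreal (cmod ((partial j ^^ k) (a x) \<xi>)) \<le> L \<xi>"
        unfolding L_def Linf_norm_def by (rule esssup_AE)
      then show ?thesis
      proof eventually_elim
        case (elim x)
        have "ennreal (japanese \<xi> powr e * cmod ((partial j ^^ k) (a x) \<xi>)) \<le> ennreal (japanese \<xi> powr e) * L \<xi>"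
          using elim by (simp add: ennreal_mult' mult_left_mono)
        also have "\<dots> \<le> ennreal B" unfolding B(1)[symmetric] S_def by (rule SUP_upper) simp
        finally have "japanese \<xi> powr e * cmod ((partial j ^^ k) (a x) \<xi>) \<le> B" using B(2) by simp
        then have "cmod ((partial j ^^ k) (a x) \<xi>) \<le> B / japanese \<xi> powr e"
          using japanese_pos[of \<xi>] by (simp add: pos_le_divide_eq mult.commute)
        also have "\<dots> = B * japanese \<xi> powr (- e)" by (simp add: powr_minus divide_inverse)
        finally show ?case by (simp add: e_def)
      qed
    qed
    obtain d :: "nat \<Rightarrow> real^'n" where d: "\<And>X. open X \<Longrightarrow> X \<noteq> {} \<Longrightarrow> \<exists>i. d i \<in> X"
      by (rule dense_sequence) blast
    have "AE x in lebesgue. \<forall>i. cmod ((partial j ^^ k) (a x) (d i)) \<le> B * japanese (d i) powr (m - \<rho> * real k)"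
      by (intro AE_all_countable[THEN iffD2] allI pt)
    then have "AE x in lebesgue. \<forall>\<xi>. cmod ((partial j ^^ k) (a x) \<xi>) \<le> B * japanese \<xi> powr (m - \<rho> * real k)"
    proof eventually_elim
      case (elim x)
      define X where "X = {\<xi>. B * japanese \<xi> powr (m - \<rho> * real k) < cmod ((partial j ^^ k) (a x) \<xi>)}"
      have c: "continuous_on UNIV ((partial j ^^ k) (a x))"
        by (rule smooth_on_continuous[OF smooth_on_partial[OF sm]])
      have nz: "japanese \<xi> \<noteq> 0" for \<xi> :: "real^'n" using japanese_pos[of \<xi>] by simp
      have "open X" unfolding X_def
        by (intro open_Collect_less continuous_intros continuous_on_japanese c)
           (simp_all add: nz)
      moreover have "d i \<notin> X" for i using elim by (simp add: X_def not_less)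
      ultimately have "X = {}" using d[of X] by blast
      then show ?case by (auto simp: X_def not_less)
    qed
    then show ?thesis using B(2) unfolding P_def by (intro exI[of _ B] conjI)
  qed
  then obtain B where B0: "\<And>j k. 0 \<le> B j k" "\<And>j k. P j k (B j k)" by metis
  then have B: "\<And>j k. 0 \<le> B j k"
    "\<And>j k. AE x in lebesgue. \<forall>\<xi>. cmod ((partial j ^^ k) (a x) \<xi>) \<le> B j k * japanese \<xi> powr (m - \<rho> * real k)"
    by (simp_all only: P_def)
  define A where "A = (\<Sum>k\<le>N. \<Sum>j\<in>UNIV. B j k)"
  have le: "B j k \<le> A" if "k \<le> N" for j k
  proof -
    have "B j k \<le> (\<Sum>j\<in>UNIV. B j k)" using B(1) by (intro member_le_sum) auto
    also have "\<dots> \<le> A" unfolding A_def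
      using B(1) that by (intro member_le_sum[where f="\<lambda>k. \<Sum>j\<in>UNIV. B j k"]) (auto intro: sum_nonneg)
    finally show ?thesis .
  qed
  have "AE x in lebesgue. \<forall>k. \<forall>j. \<forall>\<xi>. cmod ((partial j ^^ k) (a x) \<xi>) \<le> B j k * japanese \<xi> powr (m - \<rho> * real k)"
    unfolding AE_all_countable using B(2) by blast
  then have "AE x in lebesgue. symbol_bound N m \<rho> A (a x)"
  proof eventually_elim
    case (elim x)
    have "cmod ((partial j ^^ k) (a x) \<xi>) \<le> A * japanese \<xi> powr (m - \<rho> * real k)" if "k \<le> N" for j k \<xi>
      using elim[rule_format, where j=j and k=k and \<xi>=\<xi>] mult_right_mono[OF le[OF that, of j], of "japanese \<xi> powr (m - \<rho> * real k)"]
      by simp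
    then show ?case using sm by (simp add: symbol_bound_def)
  qed
  moreover have "0 \<le> A" unfolding A_def by (intro sum_nonneg B(1))
  ultimately show ?thesis by blast
qed

lemma integral_lebesgue_eq_lborel:
  fixes f :: "'a::euclidean_space \<Rightarrow> 'b::{banach, second_countable_topology}"
  shows "f \<in> borel_measurable borel \<Longrightarrow> integral\<^sup>L lebesgue f = integral\<^sup>L lborel f"
  by (rule integral_completion) simp

lemma fourier_eq_lborel:
  assumes "continuous_on UNIV u"
  shows "fourier u \<xi> = (\<integral>y. cis (- (y \<bullet> \<xi>)) * u y \<partial>lborel)"
  unfolding fourier_def
  by (intro integral_lebesgue_eq_lborel borel_measurable_continuous_onI continuous_intros assms)

lemma borel_measurable_fourier:
  assumes "continuous_on UNIV u"
  shows "fourier u \<in> borel_measurable borel"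
proof -
  have [measurable]: "(\<lambda>(\<xi>, y). cis (- (y \<bullet> \<xi>)) * u y) \<in> borel_measurable (borel \<Otimes>\<^sub>M lborel)"
  proof -
    have "continuous_on UNIV (\<lambda>p. cis (- (snd p \<bullet> fst p)) * u (snd p))"
      by (intro continuous_intros continuous_on_compose2[OF assms]) auto
    then have "(\<lambda>p. cis (- (snd p \<bullet> fst p)) * u (snd p)) \<in> borel_measurable (borel \<Otimes>\<^sub>M borel)"
      unfolding borel_prod by (rule borel_measurable_continuous_onI)
    then show ?thesis by (simp add: split_beta' cong: measurable_cong_sets)
  qed
  have "(\<lambda>\<xi>. \<integral>y. cis (- (y \<bullet> \<xi>)) * u y \<partial>lborel) \<in> borel_measurable borel"
    by measurable
  then show ?thesis by (simp add: fourier_eq_lborel[OF assms] cong: measurable_cong)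
qed

context homogeneous_phase
begin

lemma borel_measurable_phase: "(\<lambda>p. indicator punctured p *\<^sub>R \<phi> (fst p) (snd p)) \<in> borel_measurable borel"
proof -
  have "open punctured" by (intro open_Times) auto
  moreover have "continuous_on punctured (\<lambda>p. \<phi> (fst p) (snd p))"
    using continuous_on_D[of undefined 0] by (simp add: phase_deriv_def split_beta')
  ultimately show ?thesis by (intro borel_measurable_continuous_on_indicator) auto
qed

text \<open>The values \<open>\<phi> x 0\<close> are arbitrary and need not be measurable in \<open>x\<close>.  They are removed by an indicator
  function, which changes the integrand on a null set only.\<close>

lemma FIO_eq_lborel:
  assumes a: "continuous_on UNIV (a x)" and u: "continuous_on UNIV u"
  shows "FIO a \<phi> u x = complex_of_real ((2 * pi) powr (- real CARD('n))) *
     (\<integral>\<xi>. cis (indicator punctured (x, \<xi>) *\<^sub>R \<phi> x \<xi>) * a x \<xi> * fourier u \<xi> \<partial>lborel)"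
proof -
  have [measurable]: "fourier u \<in> borel_measurable borel" "a x \<in> borel_measurable borel"
    using u a by (auto intro: borel_measurable_fourier borel_measurable_continuous_onI)
  have [measurable]: "(\<lambda>\<xi>. indicator punctured (x, \<xi>) *\<^sub>R \<phi> x \<xi>) \<in> borel_measurable borel"
  proof -
    have "Pair x \<in> borel_measurable borel" by (intro borel_measurable_continuous_onI continuous_intros)
    from measurable_compose[OF this borel_measurable_phase] show ?thesis by (simp only: fst_conv snd_conv)
  qed
  have cis[measurable]: "cis \<in> borel_measurable borel"
    by (intro borel_measurable_continuous_onI continuous_intros)
  define F where "F \<xi> = cis (indicator punctured (x, \<xi>) *\<^sub>R \<phi> x \<xi>) * a x \<xi> * fourier u \<xi>" for \<xi>
  have F[measurable]: "F \<in> borel_measurable borel" unfolding F_def by measurable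
  have "AE \<xi> in lebesgue. \<xi> \<noteq> (0 :: real^'n)" by (intro AE_completion AE_lborel_singleton)
  then have ae: "AE \<xi> in lebesgue. cis (\<phi> x \<xi>) * a x \<xi> * fourier u \<xi> = F \<xi>"
    by eventually_elim (simp add: F_def)
  have Fl: "F \<in> borel_measurable lebesgue" using F by (intro measurable_completion) simp
  moreover have "(\<lambda>\<xi>. cis (\<phi> x \<xi>) * a x \<xi> * fourier u \<xi>) \<in> borel_measurable lebesgue"
    by (rule borel_measurable_AE[OF Fl]) (use ae in eventually_elim, simp)
  ultimately have "(\<integral>\<xi>. cis (\<phi> x \<xi>) * a x \<xi> * fourier u \<xi> \<partial>lebesgue) = integral\<^sup>L lebesgue F"
    using ae by (intro integral_cong_AE) auto
  also have "\<dots> = integral\<^sup>L lborel F" using F by (rule integral_lebesgue_eq_lborel)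
  finally show ?thesis by (simp only: FIO_def F_def[abs_def])
qed

lemma FIO_measurable:
  assumes am: "\<And>\<xi>. (\<lambda>x. a x \<xi>) \<in> borel_measurable lebesgue" and ac: "\<And>x. continuous_on UNIV (a x)"
    and u: "continuous_on UNIV u"
  shows "FIO a \<phi> u \<in> borel_measurable lebesgue"
proof -
  have [measurable]: "fourier u \<in> borel_measurable borel" using u by (rule borel_measurable_fourier)
  have cis[measurable]: "cis \<in> borel_measurable borel"
    by (intro borel_measurable_continuous_onI continuous_intros)
  have [measurable]: "(\<lambda>p. a (fst p) (snd p)) \<in> borel_measurable (lebesgue \<Otimes>\<^sub>M borel)"
    by (rule measurable_continuous_imp_jointly_measurable[OF am ac])
  have id: "(\<lambda>p. p) \<in> measurable (lebesgue \<Otimes>\<^sub>M borel) ((borel :: (real^'n) measure) \<Otimes>\<^sub>M (borel :: (real^'n) measure))"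
    by (intro measurable_pair) (auto simp: o_def intro!: measurable_compose[OF measurable_fst] measurable_completion)
  have [measurable]: "(\<lambda>p. indicator punctured p *\<^sub>R \<phi> (fst p) (snd p)) \<in> borel_measurable (lebesgue \<Otimes>\<^sub>M borel)"
    using measurable_compose[OF id borel_measurable_phase[folded borel_prod]] .
  have "(\<lambda>p. cis (indicator punctured p *\<^sub>R \<phi> (fst p) (snd p)) * a (fst p) (snd p) * fourier u (snd p))
      \<in> borel_measurable (lebesgue \<Otimes>\<^sub>M borel)"
    by measurable
  then have "(\<lambda>(x, \<xi>). cis (indicator punctured (x, \<xi>) *\<^sub>R \<phi> x \<xi>) * a x \<xi> * fourier u \<xi>)
      \<in> borel_measurable (lebesgue \<Otimes>\<^sub>M lborel)"
    by (simp add: split_beta' cong: measurable_cong_sets)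
  from lborel.borel_measurable_lebesgue_integral[OF this]
  have [measurable]: "(\<lambda>x. \<integral>\<xi>. cis (indicator punctured (x, \<xi>) *\<^sub>R \<phi> x \<xi>) * a x \<xi> * fourier u \<xi> \<partial>lborel) \<in> borel_measurable lebesgue"
    by simp
  have "(\<lambda>x. complex_of_real ((2 * pi) powr (- real CARD('n))) *
     (\<integral>\<xi>. cis (indicator punctured (x, \<xi>) *\<^sub>R \<phi> x \<xi>) * a x \<xi> * fourier u \<xi> \<partial>lborel)) \<in> borel_measurable lebesgue"
    by measurable
  moreover have "FIO a \<phi> u = (\<lambda>x. complex_of_real ((2 * pi) powr (- real CARD('n))) *
     (\<integral>\<xi>. cis (indicator punctured (x, \<xi>) *\<^sub>R \<phi> x \<xi>) * a x \<xi> * fourier u \<xi> \<partial>lborel))"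
    by (rule ext) (rule FIO_eq_lborel[OF ac u])
  ultimately show ?thesis by (simp only:)
qed

end

section \<open>Decay of the localized kernels\<close>

text \<open>Interpolation between the trivial bound and \<open>n\<close> integrations by parts.\<close>

lemma min_power_le_powr:
  fixes t :: real
  assumes "0 < t" "0 \<le> s" "s \<le> real n"
  shows "min 1 (1 / t ^ n) \<le> t powr (- s)"
proof (cases "t \<le> 1")
  case True
  then have "1 \<le> t powr (- s)" using assms powr_mono2'[of "- s" t 1] by simp
  then show ?thesis by simp
next
  case False
  then have "1 / t ^ n = t powr (- real n)" using assms by (simp add: powr_minus powr_realpow divide_inverse)
  also have "\<dots> \<le> t powr (- s)" using False assms by (intro powr_mono) auto
  finally show ?thesis by simp
qed

text \<open>The dependence of the kernel bounds on the size of the frequency.  It is integrable in \<open>n\<close>-space when \<open>s < n < e\<close>.\<close>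

definition tail_weight :: "real \<Rightarrow> real \<Rightarrow> real \<Rightarrow> real" where
  "tail_weight s e \<mu> = (if \<mu> \<le> 1 then \<mu> powr (- s) else \<mu> powr (- e))"

lemma tail_weight_nonneg: "0 \<le> tail_weight s e \<mu>"
  by (simp add: tail_weight_def)

lemma tail_weight_integral_finite:
  assumes "0 \<le> s" "s < real DIM('a)" "real DIM('a) < e"
  shows "(\<integral>\<^sup>+\<eta>. ennreal (tail_weight s e (norm (\<eta>::'a::euclidean_space))) \<partial>lborel) < \<infinity>"
proof -
  define n where "n = DIM('a)"
  have large: "(\<integral>\<^sup>+\<eta>. ennreal ((1 + norm (\<eta>::'a)) powr (- e)) * 1 \<partial>lebesgue) < \<infinity>"
  proof (rule nn_integral_decay_finite)
    show "(\<integral>\<^sup>+y\<in>ball (0::'a) (2 ^ k). 1 \<partial>lebesgue) \<le> ennreal (unit_ball_vol (real n) * (2 ^ n) ^ k)" for k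
      by (simp add: emeasure_ball n_def power_mult[symmetric] mult.commute)
    have "(2::real) ^ n = 2 powr real n" by (simp add: powr_realpow)
    also have "\<dots> < 2 powr e" using assms(3) by (simp add: n_def)
    finally show "(2::real) ^ n < 2 powr e" .
  qed (use assms in auto)
  have "(\<integral>\<^sup>+\<eta>. ennreal (tail_weight s e (norm (\<eta>::'a))) \<partial>lborel) \<le>
      (\<integral>\<^sup>+\<eta>. ennreal (norm (\<eta>::'a) powr (- s)) * indicator (cball 0 1) \<eta> + ennreal (2 powr e) * ennreal ((1 + norm \<eta>) powr (- e)) \<partial>lborel)"
  proof (rule nn_integral_mono)
    fix \<eta> :: 'a
    show "ennreal (tail_weight s e (norm \<eta>)) \<le> ennreal (norm \<eta> powr (- s)) * indicator (cball 0 1) \<eta> + ennreal (2 powr e) * ennreal ((1 + norm \<eta>) powr (- e))"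
    proof (cases "norm \<eta> \<le> 1")
      case True
      then show ?thesis by (simp add: tail_weight_def)
    next
      case False
      then have n1: "1 < norm \<eta>" by simp
      have "(2 * norm \<eta>) powr (- e) \<le> (1 + norm \<eta>) powr (- e)"
        using n1 assms by (intro powr_mono2') auto
      then have "2 powr e * (2 * norm \<eta>) powr (- e) \<le> 2 powr e * (1 + norm \<eta>) powr (- e)"
        by (intro mult_left_mono) auto
      moreover have "2 powr e * (2 * norm \<eta>) powr (- e) = norm \<eta> powr (- e)"
        by (simp add: powr_mult powr_minus)
      ultimately show ?thesis using False
        by (simp add: tail_weight_def ennreal_mult'[symmetric] ennreal_leI)
    qed
  qed
  also have "\<dots> = (\<integral>\<^sup>+\<eta>\<in>cball (0::'a) 1. ennreal (norm \<eta> powr (- s)) \<partial>lborel) +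
      ennreal (2 powr e) * (\<integral>\<^sup>+\<eta>. ennreal ((1 + norm (\<eta>::'a)) powr (- e)) \<partial>lborel)"
  proof (subst nn_integral_add)
    show "(\<lambda>\<eta>::'a. ennreal (norm \<eta> powr (- s)) * indicator (cball 0 1) \<eta>) \<in> borel_measurable lborel"
      by (intro borel_measurable_times_ennreal borel_measurable_indicator measurable_compose[OF _ measurable_ennreal]) auto
  qed (simp_all add: nn_integral_cmult)
  also have "\<dots> < \<infinity>"
    using nn_integral_singularity_finite[OF assms(1,2)] large
    by (simp add: nn_integral_completion ennreal_mult_less_top)
  finally show ?thesis .
qed

context homogeneous_phase
begin

text \<open>High frequencies: stationary phase for bounded \<open>y\<close> and \<open>n\<close> integrations by parts for large \<open>y\<close>, each with
  a factor \<open>\<mu> powr (- e)\<close>, where \<open>e > n\<close> is the order condition.  Low frequencies: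
  \<open>min 1 (1 / (\<mu> * norm y) ^ n)\<close> is at most \<open>(\<mu> * norm y) powr (- s)\<close>; larger \<open>s\<close> gives more decay in \<open>y\<close>
  and a worse singularity at \<open>\<mu> = 0\<close>.\<close>

lemma kernel_bound:
  assumes K: "compact K" and \<rho>: "0 \<le> \<rho>" "\<rho> \<le> 1"
    and m: "m < - ((real CARD('n) + 1) / 2) * \<rho> + real CARD('n) * (\<rho> - 1)"
  shows "\<exists>\<delta>. 0 < \<delta> \<and> \<delta> < 1 / 4 \<and> (\<exists>e>real CARD('n). \<exists>C\<ge>0. \<forall>s A \<alpha> x \<mu> \<omega> y. 0 \<le> s \<longrightarrow> s \<le> real CARD('n) \<longrightarrow>
    0 \<le> A \<longrightarrow> symbol_bound (Suc CARD('n)) m \<rho> A \<alpha> \<longrightarrow> x \<in> K \<longrightarrow> 0 < \<mu> \<longrightarrow> norm \<omega> = 1 \<longrightarrow>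
    cmod (kernel \<delta> \<alpha> x \<mu> \<omega> y) \<le> C * A * (1 + norm y) powr (- s) * tail_weight s e \<mu>)"
proof -
  define n where "n = CARD('n)"
  obtain c \<delta>0 where c: "0 < c" and \<delta>0: "0 < \<delta>0" "\<delta>0 \<le> 1 / 2" and sep: "\<And>x \<omega> i h. x \<in> K \<Longrightarrow> norm \<omega> = 1 \<Longrightarrow>
      1 \<le> real CARD('n) * \<bar>\<omega> $ i\<bar> \<Longrightarrow> 2 * real CARD('n) * \<bar>h $ i\<bar> \<le> norm h \<Longrightarrow>
      \<exists>j. \<forall>\<zeta>. \<zeta> \<in> ball \<omega> \<delta>0 \<longrightarrow> \<zeta> + h \<in> ball \<omega> \<delta>0 \<longrightarrow> c * norm h \<le> \<bar>D j 1 (x, \<zeta> + h) - D j 1 (x, \<zeta>)\<bar>"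
    using gradient_separation[OF K] by blast
  define \<delta> where "\<delta> = \<delta>0 / 4"
  have \<delta>: "0 < \<delta>" "\<delta> < 1 / 4" "2 * \<delta> < \<delta>0" using \<delta>0 by (auto simp: \<delta>_def)
  obtain C1 R where C1: "0 \<le> C1" "1 \<le> R" and C1': "\<forall>A \<alpha> x \<mu> \<omega> y. 0 \<le> A \<longrightarrow> symbol_bound (Suc CARD('n)) m \<rho> A \<alpha> \<longrightarrow>
      x \<in> K \<longrightarrow> 0 < \<mu> \<longrightarrow> norm \<omega> = 1 \<longrightarrow>
      cmod (kernel \<delta> \<alpha> x \<mu> \<omega> y) \<le> C1 * A * symbol_size m \<mu> \<and>
      (R \<le> norm y \<longrightarrow> cmod (kernel \<delta> \<alpha> x \<mu> \<omega> y) \<le>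
        C1 * A * symbol_size m \<mu> / (\<mu> / symbol_scale \<rho> \<mu> * norm y) ^ CARD('n))"
    using kernel_bound_large_y[OF K \<rho> \<delta>(1,2), of m] by (elim exE conjE) (rule that)
  have "\<exists>C\<ge>0. \<forall>A \<alpha> x \<mu> \<omega> y. 0 \<le> A \<longrightarrow> symbol_bound (Suc CARD('n)) m \<rho> A \<alpha> \<longrightarrow> x \<in> K \<longrightarrow> 1 \<le> \<mu> \<longrightarrow> norm \<omega> = 1 \<longrightarrow>
    cmod (kernel \<delta> \<alpha> x \<mu> \<omega> y) \<le> C * A * \<mu> powr (m - \<rho> * (real CARD('n) - 1) / 2)"
    by (rule kernel_bound_stationary[OF K \<rho> c \<delta>0(2) _ \<delta>(1,3)], rule sep)
  then obtain C2 where C2: "0 \<le> C2" and C2': "\<forall>A \<alpha> x \<mu> \<omega> y. 0 \<le> A \<longrightarrow> symbol_bound (Suc CARD('n)) m \<rho> A \<alpha> \<longrightarrow> x \<in> K \<longrightarrow> 1 \<le> \<mu> \<longrightarrow> norm \<omega> = 1 \<longrightarrow>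
    cmod (kernel \<delta> \<alpha> x \<mu> \<omega> y) \<le> C2 * A * \<mu> powr (m - \<rho> * (real CARD('n) - 1) / 2)"
    by (elim exE conjE) (rule that)
  define e where "e = - (m - \<rho> * (real n - 1) / 2)"
  have e: "real n < e" using m by (simp add: e_def n_def field_simps)
  define C where "C = (C1 + C2) * (1 + R) ^ n"
  have R: "1 \<le> (1 + R) ^ n" "2 ^ n \<le> (1 + R) ^ n" using C1(2) by (auto intro!: one_le_power power_mono)
  have bound: "cmod (kernel \<delta> \<alpha> x \<mu> \<omega> y) \<le> C * A * (1 + norm y) powr (- s) * tail_weight s e \<mu>"
    if s: "0 \<le> s" "s \<le> real CARD('n)" and A: "0 \<le> A" "symbol_bound (Suc CARD('n)) m \<rho> A \<alpha>"
      and x: "x \<in> K" and \<mu>: "0 < \<mu>" and \<omega>: "norm \<omega> = 1" for s A \<alpha> x \<mu> \<omega> y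
  proof -
    define k where "k = cmod (kernel \<delta> \<alpha> x \<mu> \<omega> y)"
    note k1 = C1'[rule_format, OF A x \<mu> \<omega>, of y, folded k_def]
    define z where "z = (1 + norm y) powr (- s)"
    have y0: "0 < 1 + norm y" by (simp add: add_pos_nonneg)
    then have z: "0 < z" by (simp add: z_def)
    have zs: "(1 + norm y) powr s * z = 1" using y0 by (simp add: z_def powr_minus)
    have near: "1 \<le> (1 + R) ^ n * z" if "norm y < R"
    proof -
      have "(1 + norm y) powr s \<le> (1 + R) powr real n"
        using that s C1(2) by (intro order_trans[OF powr_mono2[of s "1 + norm y" "1 + R"] powr_mono]) (auto simp: n_def)
      also have "\<dots> = (1 + R) ^ n" using C1(2) by (simp add: powr_realpow)
      finally have "(1 + norm y) powr s * z \<le> (1 + R) ^ n * z" using z by (intro mult_right_mono) auto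
      then show ?thesis by (simp only: zs)
    qed
    have far: "norm y powr (- s) \<le> (1 + R) ^ n * z" if "R \<le> norm y"
    proof -
      have y: "1 \<le> norm y" using that C1(2) by simp
      then have "(2 * norm y) powr (- s) \<le> z" unfolding z_def using s y by (intro powr_mono2') auto
      then have "2 powr s * (2 * norm y) powr (- s) \<le> 2 powr s * z" by (intro mult_left_mono) auto
      moreover have "2 powr s * (2 * norm y) powr (- s) = norm y powr (- s)"
        by (simp add: powr_mult powr_minus)
      ultimately have "norm y powr (- s) \<le> 2 powr s * z" by simp
      also have "2 powr s \<le> 2 powr real n" using s by (simp add: n_def)
      then have "2 powr s \<le> (1 + R) ^ n" using R(2) by (simp add: powr_realpow)
      then have "2 powr s * z \<le> (1 + R) ^ n * z" using z by (intro mult_right_mono) auto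
      finally show ?thesis .
    qed
    have "k \<le> (C1 + C2) * A * ((1 + R) ^ n * z * tail_weight s e \<mu>)"
    proof (cases "\<mu> \<le> 1")
      case True
      have tw: "tail_weight s e \<mu> = \<mu> powr (- s)" using True by (simp add: tail_weight_def)
      have "1 \<le> \<mu> powr (- s)" using True \<mu> s powr_mono2'[of "- s" \<mu> 1] by simp
      have one: "symbol_size m \<mu> = 1" "symbol_scale \<rho> \<mu> = 1" using True by (simp_all add: symbol_size_def symbol_scale_def)
      have "k \<le> C1 * A * ((1 + R) ^ n * z * \<mu> powr (- s))"
      proof (cases "norm y < R")
        case near': True
        have "k \<le> C1 * A * (1 * 1)" using k1 by (simp add: one)
        also have "\<dots> \<le> C1 * A * ((1 + R) ^ n * z * \<mu> powr (- s))"
          using near[OF near'] \<open>1 \<le> \<mu> powr (- s)\<close> C1(1) A(1) by (intro mult_left_mono mult_mono) auto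
        finally show ?thesis .
      next
        case False
        then have y: "R \<le> norm y" "0 < norm y" using C1(2) by auto
        have "k \<le> C1 * A * min 1 (1 / (\<mu> * norm y) ^ n)"
          using k1 y(1) C1(1) A(1) by (simp add: one n_def min_def)
        also have "\<dots> \<le> C1 * A * (\<mu> * norm y) powr (- s)"
          using min_power_le_powr[of "\<mu> * norm y" s n] \<mu> y s C1(1) A(1)
          by (intro mult_left_mono) (auto simp: n_def)
        also have "\<dots> = C1 * A * (norm y powr (- s) * \<mu> powr (- s))" using \<mu> by (simp add: powr_mult)
        also have "\<dots> \<le> C1 * A * ((1 + R) ^ n * z * \<mu> powr (- s))"
          using far[OF y(1)] C1(1) A(1) by (intro mult_left_mono mult_right_mono) auto
        finally show ?thesis .
      qed
      also have "\<dots> \<le> (C1 + C2) * A * ((1 + R) ^ n * z * \<mu> powr (- s))"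
        using C2 A(1) z C1(2) by (intro mult_right_mono) auto
      finally show ?thesis by (simp add: tw)
    next
      case False
      then have \<mu>1: "1 \<le> \<mu>" by simp
      have tw: "tail_weight s e \<mu> = \<mu> powr (- e)" using False by (simp add: tail_weight_def)
      show ?thesis
      proof (cases "norm y < R")
        case True
        have "k \<le> C2 * A * \<mu> powr (- e)"
          using C2'[rule_format, OF A x \<mu>1 \<omega>, of y] by (simp add: k_def e_def n_def)
        also have "\<dots> = C2 * A * (1 * \<mu> powr (- e))" by simp
        also have "\<dots> \<le> (C1 + C2) * A * ((1 + R) ^ n * z * \<mu> powr (- e))"
          using near[OF True] C1(1) C2 A(1) by (intro mult_mono mult_right_mono) auto
        finally show ?thesis by (simp add: tw)
      next
        case False': False
        then have y: "R \<le> norm y" "1 \<le> norm y" using C1(2) by auto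
        have sc: "\<mu> / symbol_scale \<rho> \<mu> = \<mu> powr \<rho>"
          using False by (simp add: symbol_scale_def powr_diff)
        have sz: "symbol_size m \<mu> = \<mu> powr m" using False by (simp add: symbol_size_def)
        have "k \<le> C1 * A * \<mu> powr m / (\<mu> powr \<rho> * norm y) ^ n"
          using k1 y(1) by (simp add: sc sz n_def)
        also have "\<dots> = C1 * A * ((1 / norm y ^ n) * \<mu> powr (m - \<rho> * real n))"
        proof -
          have "(\<mu> powr \<rho>) ^ n = \<mu> powr (\<rho> * real n)"
            using \<mu> by (simp add: powr_powr powr_realpow[symmetric])
          then show ?thesis by (simp add: power_mult_distrib powr_diff)
        qed
        also have "\<dots> \<le> C1 * A * (((1 + R) ^ n * z) * \<mu> powr (- e))"
        proof (intro mult_left_mono mult_mono)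
          have "norm y powr real n = norm y ^ n" using y(2) by (intro powr_realpow) linarith
          then have "1 / norm y ^ n = norm y powr (- real n)" by (simp add: powr_minus divide_inverse)
          also have "\<dots> \<le> norm y powr (- s)" using y s by (intro powr_mono) (auto simp: n_def)
          also have "\<dots> \<le> (1 + R) ^ n * z" by (rule far[OF y(1)])
          finally show "1 / norm y ^ n \<le> (1 + R) ^ n * z" .
          have "\<rho> * (real n - 1) / 2 \<le> \<rho> * real n"
            using \<rho>(1) mult_left_mono[of "(real n - 1) / 2" "real n" \<rho>] by simp
          then show "\<mu> powr (m - \<rho> * real n) \<le> \<mu> powr (- e)"
            using \<mu>1 by (intro powr_mono) (auto simp: e_def)
        qed (use C1(1,2) A(1) z in auto)
        also have "\<dots> \<le> (C1 + C2) * A * (((1 + R) ^ n * z) * \<mu> powr (- e))"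
          using C2 A(1) z C1(2) by (intro mult_right_mono) auto
        finally show ?thesis by (simp add: tw)
      qed
    qed
    then show ?thesis by (simp add: k_def z_def C_def mult_ac)
  qed
  have "0 \<le> C" using C1(1,2) C2 by (simp add: C_def)
  then show ?thesis
    using \<delta> e bound unfolding n_def by (intro exI[of _ \<delta>] conjI exI[of _ e] exI[of _ C]) blast+
qed

end

section \<open>From kernels to a pointwise bound\<close>

lemma norm_integral_le_nn_integral:
  fixes f :: "'a \<Rightarrow> 'b::{banach, second_countable_topology}"
  shows "ennreal (norm (integral\<^sup>L M f)) \<le> (\<integral>\<^sup>+x. ennreal (norm (f x)) \<partial>M)"
  by (cases "integrable M f") (simp_all add: integral_norm_bound_ennreal not_integrable_integral_eq)

lemma integrable_lborel_pairI:
  fixes f :: "'a::euclidean_space \<times> 'b::euclidean_space \<Rightarrow> 'c::{banach, second_countable_topology}"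
  assumes f[measurable]: "f \<in> borel_measurable (lborel \<Otimes>\<^sub>M lborel)"
    and fin: "(\<integral>\<^sup>+x. (\<integral>\<^sup>+y. ennreal (norm (f (x, y))) \<partial>lborel) \<partial>lborel) < \<infinity>"
  shows "integrable (lborel \<Otimes>\<^sub>M lborel) f"
proof (rule integrableI_bounded[OF f])
  show "(\<integral>\<^sup>+p. ennreal (norm (f p)) \<partial>(lborel \<Otimes>\<^sub>M lborel)) < \<infinity>"
    using fin by (subst lborel.nn_integral_fst[symmetric]) auto
qed

context homogeneous_phase
begin

text \<open>Dilation by \<open>\<mu>\<close> and Fubini's theorem.  The powers of \<open>\<mu>\<close> from the change of variables and from the localizer
  cancel.\<close>

lemma localized_integral_eq_kernel:
  assumes \<delta>: "0 < \<delta>" "\<delta> < 1 / 4" and \<alpha>: "continuous_on UNIV \<alpha>"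
    and u: "continuous_on UNIV u" "integrable lborel u" and \<mu>: "0 < \<mu>" and \<omega>: "norm \<omega> = 1"
  shows "(\<integral>\<xi>. (cis (indicator punctured (x, \<xi>) *\<^sub>R \<phi> x \<xi>) * \<alpha> \<xi> * fourier u \<xi>) *
            of_real (localizer (Suc CARD('n)) \<delta> \<xi> (\<mu> *\<^sub>R \<omega>)) \<partial>lborel) =
         (\<integral>y. kernel \<delta> \<alpha> x \<mu> \<omega> y * u y \<partial>lborel)"
proof -
  let ?N = "Suc CARD('n)"
  define n where "n = CARD('n)"
  define P where "P \<xi> = indicator punctured (x, \<xi>) *\<^sub>R \<phi> x \<xi>" for \<xi>
  have cis[measurable]: "cis \<in> borel_measurable borel"
    by (intro borel_measurable_continuous_onI continuous_intros)
  have P[measurable]: "P \<in> borel_measurable borel"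
  proof -
    have "Pair x \<in> borel_measurable borel" by (intro borel_measurable_continuous_onI continuous_intros)
    from measurable_compose[OF this borel_measurable_phase] show ?thesis by (simp only: fst_conv snd_conv P_def[abs_def])
  qed
  have [measurable]: "fourier u \<in> borel_measurable borel" "\<alpha> \<in> borel_measurable borel" "u \<in> borel_measurable borel"
    using u(1) \<alpha> by (auto intro: borel_measurable_fourier borel_measurable_continuous_onI)
  have [measurable]: "(\<lambda>\<zeta>. localizer ?N \<delta> \<zeta> \<eta>) \<in> borel_measurable borel" for \<eta> :: "real^'n"
    unfolding localizer_def by measurable
  define a where "a = amplitude \<delta> \<alpha> \<mu> \<omega>"
  have am[measurable]: "a \<in> borel_measurable borel" unfolding a_def amplitude_def[abs_def] by measurable
  have a0: "a \<zeta> = 0" if "\<zeta> \<notin> cball \<omega> (2 * \<delta>)" for \<zeta>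
    unfolding a_def using amplitude_eq_0[OF that \<delta>(1) _ \<omega>] \<delta> by simp
  have aint: "integrable lborel a"
  proof -
    have "bounded ((\<lambda>\<zeta>. \<alpha> (\<mu> *\<^sub>R \<zeta>)) ` cball \<omega> (2 * \<delta>))"
      by (intro compact_imp_bounded compact_continuous_image continuous_on_compose2[OF \<alpha>] continuous_intros) auto
    then obtain M where M: "\<forall>y\<in>(\<lambda>\<zeta>. \<alpha> (\<mu> *\<^sub>R \<zeta>)) ` cball \<omega> (2 * \<delta>). cmod y \<le> M" "0 < M"
      unfolding bounded_pos by blast
    obtain C where C: "0 \<le> C" "\<And>\<omega> e. norm (\<omega> :: real^'n) = 1 \<Longrightarrow> norm e \<le> 1 \<Longrightarrow>
        bounded_derivs e (ball \<omega> (1 / 2)) ?N C (\<lambda>\<zeta>. localizer ?N \<delta> \<zeta> \<omega>)"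
      using localizer_bounded_derivs[OF \<delta>(1), of ?N] by blast
    have "cmod (a \<zeta>) \<le> M * C" if "\<zeta> \<in> cball \<omega> (2 * \<delta>)" for \<zeta>
    proof -
      have "\<zeta> \<in> ball \<omega> (1 / 2)" using that \<delta> by simp
      then have "norm (localizer ?N \<delta> \<zeta> \<omega>) \<le> C" using bounded_derivs_bound[OF C(2)[OF \<omega>, of 0]] by simp
      then show ?thesis unfolding a_def amplitude_def norm_mult using M that by (intro mult_mono) auto
    qed
    then show ?thesis using a0 by (intro integrable_bounded_compact_support[OF compact_cball am])
  qed
  have Pz: "cis (P (\<mu> *\<^sub>R \<zeta>)) * a \<zeta> = cis (\<mu> * \<phi> x \<zeta>) * a \<zeta>" for \<zeta>
  proof (cases "\<zeta> = 0")
    case True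
    then have "a \<zeta> = 0" by (simp add: a_def amplitude_def localizer_def)
    then show ?thesis by simp
  next
    case False
    then show ?thesis using \<mu> homogeneous[of \<zeta> \<mu> x] by (simp add: P_def)
  qed
  let ?L = "\<lambda>\<xi>. (cis (P \<xi>) * \<alpha> \<xi> * fourier u \<xi>) * of_real (localizer ?N \<delta> \<xi> (\<mu> *\<^sub>R \<omega>))"
  have "(\<integral>\<xi>. ?L \<xi> \<partial>lborel) = \<bar>\<mu>\<bar> ^ DIM(real^'n) *\<^sub>R (\<integral>\<zeta>. ?L (0 + \<mu> *\<^sub>R \<zeta>) \<partial>lborel)"
    using \<mu> by (intro integral_lborel_affine) auto
  also have "\<dots> = (\<integral>\<zeta>. \<mu> ^ n *\<^sub>R ?L (\<mu> *\<^sub>R \<zeta>) \<partial>lborel)" using \<mu> by (simp add: n_def)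
  also have "\<dots> = (\<integral>\<zeta>. cis (\<mu> * \<phi> x \<zeta>) * a \<zeta> * fourier u (\<mu> *\<^sub>R \<zeta>) \<partial>lborel)"
  proof (rule Bochner_Integration.integral_cong[OF refl])
    fix \<zeta>
    have "\<mu> ^ n * \<mu> powr (- real n) = 1" using \<mu> by (simp add: powr_minus powr_realpow)
    then have "\<mu> ^ n *\<^sub>R ?L (\<mu> *\<^sub>R \<zeta>) = cis (P (\<mu> *\<^sub>R \<zeta>)) * \<alpha> (\<mu> *\<^sub>R \<zeta>) * fourier u (\<mu> *\<^sub>R \<zeta>) * of_real (localizer ?N \<delta> \<zeta> \<omega>)"
      unfolding localizer_scale[OF \<mu>] by (simp add: n_def scaleR_conv_of_real flip: of_real_mult of_real_power)
    also have "\<dots> = (cis (P (\<mu> *\<^sub>R \<zeta>)) * a \<zeta>) * fourier u (\<mu> *\<^sub>R \<zeta>)" by (simp add: a_def amplitude_def)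
    finally show "\<mu> ^ n *\<^sub>R ?L (\<mu> *\<^sub>R \<zeta>) = cis (\<mu> * \<phi> x \<zeta>) * a \<zeta> * fourier u (\<mu> *\<^sub>R \<zeta>)" unfolding Pz .
  qed
  also have "\<dots> = (\<integral>\<zeta>. (\<integral>y. cis (\<mu> * \<phi> x \<zeta>) * a \<zeta> * (cis (- (y \<bullet> (\<mu> *\<^sub>R \<zeta>))) * u y) \<partial>lborel) \<partial>lborel)"
    by (simp add: fourier_eq_lborel[OF u(1)])
  also have "\<dots> = (\<integral>\<zeta>. (\<integral>y. cis (P (\<mu> *\<^sub>R \<zeta>)) * a \<zeta> * (cis (- (y \<bullet> (\<mu> *\<^sub>R \<zeta>))) * u y) \<partial>lborel) \<partial>lborel)"
    by (simp only: Pz)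
  also have "\<dots> = (\<integral>y. (\<integral>\<zeta>. cis (P (\<mu> *\<^sub>R \<zeta>)) * a \<zeta> * (cis (- (y \<bullet> (\<mu> *\<^sub>R \<zeta>))) * u y) \<partial>lborel) \<partial>lborel)"
  proof (rule lborel_pair.Fubini_integral[symmetric], rule integrable_lborel_pairI)
    show "(\<lambda>(\<zeta>, y). cis (P (\<mu> *\<^sub>R \<zeta>)) * a \<zeta> * (cis (- (y \<bullet> (\<mu> *\<^sub>R \<zeta>))) * u y)) \<in> borel_measurable (lborel \<Otimes>\<^sub>M lborel)"
      by measurable
    have "(\<integral>\<^sup>+\<zeta>. (\<integral>\<^sup>+y. ennreal (cmod (cis (P (\<mu> *\<^sub>R \<zeta>)) * a \<zeta> * (cis (- (y \<bullet> (\<mu> *\<^sub>R \<zeta>))) * u y))) \<partial>lborel) \<partial>lborel) =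
        (\<integral>\<^sup>+\<zeta>. ennreal (cmod (a \<zeta>)) * (\<integral>\<^sup>+y. ennreal (cmod (u y)) \<partial>lborel) \<partial>lborel)"
      by (simp add: norm_mult ennreal_mult nn_integral_cmult)
    also have "\<dots> = (\<integral>\<^sup>+\<zeta>. ennreal (cmod (a \<zeta>)) \<partial>lborel) * (\<integral>\<^sup>+y. ennreal (cmod (u y)) \<partial>lborel)"
      by (rule nn_integral_multc) measurable
    also have "\<dots> < \<infinity>" using aint u(2) unfolding integrable_iff_bounded by (simp add: ennreal_mult_less_top)
    finally show "(\<integral>\<^sup>+\<zeta>. (\<integral>\<^sup>+y. ennreal (cmod (case (\<zeta>, y) of (\<zeta>, y) \<Rightarrow>
        cis (P (\<mu> *\<^sub>R \<zeta>)) * a \<zeta> * (cis (- (y \<bullet> (\<mu> *\<^sub>R \<zeta>))) * u y))) \<partial>lborel) \<partial>lborel) < \<infinity>" by simp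
  qed
  also have "\<dots> = (\<integral>y. kernel \<delta> \<alpha> x \<mu> \<omega> y * u y \<partial>lborel)"
  proof (rule Bochner_Integration.integral_cong[OF refl])
    fix y
    have "(\<integral>\<zeta>. cis (P (\<mu> *\<^sub>R \<zeta>)) * a \<zeta> * (cis (- (y \<bullet> (\<mu> *\<^sub>R \<zeta>))) * u y) \<partial>lborel) =
        (\<integral>\<zeta>. (cis (\<mu> * (\<phi> x \<zeta> - y \<bullet> \<zeta>)) * a \<zeta>) * u y \<partial>lborel)"
    proof (rule Bochner_Integration.integral_cong[OF refl])
      fix \<zeta>
      have "cis (\<mu> * (\<phi> x \<zeta> - y \<bullet> \<zeta>)) = cis (\<mu> * \<phi> x \<zeta>) * cis (- (y \<bullet> (\<mu> *\<^sub>R \<zeta>)))"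
        unfolding cis_mult by (rule arg_cong[of _ _ cis]) (simp add: algebra_simps)
      then show "cis (P (\<mu> *\<^sub>R \<zeta>)) * a \<zeta> * (cis (- (y \<bullet> (\<mu> *\<^sub>R \<zeta>))) * u y) = (cis (\<mu> * (\<phi> x \<zeta> - y \<bullet> \<zeta>)) * a \<zeta>) * u y"
        unfolding Pz by (simp only: mult_ac)
    qed
    also have "\<dots> = kernel \<delta> \<alpha> x \<mu> \<omega> y * u y"
      unfolding kernel_def a_def[symmetric] by (rule integral_mult_left_zero)
    finally show "(\<integral>\<zeta>. cis (P (\<mu> *\<^sub>R \<zeta>)) * a \<zeta> * (cis (- (y \<bullet> (\<mu> *\<^sub>R \<zeta>))) * u y) \<partial>lborel) = kernel \<delta> \<alpha> x \<mu> \<omega> y * u y" .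
  qed
  finally show ?thesis by (simp only: P_def)
qed

text \<open>Insert the partition of unity, interchange the integrals and estimate each localized piece by its kernel.
  If the integrand or \<open>u\<close> is not integrable, the oscillatory integral is \<open>0\<close>, because divergent
  integrals have this value.\<close>

lemma oscillatory_integral_pointwise_bound:
  assumes \<delta>: "0 < \<delta>" "\<delta> < 1 / 4" and \<alpha>: "continuous_on UNIV \<alpha>" and u: "continuous_on UNIV u"
    and c0: "0 < c0" "\<And>\<xi>::real^'n. \<xi> \<noteq> 0 \<Longrightarrow> (\<integral>\<^sup>+\<eta>. ennreal (localizer (Suc CARD('n)) \<delta> \<xi> \<eta>) \<partial>lborel) = ennreal c0"
    and B: "0 \<le> B" "\<And>\<mu> \<omega> y. 0 < \<mu> \<Longrightarrow> norm \<omega> = 1 \<Longrightarrow>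
      cmod (kernel \<delta> \<alpha> x \<mu> \<omega> y) \<le> B * (1 + norm y) powr (- s) * tail_weight s e \<mu>"
  shows "ennreal (c0 * cmod (\<integral>\<xi>. cis (indicator punctured (x, \<xi>) *\<^sub>R \<phi> x \<xi>) * \<alpha> \<xi> * fourier u \<xi> \<partial>lborel)) \<le>
    ennreal B * (\<integral>\<^sup>+\<eta>. ennreal (tail_weight s e (norm (\<eta>::real^'n))) \<partial>lborel) *
    (\<integral>\<^sup>+y. ennreal ((1 + norm y) powr (- s) * cmod (u y)) \<partial>lborel)"
proof -
  define G where "G \<xi> = cis (indicator punctured (x, \<xi>) *\<^sub>R \<phi> x \<xi>) * \<alpha> \<xi> * fourier u \<xi>" for \<xi>
  define l where "l \<xi> \<eta> = localizer (Suc CARD('n)) \<delta> \<xi> \<eta>" for \<xi> \<eta> :: "real^'n"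
  define J where "J = (\<integral>\<^sup>+y. ennreal ((1 + norm y) powr (- s) * cmod (u y)) \<partial>lborel)"
  have um[measurable]: "u \<in> borel_measurable borel" using u by (rule borel_measurable_continuous_onI)
  consider "\<not> integrable lborel G" | "\<not> integrable lborel u" | "integrable lborel G" "integrable lborel u" by blast
  then have "ennreal (c0 * cmod (integral\<^sup>L lborel G)) \<le>
    ennreal B * (\<integral>\<^sup>+\<eta>. ennreal (tail_weight s e (norm (\<eta>::real^'n))) \<partial>lborel) * J"
  proof cases
    case 1
    then show ?thesis by (simp add: not_integrable_integral_eq)
  next
    case 2
    \<comment> \<open>then the integral defining the Fourier transform is \<open>0\<close> by convention\<close>
    have "fourier u \<xi> = 0" for \<xi>
    proof -
      have "\<not> integrable lborel (\<lambda>y. cis (- (y \<bullet> \<xi>)) * u y)"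
      proof
        assume "integrable lborel (\<lambda>y. cis (- (y \<bullet> \<xi>)) * u y)"
        then have "integrable lborel u"
          by (rule Bochner_Integration.integrable_bound) (auto simp: norm_mult)
        with 2 show False by simp
      qed
      then show ?thesis by (simp add: fourier_eq_lborel[OF u] not_integrable_integral_eq)
    qed
    then have "integral\<^sup>L lborel G = 0" by (simp add: G_def[abs_def])
    then show ?thesis by simp
  next
    case 3
    have Gm[measurable]: "G \<in> borel_measurable borel" using 3(1) borel_measurable_integrable by fastforce
    have lm[measurable]: "(\<lambda>p. l (fst p) (snd p)) \<in> borel_measurable (borel \<Otimes>\<^sub>M borel)"
      unfolding l_def by measurable
    have lm1[measurable]: "l \<xi> \<in> borel_measurable borel" for \<xi>
      unfolding l_def localizer_def by measurable
    have l0: "0 \<le> l \<xi> \<eta>" for \<xi> \<eta> by (simp add: l_def localizer_nonneg)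
    have lmass: "(\<integral>\<^sup>+\<eta>. ennreal (l \<xi> \<eta>) \<partial>lborel) \<le> ennreal c0" for \<xi>
      using c0(2)[of \<xi>] by (cases "\<xi> = 0") (simp_all add: l_def localizer_def)
    have F: "integrable (lborel \<Otimes>\<^sub>M lborel) (\<lambda>(\<xi>, \<eta>). G \<xi> * of_real (l \<xi> \<eta>))"
    proof (rule integrable_lborel_pairI)
      have "(\<lambda>p. G (fst p) * of_real (l (fst p) (snd p))) \<in> borel_measurable (borel \<Otimes>\<^sub>M borel)" by measurable
      then show "(\<lambda>(\<xi>, \<eta>). G \<xi> * of_real (l \<xi> \<eta>)) \<in> borel_measurable (lborel \<Otimes>\<^sub>M lborel)"
        by (simp add: split_beta' cong: measurable_cong_sets)
      have "(\<integral>\<^sup>+\<xi>. (\<integral>\<^sup>+\<eta>. ennreal (cmod (G \<xi> * of_real (l \<xi> \<eta>))) \<partial>lborel) \<partial>lborel) =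
          (\<integral>\<^sup>+\<xi>. ennreal (cmod (G \<xi>)) * (\<integral>\<^sup>+\<eta>. ennreal (l \<xi> \<eta>) \<partial>lborel) \<partial>lborel)"
        using l0 by (intro nn_integral_cong) (simp add: norm_mult ennreal_mult nn_integral_cmult)
      also have "\<dots> \<le> (\<integral>\<^sup>+\<xi>. ennreal (cmod (G \<xi>)) * ennreal c0 \<partial>lborel)"
        by (intro nn_integral_mono mult_left_mono lmass) simp
      also have "\<dots> = (\<integral>\<^sup>+\<xi>. ennreal (cmod (G \<xi>)) \<partial>lborel) * ennreal c0"
        by (rule nn_integral_multc) measurable
      also have "\<dots> < \<infinity>" using 3(1) unfolding integrable_iff_bounded by (simp add: ennreal_mult_less_top)
      finally show "(\<integral>\<^sup>+\<xi>. (\<integral>\<^sup>+\<eta>. ennreal (cmod (case (\<xi>, \<eta>) of (\<xi>, \<eta>) \<Rightarrow> G \<xi> * of_real (l \<xi> \<eta>))) \<partial>lborel) \<partial>lborel) < \<infinity>"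
        by simp
    qed
    have inner: "(\<integral>\<eta>. G \<xi> * of_real (l \<xi> \<eta>) \<partial>lborel) = G \<xi> * of_real c0" if "\<xi> \<noteq> 0" for \<xi>
    proof -
      have "(\<integral>\<eta>. l \<xi> \<eta> \<partial>lborel) = enn2real (ennreal c0)"
        using c0(2)[OF that] l0 by (subst integral_eq_nn_integral) (simp_all add: l_def[symmetric])
      then show ?thesis using c0(1) by simp
    qed
    have "integral\<^sup>L lborel G * of_real c0 = (\<integral>\<xi>. G \<xi> * of_real c0 \<partial>lborel)" by simp
    also have "\<dots> = (\<integral>\<xi>. (\<integral>\<eta>. G \<xi> * of_real (l \<xi> \<eta>) \<partial>lborel) \<partial>lborel)"
    proof (rule integral_cong_AE)
      show "(\<lambda>\<xi>. \<integral>\<eta>. G \<xi> * of_real (l \<xi> \<eta>) \<partial>lborel) \<in> borel_measurable lborel"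
        using lborel_pair.integrable_fst[OF F] by (rule borel_measurable_integrable)
      show "AE \<xi> in lborel. G \<xi> * of_real c0 = (\<integral>\<eta>. G \<xi> * of_real (l \<xi> \<eta>) \<partial>lborel)"
        using AE_lborel_singleton[of "0::real^'n"] by eventually_elim (rule inner[symmetric])
    qed measurable
    also have "\<dots> = (\<integral>\<eta>. (\<integral>\<xi>. G \<xi> * of_real (l \<xi> \<eta>) \<partial>lborel) \<partial>lborel)"
      by (rule lborel_pair.Fubini_integral[OF F, symmetric])
    finally have eq: "integral\<^sup>L lborel G * of_real c0 = (\<integral>\<eta>. (\<integral>\<xi>. G \<xi> * of_real (l \<xi> \<eta>) \<partial>lborel) \<partial>lborel)" .
    have "ennreal (c0 * cmod (integral\<^sup>L lborel G)) = ennreal (cmod (integral\<^sup>L lborel G * of_real c0))"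
      using c0(1) by (simp add: norm_mult mult.commute)
    also have "\<dots> \<le> (\<integral>\<^sup>+\<eta>. ennreal (cmod (\<integral>\<xi>. G \<xi> * of_real (l \<xi> \<eta>) \<partial>lborel)) \<partial>lborel)"
      unfolding eq by (rule norm_integral_le_nn_integral)
    also have "\<dots> \<le> (\<integral>\<^sup>+\<eta>. (ennreal B * J) * ennreal (tail_weight s e (norm (\<eta>::real^'n))) \<partial>lborel)"
    proof (rule nn_integral_mono_AE)
      show "AE \<eta> in lborel. ennreal (cmod (\<integral>\<xi>. G \<xi> * of_real (l \<xi> \<eta>) \<partial>lborel)) \<le>
          (ennreal B * J) * ennreal (tail_weight s e (norm (\<eta>::real^'n)))"
        using AE_lborel_singleton[of "0::real^'n"]
      proof eventually_elim
        case (elim \<eta>)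
        define \<mu> where "\<mu> = norm \<eta>"
        define \<omega> where "\<omega> = (1 / norm \<eta>) *\<^sub>R \<eta>"
        have \<mu>: "0 < \<mu>" and \<omega>: "norm \<omega> = 1" and \<eta>: "\<eta> = \<mu> *\<^sub>R \<omega>" using elim by (auto simp: \<mu>_def \<omega>_def)
        have "(\<integral>\<xi>. G \<xi> * of_real (l \<xi> \<eta>) \<partial>lborel) = (\<integral>y. kernel \<delta> \<alpha> x \<mu> \<omega> y * u y \<partial>lborel)"
          unfolding G_def l_def \<eta> by (rule localized_integral_eq_kernel[OF \<delta> \<alpha> u 3(2) \<mu> \<omega>])
        then have "ennreal (cmod (\<integral>\<xi>. G \<xi> * of_real (l \<xi> \<eta>) \<partial>lborel)) \<le> (\<integral>\<^sup>+y. ennreal (cmod (kernel \<delta> \<alpha> x \<mu> \<omega> y * u y)) \<partial>lborel)"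
          by (simp only: norm_integral_le_nn_integral)
        also have "\<dots> \<le> (\<integral>\<^sup>+y. (ennreal B * ennreal (tail_weight s e \<mu>)) * ennreal ((1 + norm y) powr (- s) * cmod (u y)) \<partial>lborel)"
        proof (rule nn_integral_mono)
          fix y :: "real^'n"
          have "cmod (kernel \<delta> \<alpha> x \<mu> \<omega> y * u y) \<le> (B * (1 + norm y) powr (- s) * tail_weight s e \<mu>) * cmod (u y)"
            unfolding norm_mult by (intro mult_right_mono B(2) \<mu> \<omega>) simp
          then have "ennreal (cmod (kernel \<delta> \<alpha> x \<mu> \<omega> y * u y)) \<le> ennreal ((B * tail_weight s e \<mu>) * ((1 + norm y) powr (- s) * cmod (u y)))"
            by (intro ennreal_leI) (simp add: mult_ac)
          also have "\<dots> = (ennreal B * ennreal (tail_weight s e \<mu>)) * ennreal ((1 + norm y) powr (- s) * cmod (u y))"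
            using B(1) tail_weight_nonneg by (simp add: ennreal_mult)
          finally show "ennreal (cmod (kernel \<delta> \<alpha> x \<mu> \<omega> y * u y)) \<le>
              (ennreal B * ennreal (tail_weight s e \<mu>)) * ennreal ((1 + norm y) powr (- s) * cmod (u y))" .
        qed
        also have "\<dots> = (ennreal B * ennreal (tail_weight s e \<mu>)) * J"
          unfolding J_def by (rule nn_integral_cmult) measurable
        finally show ?case by (simp add: \<mu>_def mult_ac)
      qed
    qed
    also have "\<dots> = (ennreal B * J) * (\<integral>\<^sup>+\<eta>. ennreal (tail_weight s e (norm (\<eta>::real^'n))) \<partial>lborel)"
      unfolding tail_weight_def by (rule nn_integral_cmult) measurable
    finally show ?thesis by (simp add: mult_ac)
  qed
  then show ?thesis by (simp only: G_def[abs_def] J_def)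
qed

end

section \<open>Weighted bounds\<close>

lemma epowr_mono: "0 \<le> r \<Longrightarrow> x \<le> y \<Longrightarrow> epowr x r \<le> epowr y r"
  by (cases y; cases x) (auto simp: epowr_def top_unique intro!: ennreal_leI powr_mono2)

text \<open>Hoelder's inequality with the weight split as \<open>w powr (1 / p) * w powr (- (1 / p))\<close>.\<close>

lemma weighted_average_le_Lpw_norm:
  fixes w :: "real^'n::finite \<Rightarrow> real" and u :: "real^'n \<Rightarrow> complex"
  assumes p: "1 < p" and w: "w \<in> Ap_weights p" and u[measurable]: "u \<in> borel_measurable lebesgue"
  shows "(\<integral>\<^sup>+y. ennreal ((1 + norm y) powr (- s) * cmod (u y)) \<partial>lebesgue) \<le>
    epowr (\<integral>\<^sup>+y. ennreal ((1 + norm y) powr (- (s * (p / (p - 1))))) * ennreal (w y powr (- 1 / (p - 1))) \<partial>lebesgue) (1 / (p / (p - 1)))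
      * Lpw_norm p w u"
proof -
  define q where "q = p / (p - 1)"
  have q: "1 < q" "1 / p + 1 / q = 1" "q / p = 1 / (p - 1)"
    using p by (auto simp: q_def field_simps)
  have [measurable]: "w \<in> borel_measurable lebesgue" using w by (rule Ap_weight_measurable)
  have [measurable]: "(norm :: real^'n \<Rightarrow> real) \<in> borel_measurable lebesgue" by (intro measurable_completion) simp
  have wpos: "0 < w x" for x using w by (simp add: Ap_weights_def)
  define f where "f y = cmod (u y) * w y powr (1 / p)" for y
  define g where "g y = (1 + norm y) powr (- s) * w y powr (- (1 / p))" for y
  have "(1 + norm y) powr (- s) * cmod (u y) = f y * g y" for y
    using wpos[of y] by (simp add: f_def g_def powr_minus)
  moreover have "f y powr p = cmod (u y) powr p * w y" for y
    using wpos[of y] p by (simp add: f_def powr_mult powr_powr)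
  moreover have "ennreal (g y powr q) = ennreal ((1 + norm y) powr (- (s * q))) * ennreal (w y powr (- 1 / (p - 1)))" for y
  proof -
    have "g y powr q = (1 + norm y) powr (- (s * q)) * w y powr (- (q / p))"
      by (simp add: g_def powr_mult powr_powr)
    then show ?thesis unfolding q(3) by (simp add: ennreal_mult)
  qed
  moreover have "(\<integral>\<^sup>+y. ennreal (f y * g y) \<partial>lebesgue) \<le>
      epowr (\<integral>\<^sup>+y. ennreal (f y powr p) \<partial>lebesgue) (1 / p) * epowr (\<integral>\<^sup>+y. ennreal (g y powr q) \<partial>lebesgue) (1 / q)"
    by (rule Holder_nn_integral) (use p q in \<open>auto simp: f_def g_def\<close>)
  ultimately show ?thesis by (simp add: Lpw_norm_def q_def mult.commute)
qed

text \<open>The right-hand side of the pointwise bound does not depend on \<open>x\<close>, so its \<open>L\<^sup>p\<close> norm over \<open>K\<close> costs only the mass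
  of \<open>w\<close> on \<open>K\<close>.\<close>

lemma bounded_on_Lpw_if_pointwise_bound:
  fixes w :: "real^'n::finite \<Rightarrow> real" and T :: "(real^'n \<Rightarrow> complex) \<Rightarrow> real^'n \<Rightarrow> complex"
  assumes p: "1 < p" and w: "w \<in> Ap_weights p" and K: "compact K" and M: "0 \<le> M"
    and meas: "\<And>u. schwartz u \<Longrightarrow> T u \<in> borel_measurable lebesgue"
    and out: "\<And>u x. schwartz u \<Longrightarrow> x \<notin> K \<Longrightarrow> T u x = 0"
    and bound: "\<And>u. schwartz u \<Longrightarrow> AE x in lebesgue. x \<in> K \<longrightarrow>
      ennreal (cmod (T u x)) \<le> ennreal M * (\<integral>\<^sup>+y. ennreal ((1 + norm y) powr (- s) * cmod (u y)) \<partial>lborel)"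
    and s: "(\<integral>\<^sup>+y. ennreal ((1 + norm y) powr (- (s * (p / (p - 1))))) * ennreal (w y powr (- 1 / (p - 1))) \<partial>lebesgue) < \<infinity>"
  shows "bounded_on_Lpw p w T"
proof -
  define H where "H = enn2real (epowr (\<integral>\<^sup>+y. ennreal ((1 + norm y) powr (- (s * (p / (p - 1))))) * ennreal (w y powr (- 1 / (p - 1))) \<partial>lebesgue) (1 / (p / (p - 1))))"
  have H: "epowr (\<integral>\<^sup>+y. ennreal ((1 + norm y) powr (- (s * (p / (p - 1))))) * ennreal (w y powr (- 1 / (p - 1))) \<partial>lebesgue) (1 / (p / (p - 1))) = ennreal H" "0 \<le> H"
    using s by (auto simp: H_def epowr_def)
  define W where "W = enn2real (\<integral>\<^sup>+x\<in>K. ennreal (w x) \<partial>lebesgue)"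
  have W: "(\<integral>\<^sup>+x\<in>K. ennreal (w x) \<partial>lebesgue) = ennreal W" "0 \<le> W"
    using Ap_weight_finite_on_compact[OF w K] by (auto simp: W_def)
  have wpos: "0 < w x" for x using w by (simp add: Ap_weights_def)
  have [measurable]: "w \<in> borel_measurable lebesgue" using w by (rule Ap_weight_measurable)
  have [measurable]: "K \<in> sets lebesgue" using K by (simp add: borel_compact)
  \<comment> \<open>the summand \<open>1\<close> keeps the product with an infinite norm infinite\<close>
  define C where "C = M * H * W powr (1 / p) + 1"
  have C: "0 < C" using M H(2) by (simp add: C_def add_nonneg_pos)
  have "Lpw_norm p w (T u) \<le> ennreal C * Lpw_norm p w u" if u: "schwartz u" for u
  proof (cases "Lpw_norm p w u = \<infinity>")
    case True
    then show ?thesis using C by (simp add: ennreal_mult_top)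
  next
    case False
    define L where "L = enn2real (Lpw_norm p w u)"
    have L: "Lpw_norm p w u = ennreal L" "0 \<le> L" using False by (auto simp: L_def less_top)
    have "continuous_on UNIV u" using u smooth_on_continuous by (auto simp: schwartz_def)
    then have um: "u \<in> borel_measurable lebesgue"
      by (intro measurable_completion) (simp add: borel_measurable_continuous_onI)
    have J: "(\<integral>\<^sup>+y. ennreal ((1 + norm y) powr (- s) * cmod (u y)) \<partial>lborel) \<le> ennreal (H * L)"
      using weighted_average_le_Lpw_norm[OF p w um, of s] H L
      by (simp add: nn_integral_completion ennreal_mult)
    have "AE x in lebesgue. ennreal (cmod (T u x) powr p * w x) \<le> ennreal ((M * (H * L)) powr p) * (ennreal (w x) * indicator K x)"
      using bound[OF u]
    proof eventually_elim
      case (elim x)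
      show ?case
      proof (cases "x \<in> K")
        case True
        then have "ennreal (cmod (T u x)) \<le> ennreal M * ennreal (H * L)"
          using elim mult_left_mono[OF J, of "ennreal M"] by (auto intro: order_trans)
        then have "cmod (T u x) \<le> M * (H * L)" using M H L by (simp add: ennreal_mult'[symmetric])
        then have "cmod (T u x) powr p * w x \<le> (M * (H * L)) powr p * w x"
          using p wpos[of x] by (intro mult_right_mono powr_mono2) auto
        then show ?thesis using True wpos[of x] by (simp add: ennreal_mult'[symmetric] ennreal_leI less_imp_le)
      next
        case False
        then show ?thesis using out[OF u] p by simp
      qed
    qed
    then have "(\<integral>\<^sup>+x. ennreal (cmod (T u x) powr p * w x) \<partial>lebesgue) \<le>
        (\<integral>\<^sup>+x. ennreal ((M * (H * L)) powr p) * (ennreal (w x) * indicator K x) \<partial>lebesgue)"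
      by (rule nn_integral_mono_AE)
    also have "\<dots> = ennreal ((M * (H * L)) powr p) * ennreal W"
      by (subst nn_integral_cmult) (auto simp: W(1))
    also have "\<dots> = ennreal ((M * (H * L)) powr p * W)" using W(2) by (simp add: ennreal_mult)
    finally have "Lpw_norm p w (T u) \<le> epowr (ennreal ((M * (H * L)) powr p * W)) (1 / p)"
      unfolding Lpw_norm_def using p by (intro epowr_mono) auto
    also have "\<dots> = ennreal ((M * H * W powr (1 / p)) * L)"
      using p M H(2) L(2) W(2) by (simp add: epowr_def powr_mult powr_powr mult_ac)
    also have "\<dots> \<le> ennreal (C * L)"
      using L(2) by (intro ennreal_leI mult_right_mono) (simp_all add: C_def)
    also have "\<dots> = ennreal C * Lpw_norm p w u" using C L by (simp add: ennreal_mult)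
    finally show ?thesis .
  qed
  then show ?thesis unfolding bounded_on_Lpw_def using C meas by (intro exI[of _ C]) auto
qed

theorem theorem3p4p1:
  fixes a :: "real^'n::finite \<Rightarrow> real^'n \<Rightarrow> complex"
    and \<phi> :: "real^'n \<Rightarrow> real^'n \<Rightarrow> real"
    and m \<rho> :: real
  assumes "\<rho> \<in> {0..1}"
    and "a \<in> symbol_class m \<rho>"
    and "m < - ((real CARD('n) + 1) / 2) * \<rho> + real CARD('n) * (\<rho> - 1)"
    and "compact (closure {x. \<exists>\<xi>. a x \<xi> \<noteq> 0})"
    and "smooth_on (UNIV \<times> (UNIV - {0})) (\<lambda>(x, \<xi>). \<phi> x \<xi>)"
    and "\<And>x \<xi> t. \<xi> \<noteq> 0 \<Longrightarrow> 0 < t \<Longrightarrow> \<phi> x (t *\<^sub>R \<xi>) = t * \<phi> x \<xi>"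
    and "\<And>x \<xi>. \<xi> \<noteq> 0 \<Longrightarrow> rank (hessian (\<phi> x) \<xi>) = CARD('n) - 1"
  shows "\<forall>p>1. \<forall>w\<in>Ap_weights p. bounded_on_Lpw p w (FIO a \<phi>)"
proof -
  interpret homogeneous_phase \<phi>
    using assms(5-7) by unfold_locales
  define K where "K = closure {x. \<exists>\<xi>. a x \<xi> \<noteq> 0}"
  have K: "compact K" using assms(4) by (simp add: K_def)
  have out: "a x \<xi> = 0" if "x \<notin> K" for x \<xi>
    using that closure_subset[of "{x. \<exists>\<xi>. a x \<xi> \<noteq> 0}"] by (auto simp: K_def)
  have \<rho>: "0 \<le> \<rho>" "\<rho> \<le> 1" using assms(1) by auto
  note sc = assms(2)[unfolded symbol_class_def mem_Collect_eq]
  have ac: "continuous_on UNIV (a x)" for x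
    by (rule smooth_on_continuous[OF sc[THEN conjunct1, THEN spec]])
  have am: "(\<lambda>x. a x \<xi>) \<in> borel_measurable lebesgue" for \<xi>
    by (rule sc[THEN conjunct2, THEN conjunct1, THEN spec])
  obtain \<delta> e C where \<delta>: "0 < \<delta>" "\<delta> < 1 / 4" and e: "real CARD('n) < e" and C: "0 \<le> C"
    and kb: "\<forall>s A \<alpha> x \<mu> \<omega> y. 0 \<le> s \<longrightarrow> s \<le> real CARD('n) \<longrightarrow>
    0 \<le> A \<longrightarrow> symbol_bound (Suc CARD('n)) m \<rho> A \<alpha> \<longrightarrow> x \<in> K \<longrightarrow> 0 < \<mu> \<longrightarrow> norm \<omega> = 1 \<longrightarrow>
    cmod (kernel \<delta> \<alpha> x \<mu> \<omega> y) \<le> C * A * (1 + norm y) powr (- s) * tail_weight s e \<mu>"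
    using kernel_bound[OF K \<rho> assms(3)] by (elim exE conjE) (rule that)
  obtain A where A: "0 \<le> A" "AE x in lebesgue. symbol_bound (Suc CARD('n)) m \<rho> A (a x)"
    using symbol_class_AE_symbol_bound[OF assms(2)] by blast
  obtain c0 where c0: "0 < c0" "\<And>\<xi>::real^'n. \<xi> \<noteq> 0 \<Longrightarrow> (\<integral>\<^sup>+\<eta>. ennreal (localizer (Suc CARD('n)) \<delta> \<xi> \<eta>) \<partial>lborel) = ennreal c0"
    using localizer_mass[OF \<delta>(1), of "Suc CARD('n)"] by blast
  show ?thesis
  proof (intro allI impI ballI)
    fix p :: real and w :: "real^'n \<Rightarrow> real" assume p: "1 < p" and w: "w \<in> Ap_weights p"
    obtain s where s: "0 \<le> s" "s < real CARD('n)"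
      "(\<integral>\<^sup>+y. ennreal ((1 + norm y) powr (- (s * (p / (p - 1))))) * ennreal (w y powr (- 1 / (p - 1))) \<partial>lebesgue) < \<infinity>"
      using Ap_dual_weight_decay[OF p w] .
    define I where "I = enn2real (\<integral>\<^sup>+\<eta>. ennreal (tail_weight s e (norm (\<eta>::real^'n))) \<partial>lborel)"
    have I: "(\<integral>\<^sup>+\<eta>. ennreal (tail_weight s e (norm (\<eta>::real^'n))) \<partial>lborel) = ennreal I" "0 \<le> I"
      using tail_weight_integral_finite[where 'a="real^'n", of s e] s e by (auto simp: I_def)
    define k where "k = (2 * pi) powr (- real CARD('n))"
    have k: "0 \<le> k" by (simp add: k_def)
    define M where "M = k / c0 * (C * A * I)"
    have M: "0 \<le> M" using k c0(1) C A(1) I(2) by (simp add: M_def)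
    show "bounded_on_Lpw p w (FIO a \<phi>)"
    proof (rule bounded_on_Lpw_if_pointwise_bound[OF p w K M _ _ _ s(3)])
      fix u :: "real^'n \<Rightarrow> complex" assume "schwartz u"
      then have u: "continuous_on UNIV u" using smooth_on_continuous by (auto simp: schwartz_def)
      show "FIO a \<phi> u \<in> borel_measurable lebesgue" by (rule FIO_measurable[OF am ac u])
      show "FIO a \<phi> u x = 0" if "x \<notin> K" for x using out[OF that] by (simp add: FIO_def)
      show "AE x in lebesgue. x \<in> K \<longrightarrow> ennreal (cmod (FIO a \<phi> u x)) \<le>
          ennreal M * (\<integral>\<^sup>+y. ennreal ((1 + norm y) powr (- s) * cmod (u y)) \<partial>lborel)"
        using A(2)
      proof eventually_elim
        case (elim x)
        show ?case
        proof
          assume x: "x \<in> K"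
          define X where "X = (\<integral>\<xi>. cis (indicator punctured (x, \<xi>) *\<^sub>R \<phi> x \<xi>) * a x \<xi> * fourier u \<xi> \<partial>lborel)"
          define J where "J = (\<integral>\<^sup>+y. ennreal ((1 + norm y) powr (- s) * cmod (u y)) \<partial>lborel)"
          have "ennreal (c0 * cmod X) \<le> ennreal (C * A) * ennreal I * J"
            unfolding X_def J_def I(1)[symmetric]
          proof (rule oscillatory_integral_pointwise_bound[OF \<delta> ac u c0])
            show "0 \<le> C * A" using C A(1) by simp
            show "cmod (kernel \<delta> (a x) x \<mu> \<omega> y) \<le> C * A * (1 + norm y) powr (- s) * tail_weight s e \<mu>"
              if "0 < \<mu>" "norm \<omega> = 1" for \<mu> \<omega> y
              using kb[rule_format, OF s(1) less_imp_le[OF s(2)] A(1) elim x that] .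
          qed
          then have "ennreal (k / c0) * ennreal (c0 * cmod X) \<le> ennreal (k / c0) * (ennreal (C * A) * ennreal I * J)"
            by (rule mult_left_mono) simp
          also have "ennreal (k / c0) * ennreal (c0 * cmod X) = ennreal (cmod (FIO a \<phi> u x))"
          proof -
            have "FIO a \<phi> u x = complex_of_real k * X"
              unfolding X_def k_def by (rule FIO_eq_lborel[OF ac u])
            then have "cmod (FIO a \<phi> u x) = k / c0 * (c0 * cmod X)"
              using k c0(1) by (simp add: norm_mult)
            then show ?thesis using k c0(1) by (simp only: ennreal_mult'[symmetric] divide_nonneg_pos)
          qed
          also have "ennreal (k / c0) * (ennreal (C * A) * ennreal I * J) = ennreal M * J"
          proof -
            have "ennreal M = ennreal (k / c0) * ennreal (C * A * I)"
              unfolding M_def using k c0(1) by (intro ennreal_mult') simp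
            also have "ennreal (C * A * I) = ennreal (C * A) * ennreal I"
              using C A(1) by (intro ennreal_mult') simp
            finally show ?thesis by (simp only: mult.assoc)
          qed
          finally show "ennreal (cmod (FIO a \<phi> u x)) \<le> ennreal M * J" .
        qed
      qed
    qed
  qed
qed

end
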